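(* Let $G$ be any finite simple graph. Fix an edge $e$ in $G$, and connect a new even cycle of length $2d\ge 4$ along $e$; let $H$ be the resulting graph and $R=\mathbb{K}[E(H)]$. Then $$\beta_{i,j}(R/I_H)=\beta_{i,j}(R/I_G)+\beta_{i-1,j-d}(R/I_G)\quad\text{for all } i,j\ge 0.$$
   Context: $\mathbb{K}$ is an algebraically closed field of characteristic zero. For a finite simple graph $G$ with vertices $V(G)=\{x_1,\ldots,x_n\}$ and edges $E(G)=\{e_1,\ldots,e_q\}$, the toric ideal $I_G$ is the kernel of the $\mathbb{K}$-algebra homomorphism $\mathbb{K}[E(G)]=\mathbb{K}[e_1,\ldots,e_q]\to\mathbb{K}[x_1,\ldots,x_n]$ sending $e_i=\{x_{i,1},x_{i,2}\}$ to $x_{i,1}x_{i,2}$; it is homogeneous for the standard grading $\deg e_i=1$. Connecting a new even cycle along $e$ means taking the disjoint union of $G$ and a cycle $C$ of length $2d$ and identifying $e$ with an edge of $C$ (together with its endpoints), i.e. adding to $G$ a path of length $2d-1$ joining the endpoints of $e$ through $2d-2$ new vertices. $I_G$ is viewed as an ideal of $R=\mathbb{K}[E(H)]$ by extension. $\beta_{i,j}(M)=\dim_{\mathbb{K}}\operatorname{Tor}_i^R(M,\mathbb{K})_j$, and $\beta_{i,j}=0$ if $i<0$ or $j<0$. *)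

theory Defs
  imports "HOL-Library.Poly_Mapping" "HOL-Computational_Algebra.Polynomial"
begin

abbreviation keys :: "('a \<Rightarrow>\<^sub>0 'b::zero) \<Rightarrow> 'a set" where
  "keys \<equiv> Poly_Mapping.keys"

abbreviation lookup :: "('a \<Rightarrow>\<^sub>0 'b::zero) \<Rightarrow> 'a \<Rightarrow> 'b" where
  "lookup \<equiv> Poly_Mapping.lookup"


subsection \<open>Graphs\<close>

record 'v graph =
  verts :: "'v set"
  edges :: "'v set set"

definition finite_simple_graph :: "'v graph \<Rightarrow> bool" where
  "finite_simple_graph G \<longleftrightarrow>
     finite (verts G) \<and>
     (\<forall>e\<in>edges G. e \<subseteq> verts G \<and> card e = 2)"

definition cycle_graph :: "nat \<Rightarrow> 'v graph \<Rightarrow> bool" where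
  "cycle_graph n C \<longleftrightarrow> n \<ge> 3 \<and>
     (\<exists>p. length p = n \<and> distinct p \<and> verts C = set p \<and>
          edges C = {{p ! k, p ! (Suc k mod n)} | k. k < n})"

text \<open>
  Instead of forming a disjoint union and identifying the edge \<^term>\<open>e\<close> of \<^term>\<open>G\<close> with an edge of
  the cycle, we take a copy of the cycle \<^term>\<open>C\<close> that already contains \<^term>\<open>e\<close> and shares with
  \<^term>\<open>G\<close> exactly the two endpoints of \<^term>\<open>e\<close>. As \<^term>\<open>e\<close> is then the only common edge,
  the union of \<^term>\<open>G\<close> and \<^term>\<open>C\<close> is the glued graph.
\<close>
definition cycle_connected_along :: "'v graph \<Rightarrow> 'v set \<Rightarrow> nat \<Rightarrow> 'v graph \<Rightarrow> bool" where
  "cycle_connected_along G e n H \<longleftrightarrow>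
     (\<exists>C. cycle_graph n C \<and> e \<in> edges G \<and> e \<in> edges C \<and> verts G \<inter> verts C = e \<and>
          H = \<lparr>verts = verts G \<union> verts C, edges = edges G \<union> edges C\<rparr>)"


subsection \<open>Polynomials in variables from a set\<close>

type_synonym ('x, 'k) mpoly = "('x \<Rightarrow>\<^sub>0 nat) \<Rightarrow>\<^sub>0 'k"

definition Var :: "'x \<Rightarrow> ('x, 'k::comm_ring_1) mpoly" where
  "Var x = Poly_Mapping.single (Poly_Mapping.single x 1) 1"

definition Const :: "'k \<Rightarrow> ('x, 'k::comm_ring_1) mpoly" where
  "Const c = Poly_Mapping.single 0 c"

text \<open>The polynomial ring \<open>\<bbbK>[X]\<close>, as a subring of the polynomials in all variables of type \<^typ>\<open>'x\<close>.\<close>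
definition poly_ring :: "'x set \<Rightarrow> ('x, 'k::comm_ring_1) mpoly set" where
  "poly_ring X = {p. \<forall>m\<in>keys p. keys m \<subseteq> X}"

definition mon_degree :: "('x \<Rightarrow>\<^sub>0 nat) \<Rightarrow> nat" where
  "mon_degree m = (\<Sum>x\<in>keys m. lookup m x)"

text \<open>The zero polynomial is homogeneous of every degree, and the only one of negative degree.\<close>
definition homogeneous :: "int \<Rightarrow> ('x, 'k::comm_ring_1) mpoly \<Rightarrow> bool" where
  "homogeneous n p \<longleftrightarrow> (\<forall>m\<in>keys p. int (mon_degree m) = n)"

text \<open>The \<open>\<bbbK>\<close>-algebra homomorphism that sends each variable \<^term>\<open>x\<close> to \<^term>\<open>f x\<close>.\<close>
definition mpoly_subst ::
  "('x \<Rightarrow> ('y, 'k) mpoly) \<Rightarrow> ('x, 'k) mpoly \<Rightarrow> ('y, 'k::comm_ring_1) mpoly" where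
  "mpoly_subst f p = (\<Sum>m\<in>keys p. Const (lookup p m) * (\<Prod>x\<in>keys m. f x ^ lookup m x))"

definition toric_ideal :: "'k itself \<Rightarrow> 'v graph \<Rightarrow> ('v set, 'k::comm_ring_1) mpoly set" where
  "toric_ideal _ G =
     {p \<in> poly_ring (edges G). mpoly_subst (\<lambda>e. \<Prod>v\<in>e. Var v :: ('v, 'k) mpoly) p = 0}"

text \<open>The ideal of \<open>\<bbbK>[X]\<close> generated by \<^term>\<open>A\<close>.\<close>
definition ideal_extension :: "'x set \<Rightarrow> ('x, 'k) mpoly set \<Rightarrow> ('x, 'k::comm_ring_1) mpoly set" where
  "ideal_extension X A =
     {\<Sum>g\<in>S. r g * g | r S. finite S \<and> S \<subseteq> A \<and> (\<forall>g\<in>S. r g \<in> poly_ring X)}"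


subsection \<open>Free modules\<close>

text \<open>An element of the free module on a set \<open>B\<close> of natural numbers is its finitely supported
  coefficient family.\<close>

definition scal :: "'r \<Rightarrow> ('b \<Rightarrow>\<^sub>0 'r) \<Rightarrow> ('b \<Rightarrow>\<^sub>0 'r::comm_ring_1)" where
  "scal r v = Poly_Mapping.map (\<lambda>s. r * s) v"

text \<open>The linear map that sends each basis element \<^term>\<open>b\<close> to \<^term>\<open>f b\<close>.\<close>
definition lin_ext :: "('b \<Rightarrow> ('c \<Rightarrow>\<^sub>0 'r)) \<Rightarrow> ('b \<Rightarrow>\<^sub>0 'r) \<Rightarrow> ('c \<Rightarrow>\<^sub>0 'r::comm_ring_1)" where
  "lin_ext f v = (\<Sum>b\<in>keys v. scal (lookup v b) (f b))"

definition free_module :: "'x set \<Rightarrow> 'b set \<Rightarrow> ('b \<Rightarrow>\<^sub>0 ('x, 'k::comm_ring_1) mpoly) set" where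
  "free_module X B = {v. keys v \<subseteq> B \<and> (\<forall>b\<in>B. lookup v b \<in> poly_ring X)}"


subsection \<open>Graded free resolutions of \<open>R/I\<close>\<close>

text \<open>
  In homological degree \<open>i\<close> the complex is the free module \<open>F\<^sub>i\<close> on \<open>basis F i\<close>, the basis
  element \<open>b\<close> having internal degree \<open>bdeg F i b\<close>; that is, \<open>F\<^sub>i\<close> is the direct sum of the shifts
  \<open>R(- bdeg F i b)\<close>. The image of \<open>b\<close> under \<open>F\<^bsub>i+1\<^esub> \<rightarrow> F\<^sub>i\<close> is \<open>diff F i b\<close> (so \<open>diff\<close> is indexed by
  its target), and \<open>aug F b\<close> represents the image of \<open>b\<close> under \<open>F\<^sub>0 \<rightarrow> R/I\<close>. The bases may be infinite.
\<close>
record (overloaded) ('x, 'k) free_complex =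
  basis :: "nat \<Rightarrow> nat set"
  bdeg :: "nat \<Rightarrow> nat \<Rightarrow> int"
  diff :: "nat \<Rightarrow> nat \<Rightarrow> nat \<Rightarrow>\<^sub>0 (('x \<Rightarrow>\<^sub>0 nat) \<Rightarrow>\<^sub>0 'k::comm_ring_1)"
  aug :: "nat \<Rightarrow> (('x \<Rightarrow>\<^sub>0 nat) \<Rightarrow>\<^sub>0 'k::comm_ring_1)"

definition aug_map ::
  "('x, 'k) free_complex \<Rightarrow> (nat \<Rightarrow>\<^sub>0 ('x, 'k) mpoly) \<Rightarrow> ('x, 'k::comm_ring_1) mpoly" where
  "aug_map F v = (\<Sum>b\<in>keys v. lookup v b * aug F b)"

text \<open>The last three conditions say that \<open>\<cdots> \<rightarrow> F\<^sub>1 \<rightarrow> F\<^sub>0 \<rightarrow> R/I \<rightarrow> 0\<close> is exact, where \<open>R = \<bbbK>[X]\<close>;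
  equality in \<open>R/I\<close> is congruence modulo \<open>I\<close>.\<close>
definition graded_free_resolution ::
  "'x set \<Rightarrow> ('x, 'k) mpoly set \<Rightarrow> ('x, 'k::comm_ring_1) free_complex \<Rightarrow> bool" where
  "graded_free_resolution X I F \<longleftrightarrow>
     (\<forall>b\<in>basis F 0. aug F b \<in> poly_ring X \<and> homogeneous (bdeg F 0 b) (aug F b)) \<and>
     (\<forall>i. \<forall>b\<in>basis F (Suc i). diff F i b \<in> free_module X (basis F i) \<and>
        (\<forall>c\<in>basis F i. homogeneous (bdeg F (Suc i) b - bdeg F i c) (lookup (diff F i b) c))) \<and>
     (\<forall>r\<in>poly_ring X. \<exists>v\<in>free_module X (basis F 0). aug_map F v - r \<in> I) \<and>
     {v \<in> free_module X (basis F 0). aug_map F v \<in> I} =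
       lin_ext (diff F 0) ` free_module X (basis F 1) \<and>
     (\<forall>i. {v \<in> free_module X (basis F (Suc i)). lin_ext (diff F i) v = 0} =
       lin_ext (diff F (Suc i)) ` free_module X (basis F (Suc (Suc i))))"


subsection \<open>Tor and graded Betti numbers\<close>

text \<open>
  \<open>\<bbbK>\<close> is the \<open>R\<close>-module on which every variable acts as zero, so \<open>F\<^sub>i \<otimes>\<^sub>R \<bbbK>\<close> is the vector space on
  the basis elements \<open>b \<otimes> 1\<close>, and a matrix entry of the induced differential is the constant
  coefficient of the original entry.
\<close>
definition tensor_diff ::
  "('x, 'k) free_complex \<Rightarrow> nat \<Rightarrow> (nat \<Rightarrow>\<^sub>0 'k) \<Rightarrow> (nat \<Rightarrow>\<^sub>0 'k::comm_ring_1)" where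
  "tensor_diff F i = lin_ext (\<lambda>b. Poly_Mapping.map (\<lambda>p. lookup p 0) (diff F i b))"

text \<open>The part of internal degree \<open>j\<close> of \<open>F\<^sub>i \<otimes>\<^sub>R \<bbbK>\<close>.\<close>
definition tensor_part :: "('x, 'k) free_complex \<Rightarrow> nat \<Rightarrow> int \<Rightarrow> (nat \<Rightarrow>\<^sub>0 'k::comm_ring_1) set" where
  "tensor_part F i j = {v. keys v \<subseteq> {b \<in> basis F i. bdeg F i b = j}}"

definition tor_cycles :: "('x, 'k) free_complex \<Rightarrow> nat \<Rightarrow> int \<Rightarrow> (nat \<Rightarrow>\<^sub>0 'k::comm_ring_1) set" where
  "tor_cycles F i j = (case i of
      0 \<Rightarrow> tensor_part F 0 j
    | Suc i' \<Rightarrow> {v \<in> tensor_part F i j. tensor_diff F i' v = 0})"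

definition tor_boundaries :: "('x, 'k) free_complex \<Rightarrow> nat \<Rightarrow> int \<Rightarrow> (nat \<Rightarrow>\<^sub>0 'k::comm_ring_1) set" where
  "tor_boundaries F i j = tensor_diff F i ` tensor_part F (Suc i) j"

text \<open>The classes of the elements of \<^term>\<open>S\<close> form a basis (without repetition) of the quotient of the
  vector space \<^term>\<open>Z\<close> by its subspace \<^term>\<open>B\<close>.\<close>
definition basis_modulo ::
  "(nat \<Rightarrow>\<^sub>0 'k) set \<Rightarrow> (nat \<Rightarrow>\<^sub>0 'k) set \<Rightarrow> (nat \<Rightarrow>\<^sub>0 'k::field) set \<Rightarrow> bool" where
  "basis_modulo Z B S \<longleftrightarrow> S \<subseteq> Z \<and>
     (\<forall>z\<in>Z. \<exists>!c :: (nat \<Rightarrow>\<^sub>0 'k) \<Rightarrow>\<^sub>0 'k.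
        keys c \<subseteq> S \<and> z - (\<Sum>s\<in>keys c. scal (lookup c s) s) \<in> B)"

text \<open>As with \<^const>\<open>card\<close>, the value is 0 for an infinite-dimensional quotient; this case does not
  arise for the graded pieces of \<open>Tor\<close> below when \<^term>\<open>X\<close> is finite.\<close>
definition quotient_dim :: "(nat \<Rightarrow>\<^sub>0 'k) set \<Rightarrow> (nat \<Rightarrow>\<^sub>0 'k::field) set \<Rightarrow> nat" where
  "quotient_dim Z B = card (SOME S. basis_modulo Z B S)"

text \<open>
  The graded Betti number \<open>dim\<^bsub>\<bbbK>\<^esub> Tor\<^sub>i(R/I, \<bbbK>)\<^sub>j\<close> over \<open>R = \<bbbK>[X]\<close>, for a finite set \<open>X\<close> and a homogeneous
  ideal \<open>I\<close> of \<open>R\<close>, computed from an arbitrarily chosen graded free resolution of \<open>R/I\<close>.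
\<close>
definition betti :: "'x set \<Rightarrow> ('x, 'k::field) mpoly set \<Rightarrow> int \<Rightarrow> int \<Rightarrow> nat" where
  "betti X I i j = (if i < 0 \<or> j < 0 then 0 else
     (let F = (SOME F. graded_free_resolution X I F)
      in quotient_dim (tor_cycles F (nat i) j) (tor_boundaries F (nat i) j)))"

end

theory Submission
  imports Defs "HOL-Library.Nat_Bijection" "HOL-Library.Product_Plus"
begin

text \<open>
  Let \<open>f\<close> be the product of the even edges minus the product of the odd edges of the new cycle, both of
  degree \<open>d\<close>. Two monomials with the same image differ along the path of new edges by an alternating
  amount, so \<open>I\<^sub>H = I\<^sub>G R + (f)\<close>; and \<open>f\<close> is a nonzerodivisor modulo \<open>I\<^sub>G R\<close>, because only one of its two
  terms contains a given new odd edge. Hence the mapping cone of \<open>f : F(- d) \<rightarrow> F\<close> resolves \<open>R/I\<^sub>H\<close> whenever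
  \<open>F\<close> resolves \<open>R/I\<^sub>G R\<close>. As \<open>f\<close> has no constant term, the connecting map vanishes after tensoring with
  \<open>\<bbbK>\<close>, and Tor of the cone is the direct sum of Tor of \<open>F\<close> and a shifted copy.
\<close>

section \<open>Linear maps on finitely supported families\<close>

text \<open>\<open>betti\<close> evaluates one resolution picked by choice and counts a basis with
  \<open>card\<close>, so three facts must be supplied besides the cone. A resolution has to exist,
  or the choice is meaningless; Tor has to be independent of it, which is the comparison theorem
  with its homotopies; and the graded pieces must be finite-dimensional, since \<open>card\<close>
  sends infinite sets to 0 and additivity would fail. Resolutions with finitely many basis elements
  in each degree, all in degrees at least 0, settle the last point, and they also make the shifted
  term vanish for j < d, where \<open>betti\<close> is 0 by convention. The two ideals are handled
  as kernels of maps of monoid algebras: \<open>vmon\<close> sends an edge to the product of its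
  endpoints, and \<open>ext_vmon\<close> does so only for the edges of G and keeps each new edge as
  a variable of its own. Such kernels are spanned by binomials, so the ideal identity and
  homogeneity become statements on exponents, and the nonzerodivisor property becomes one about
  multiplication by a binomial in the target algebra.\<close>

lemma lookup_scal [simp]: "lookup (scal r v) k = r * lookup v k"
  by (simp add: scal_def Poly_Mapping.map.rep_eq when_def)

lemma keys_scal: "keys (scal r v) \<subseteq> keys v"
  by (auto simp: in_keys_iff)

lemma scal_simps [simp]:
  "scal 0 v = 0" "scal r 0 = 0" "scal 1 v = v" "scal (- r) v = - scal r v" "scal r (- v) = - scal r v"
  by (auto intro!: poly_mapping_eqI)

lemma scal_distribs:
  "scal r (v + w) = scal r v + scal r w" "scal r (v - w) = scal r v - scal r w"
  "scal (r + s) v = scal r v + scal s v" "scal (r - s) v = scal r v - scal s v"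
  by (auto intro!: poly_mapping_eqI simp: lookup_add lookup_minus algebra_simps)

lemma scal_scal [simp]: "scal r (scal s v) = scal (r * s) v"
  by (auto intro!: poly_mapping_eqI simp: mult.assoc)

lemma scal_sum: "scal r (\<Sum>x\<in>A. g x) = (\<Sum>x\<in>A. scal r (g x))"
  by (auto intro!: poly_mapping_eqI simp: lookup_sum sum_distrib_left)

lemma scal_single: "scal r (Poly_Mapping.single b s) = Poly_Mapping.single b (r * s)"
  by (auto intro!: poly_mapping_eqI simp: lookup_single when_def)

lemma vector_space_scal: "vector_space (scal :: 'k::field \<Rightarrow> ('b \<Rightarrow>\<^sub>0 'k) \<Rightarrow> _)"
  by unfold_locales (auto simp: scal_distribs)

lemma lin_ext_superset:
  assumes "finite A" "keys v \<subseteq> A"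
  shows "lin_ext f v = (\<Sum>b\<in>A. scal (lookup v b) (f b))"
  unfolding lin_ext_def using assms
  by (intro sum.mono_neutral_left) (auto simp: in_keys_iff)

lemma lookup_lin_ext: "lookup (lin_ext f v) c = (\<Sum>b\<in>keys v. lookup v b * lookup (f b) c)"
  by (simp add: lin_ext_def lookup_sum)

lemma lin_ext_0 [simp]: "lin_ext f 0 = 0"
  by (simp add: lin_ext_def)

lemma lin_ext_add: "lin_ext f (v + w) = lin_ext f v + lin_ext f w"
proof -
  have "keys (v + w) \<subseteq> keys v \<union> keys w" by (rule Poly_Mapping.keys_add)
  then show ?thesis
    by (simp add: lin_ext_superset[of "keys v \<union> keys w"] lookup_add scal_distribs sum.distrib)
qed

lemma lin_ext_scal: "lin_ext f (scal r v) = scal r (lin_ext f v)"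
  using lin_ext_superset[OF finite_keys keys_scal, of f r v] by (simp add: lin_ext_def scal_sum)

lemma lin_ext_uminus: "lin_ext f (- v) = - lin_ext f v"
  using lin_ext_scal[of f "-1" v] by simp

lemma lin_ext_diff: "lin_ext f (v - w) = lin_ext f v - lin_ext f w"
  using lin_ext_add[of f v "- w"] by (simp add: lin_ext_uminus)

lemma lin_ext_sum: "lin_ext f (\<Sum>x\<in>A. g x) = (\<Sum>x\<in>A. lin_ext f (g x))"
  by (induction A rule: infinite_finite_induct) (auto simp: lin_ext_add)

lemma lin_ext_single [simp]: "lin_ext f (Poly_Mapping.single b r) = scal r (f b)"
  by (cases "r = 0") (auto simp: lin_ext_def)

lemma lin_ext_lin_ext: "lin_ext f (lin_ext g v) = lin_ext (\<lambda>b. lin_ext f (g b)) v"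
  by (simp add: lin_ext_def[of g] lin_ext_def[of "\<lambda>b. lin_ext f (g b)"] lin_ext_sum lin_ext_scal)

lemma lin_ext_cong: "(\<And>b. b \<in> keys v \<Longrightarrow> f b = g b) \<Longrightarrow> lin_ext f v = lin_ext g v"
  by (simp add: lin_ext_def)

lemma lin_ext_fun_add: "lin_ext (\<lambda>b. f b + g b) v = lin_ext f v + lin_ext g v"
  by (simp add: lin_ext_def scal_distribs sum.distrib)

lemma lin_ext_fun_diff: "lin_ext (\<lambda>b. f b - g b) v = lin_ext f v - lin_ext g v"
  by (simp add: lin_ext_def scal_distribs sum_subtractf)

lemma lin_ext_fun_zero [simp]: "lin_ext (\<lambda>b. 0) v = 0"
  by (simp add: lin_ext_def)

lemma lin_ext_fun_scal: "lin_ext (\<lambda>b. scal r (f b)) v = scal r (lin_ext f v)"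
  by (simp add: lin_ext_def scal_sum mult.commute)

lemma lin_ext_unit [simp]: "lin_ext (\<lambda>b. Poly_Mapping.single b 1) v = v"
  by (rule poly_mapping_eqI)
    (auto simp: lookup_lin_ext lookup_single when_def in_keys_iff if_distrib sum.delta cong: if_cong)

lemma keys_lin_ext: "keys (lin_ext f v) \<subseteq> (\<Union>b\<in>keys v. keys (f b))"
  by (auto simp: in_keys_iff lookup_lin_ext dest!: sum.not_neutral_contains_not_neutral)

text \<open>Unlike \<^const>\<open>basis_modulo\<close>, this notion for families is stable under direct sums without any
  disjointness condition.\<close>
definition family_basis ::
  "(nat \<Rightarrow>\<^sub>0 'k) set \<Rightarrow> (nat \<Rightarrow>\<^sub>0 'k) set \<Rightarrow> 'a set \<Rightarrow> ('a \<Rightarrow> (nat \<Rightarrow>\<^sub>0 'k::field)) \<Rightarrow> bool" where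
  "family_basis Z B A \<sigma> \<longleftrightarrow> (\<forall>a\<in>A. \<sigma> a \<in> Z) \<and>
     (\<forall>z\<in>Z. \<exists>c. keys c \<subseteq> A \<and> z - lin_ext \<sigma> c \<in> B) \<and>
     (\<forall>c. keys c \<subseteq> A \<and> lin_ext \<sigma> c \<in> B \<longrightarrow> c = 0)"

section \<open>Subspaces, bases of quotients and dimension\<close>

definition lin_subspace :: "('b \<Rightarrow>\<^sub>0 'k::field) set \<Rightarrow> bool" where
  "lin_subspace V \<longleftrightarrow> 0 \<in> V \<and> (\<forall>x\<in>V. \<forall>y\<in>V. x + y \<in> V) \<and> (\<forall>r. \<forall>x\<in>V. scal r x \<in> V)"

lemma lin_subspaceD:
  assumes "lin_subspace V"
  shows "0 \<in> V" "x \<in> V \<Longrightarrow> y \<in> V \<Longrightarrow> x + y \<in> V" "x \<in> V \<Longrightarrow> scal r x \<in> V"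
    "x \<in> V \<Longrightarrow> - x \<in> V" "x \<in> V \<Longrightarrow> y \<in> V \<Longrightarrow> x - y \<in> V"
proof -
  show 1: "0 \<in> V" "x \<in> V \<Longrightarrow> y \<in> V \<Longrightarrow> x + y \<in> V" "x \<in> V \<Longrightarrow> scal r x \<in> V" for x y r
    using assms by (auto simp: lin_subspace_def)
  show 2: "x \<in> V \<Longrightarrow> - x \<in> V" for x using 1(3)[of x "-1"] by simp
  show "x \<in> V \<Longrightarrow> y \<in> V \<Longrightarrow> x - y \<in> V" using 1(2)[of x "- y"] 2[of y] by simp
qed

lemma lin_subspace_sum: "lin_subspace V \<Longrightarrow> (\<And>x. x \<in> A \<Longrightarrow> f x \<in> V) \<Longrightarrow> (\<Sum>x\<in>A. f x) \<in> V"
  by (induction A rule: infinite_finite_induct) (auto simp: lin_subspaceD)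

lemma lin_subspace_lin_ext:
  "lin_subspace V \<Longrightarrow> (\<And>b. b \<in> keys c \<Longrightarrow> \<sigma> b \<in> V) \<Longrightarrow> lin_ext \<sigma> c \<in> V"
  unfolding lin_ext_def by (intro lin_subspace_sum) (auto simp: lin_subspaceD)

lemma basis_modulo_imp_family_basis:
  assumes "basis_modulo Z B S" "lin_subspace Z" "lin_subspace B" "B \<subseteq> Z"
  shows "family_basis Z B S (\<lambda>s. s)"
proof -
  have ex1: "\<exists>!c. keys c \<subseteq> S \<and> z - lin_ext (\<lambda>s. s) c \<in> B" if "z \<in> Z" for z
    using assms(1) that by (simp add: basis_modulo_def lin_ext_def)
  have z0: "c = 0" if "keys c \<subseteq> S" "lin_ext (\<lambda>s. s) c \<in> B" for c
  proof -
    have "keys 0 \<subseteq> S \<and> 0 - lin_ext (\<lambda>s. s) (0 :: (nat \<Rightarrow>\<^sub>0 'a) \<Rightarrow>\<^sub>0 'a) \<in> B"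
      using lin_subspaceD[OF assms(3)] by simp
    moreover have "keys c \<subseteq> S \<and> 0 - lin_ext (\<lambda>s. s) c \<in> B"
      using lin_subspaceD[OF assms(3)] that by simp
    ultimately show ?thesis using ex1[of 0] lin_subspaceD[OF assms(2)] by blast
  qed
  show ?thesis
    unfolding family_basis_def
  proof (intro conjI ballI allI impI)
    show "s \<in> Z" if "s \<in> S" for s using assms(1) that by (auto simp: basis_modulo_def)
    show "\<exists>c. keys c \<subseteq> S \<and> z - lin_ext (\<lambda>s. s) c \<in> B" if "z \<in> Z" for z
      using ex1[OF that] by (rule ex1_implies_ex)
    show "c = 0" if "keys c \<subseteq> S \<and> lin_ext (\<lambda>s. s) c \<in> B" for c
      using z0 that by simp
  qed
qed

lemma family_basis_imp_basis_modulo: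
  assumes "family_basis Z B S (\<lambda>s. s)" "lin_subspace B"
  shows "basis_modulo Z B S"
  unfolding basis_modulo_def lin_ext_def[of "\<lambda>s. s", symmetric]
proof (intro conjI ballI)
  show "S \<subseteq> Z" using assms by (auto simp: family_basis_def)
  fix z assume "z \<in> Z"
  then obtain c where c: "keys c \<subseteq> S" "z - lin_ext (\<lambda>s. s) c \<in> B"
    using assms(1) unfolding family_basis_def by blast
  show "\<exists>!c. keys c \<subseteq> S \<and> z - lin_ext (\<lambda>s. s) c \<in> B"
  proof (rule ex1I)
    show "keys c \<subseteq> S \<and> z - lin_ext (\<lambda>s. s) c \<in> B" using c by simp
    fix c' assume c': "keys c' \<subseteq> S \<and> z - lin_ext (\<lambda>s. s) c' \<in> B"
    have "lin_ext (\<lambda>s. s) (c' - c) = (z - lin_ext (\<lambda>s. s) c) - (z - lin_ext (\<lambda>s. s) c')"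
      by (simp add: lin_ext_diff)
    then have "lin_ext (\<lambda>s. s) (c' - c) \<in> B"
      using c c' lin_subspaceD[OF assms(2)] by metis
    moreover have "keys (c' - c) \<subseteq> S" using c c' Poly_Mapping.keys_diff[of c' c] by auto
    ultimately show "c' = c" using assms(1) unfolding family_basis_def by fastforce
  qed
qed

text \<open>A basis \<open>T\<close> of the subspace \<open>B\<close> is extended to a basis
  \<open>T'\<close> of \<open>Z\<close>; the added vectors \<open>T' - T\<close> represent a basis
  of the quotient.\<close>

lemma basis_modulo_exists:
  fixes Z B :: "(nat \<Rightarrow>\<^sub>0 'k::field) set"
  assumes "lin_subspace Z" "lin_subspace B" "B \<subseteq> Z"
  shows "\<exists>S. basis_modulo Z B S"
proof -
  interpret vs: vector_space "scal :: 'k \<Rightarrow> (nat \<Rightarrow>\<^sub>0 'k) \<Rightarrow> _" by (rule vector_space_scal)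
  have sub: "vs.subspace V \<longleftrightarrow> lin_subspace V" for V
    by (simp add: vs.subspace_def lin_subspace_def)
  obtain T where T: "T \<subseteq> B" "vs.independent T" "B \<subseteq> vs.span T"
    using vs.maximal_independent_subset by blast
  obtain T' where T': "T \<subseteq> T'" "T' \<subseteq> Z" "vs.independent T'" "Z \<subseteq> vs.span T'"
    using vs.maximal_independent_subset_extend[of T Z] T assms(3) by blast
  have spB: "vs.span T = B" using T assms(2) vs.span_minimal[of T B] sub by blast
  have spU: "lin_ext (\<lambda>s. s) c \<in> vs.span U" if "keys c \<subseteq> U" for c U
  proof -
    have "lin_subspace (vs.span U)" using vs.subspace_span sub by blast
    then show ?thesis by (rule lin_subspace_lin_ext) (use that vs.span_base in blast)
  qed
  have "family_basis Z B (T' - T) (\<lambda>s. s)"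
    unfolding family_basis_def
  proof (intro conjI ballI allI impI)
    show "a \<in> Z" if "a \<in> T' - T" for a using that T' by blast
  next
    fix z assume "z \<in> Z"
    then have "z \<in> vs.span ((T' - T) \<union> T)" using T' by (auto simp: Un_absorb2)
    then obtain x y where xy: "z = x + y" "x \<in> vs.span (T' - T)" "y \<in> B"
      unfolding vs.span_Un spB by blast
    let ?V = "{lin_ext (\<lambda>s. s) c | c. keys c \<subseteq> T' - T}"
    have "lin_subspace ?V"
      unfolding lin_subspace_def
    proof (safe, goal_cases)
      case 1 show ?case by (rule exI[of _ 0]) auto
    next
      case (2 _ _ c c')
      then show ?case using Poly_Mapping.keys_add[of c c'] by (intro exI[of _ "c + c'"]) (auto simp: lin_ext_add)
    next
      case (3 r _ c)
      then show ?case using keys_scal[of r c] by (intro exI[of _ "scal r c"]) (auto simp: lin_ext_scal)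
    qed
    moreover have "T' - T \<subseteq> ?V"
    proof
      fix t assume "t \<in> T' - T"
      then show "t \<in> ?V" by (intro CollectI exI[of _ "Poly_Mapping.single t 1"]) auto
    qed
    ultimately have "x \<in> ?V" using vs.span_minimal sub xy by blast
    then show "\<exists>c. keys c \<subseteq> T' - T \<and> z - lin_ext (\<lambda>s. s) c \<in> B" using xy by auto
  next
    fix c assume c: "keys c \<subseteq> T' - T \<and> lin_ext (\<lambda>s. s) c \<in> B"
    \<comment> \<open>A nonzero coefficient at \<open>s\<close> would put \<open>s\<close> in the
      span of \<open>T' - {s}\<close>, because \<open>B\<close> is the span of \<open>T\<close>, a
      subset of \<open>T' - {s}\<close>.\<close>
    show "c = 0"
    proof (rule ccontr)
      assume "c \<noteq> 0"
      then obtain s where s: "s \<in> keys c" by (metis Poly_Mapping.keys_eq_empty ex_in_conv)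
      define c' where "c' = c - Poly_Mapping.single s (lookup c s)"
      have kc': "keys c' \<subseteq> T' - {s}"
        using c by (auto simp: c'_def in_keys_iff lookup_minus lookup_single when_def split: if_splits)
      have "lin_ext (\<lambda>s. s) c = lin_ext (\<lambda>s. s) c' + scal (lookup c s) s"
        by (simp add: c'_def lin_ext_diff)
      then have "scal (lookup c s) s = lin_ext (\<lambda>s. s) c - lin_ext (\<lambda>s. s) c'" by simp
      also have "\<dots> \<in> vs.span (T' - {s})"
      proof (rule vs.span_diff)
        have "T \<subseteq> T' - {s}" using c s T' by blast
        then show "lin_ext (\<lambda>s. s) c \<in> vs.span (T' - {s})" using c spB vs.span_mono by blast
      qed (use spU[OF kc'] in blast)
      finally have "scal (inverse (lookup c s)) (scal (lookup c s) s) \<in> vs.span (T' - {s})"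
        by (rule vs.span_scale)
      then have "s \<in> vs.span (T' - {s})" using s by (simp add: in_keys_iff)
      then show False using T' s c unfolding vs.dependent_def by blast
    qed
  qed
  then show ?thesis using family_basis_imp_basis_modulo[OF _ assms(2)] by blast
qed

text \<open>Injectivity makes the vectors \<open>\<kappa> a\<close> distinct and independent, and
  they lie in the span of the unit vectors indexed by \<open>A\<close>. Finiteness of
  \<open>A'\<close> is part of the conclusion, because index sets of quotient bases are not known to
  be finite in advance.\<close>

lemma card_le_if_lin_ext_inj:
  fixes \<kappa> :: "'a \<Rightarrow> ('b \<Rightarrow>\<^sub>0 'k::field)"
  assumes "finite A" "\<And>a. a \<in> A' \<Longrightarrow> keys (\<kappa> a) \<subseteq> A"
    and inj: "\<And>c. keys c \<subseteq> A' \<Longrightarrow> lin_ext \<kappa> c = 0 \<Longrightarrow> c = 0"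
  shows "finite A' \<and> card A' \<le> card A"
proof -
  interpret vs: vector_space "scal :: 'k \<Rightarrow> ('b \<Rightarrow>\<^sub>0 'k) \<Rightarrow> _" by (rule vector_space_scal)
  have sub: "vs.subspace V \<longleftrightarrow> lin_subspace V" for V
    by (simp add: vs.subspace_def lin_subspace_def)
  have inj_on: "inj_on \<kappa> A'"
  proof (rule inj_onI)
    fix a b assume ab: "a \<in> A'" "b \<in> A'" "\<kappa> a = \<kappa> b"
    have "Poly_Mapping.single a 1 - Poly_Mapping.single b 1 = (0 :: 'a \<Rightarrow>\<^sub>0 'k)"
    proof (rule inj)
      show "keys (Poly_Mapping.single a 1 - Poly_Mapping.single b (1::'k)) \<subseteq> A'"
        using ab Poly_Mapping.keys_diff[of "Poly_Mapping.single a 1" "Poly_Mapping.single b (1::'k)"] by auto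
    qed (use ab in \<open>simp add: lin_ext_diff\<close>)
    then have "lookup (Poly_Mapping.single a (1::'k)) a = lookup (Poly_Mapping.single b 1) a" by simp
    then show "a = b" by (auto simp: lookup_single when_def split: if_splits)
  qed
  have "vs.independent (\<kappa> ` A')"
  proof (subst vs.independent_explicit_finite_subsets, intro allI impI ballI)
    fix S u v assume S: "S \<subseteq> \<kappa> ` A'" "finite S" "(\<Sum>v\<in>S. scal (u v) v) = 0" "v \<in> S"
    define g where "g = inv_into A' \<kappa>"
    have g: "\<kappa> (g v) = v" "g v \<in> A'" if "v \<in> S" for v
      using that S by (auto simp: g_def f_inv_into_f inv_into_into subset_iff)
    define c where "c = (\<Sum>v\<in>S. Poly_Mapping.single (g v) (u v))"
    have "lin_ext \<kappa> c = 0" using S(3) g by (simp add: c_def lin_ext_sum cong: sum.cong)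
    moreover have "keys c \<subseteq> A'"
      unfolding c_def using g by (intro order_trans[OF Poly_Mapping.keys_sum]) auto
    ultimately have "c = 0" using inj by blast
    have gi: "g w = g v \<longleftrightarrow> w = v" if "w \<in> S" for w using g that S(4) by metis
    have "lookup c (g v) = (\<Sum>w\<in>S. if w = v then u w else 0)"
      using gi by (auto simp: c_def lookup_sum lookup_single when_def intro!: sum.cong)
    then show "u v = 0" using S \<open>c = 0\<close> by (simp add: sum.delta)
  qed
  moreover have "\<kappa> ` A' \<subseteq> vs.span ((\<lambda>b. Poly_Mapping.single b 1) ` A)"
  proof
    fix x assume "x \<in> \<kappa> ` A'"
    then obtain a where a: "x = \<kappa> a" "a \<in> A'" by blast
    have "lin_ext (\<lambda>b. Poly_Mapping.single b 1) (\<kappa> a) \<in> vs.span ((\<lambda>b. Poly_Mapping.single b 1) ` A)"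
    proof (rule lin_subspace_lin_ext)
      show "lin_subspace (vs.span ((\<lambda>b. Poly_Mapping.single b 1) ` A))"
        by (simp add: sub[symmetric] vs.subspace_span)
      show "Poly_Mapping.single b 1 \<in> vs.span ((\<lambda>b. Poly_Mapping.single b 1) ` A)" if "b \<in> keys (\<kappa> a)" for b
        using assms(2)[OF a(2)] that by (intro vs.span_base) auto
    qed
    then show "x \<in> vs.span ((\<lambda>b. Poly_Mapping.single b 1) ` A)" using a by simp
  qed
  ultimately have "finite (\<kappa> ` A') \<and> card (\<kappa> ` A') \<le> card ((\<lambda>b. Poly_Mapping.single b (1::'k)) ` A)"
    by (intro vs.independent_span_bound finite_imageI assms(1))
  then have 1: "finite (\<kappa> ` A')" and 2: "card (\<kappa> ` A') \<le> card ((\<lambda>b. Poly_Mapping.single b (1::'k)) ` A)"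
    by auto
  have "finite A'" using 1 inj_on by (rule finite_imageD)
  moreover have "card A' \<le> card A"
    using 2 card_image[OF inj_on] card_image_le[OF assms(1), of "\<lambda>b. Poly_Mapping.single b (1::'k)"] by linarith
  ultimately show ?thesis by blast
qed

lemma family_basisD:
  assumes "family_basis Z B A \<sigma>"
  shows "a \<in> A \<Longrightarrow> \<sigma> a \<in> Z" "z \<in> Z \<Longrightarrow> \<exists>c. keys c \<subseteq> A \<and> z - lin_ext \<sigma> c \<in> B"
    "keys c \<subseteq> A \<Longrightarrow> lin_ext \<sigma> c \<in> B \<Longrightarrow> c = 0"
  using assms unfolding family_basis_def by simp_all

text \<open>The images of representatives of a basis of Z'/B' stay independent modulo
  \<open>B\<close>, since a combination that \<open>f\<close> sends into \<open>B\<close> lies in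
  \<open>B'\<close>. Their coordinates \<open>\<kappa>\<close> therefore form an injective
  matrix.\<close>

lemma family_basis_card_le:
  assumes fb: "family_basis Z B A \<sigma>" "finite A" "family_basis Z' B' A' \<sigma>'"
    and B: "lin_subspace B" and Z': "lin_subspace Z'"
    and hZ: "\<And>z. z \<in> Z' \<Longrightarrow> lin_ext f z \<in> Z"
    and hB: "\<And>z. z \<in> Z' \<Longrightarrow> lin_ext f z \<in> B \<Longrightarrow> z \<in> B'"
  shows "finite A' \<and> card A' \<le> card A"
proof -
  have "\<forall>a\<in>A'. \<exists>c. keys c \<subseteq> A \<and> lin_ext f (\<sigma>' a) - lin_ext \<sigma> c \<in> B"
    by (intro ballI family_basisD(2)[OF fb(1)] hZ family_basisD(1)[OF fb(3)])
  from bchoice[OF this] obtain \<kappa> where "\<forall>a\<in>A'. keys (\<kappa> a) \<subseteq> A \<and> lin_ext f (\<sigma>' a) - lin_ext \<sigma> (\<kappa> a) \<in> B" ..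
  then have \<kappa>: "keys (\<kappa> a) \<subseteq> A" "lin_ext f (\<sigma>' a) - lin_ext \<sigma> (\<kappa> a) \<in> B" if "a \<in> A'" for a
    using that by simp_all
  show ?thesis
  proof (rule card_le_if_lin_ext_inj[where \<kappa> = \<kappa>])
    fix c assume c: "keys c \<subseteq> A'" "lin_ext \<kappa> c = 0"
    have "lin_ext (\<lambda>a. lin_ext f (\<sigma>' a) - lin_ext \<sigma> (\<kappa> a)) c \<in> B"
      using c(1) by (intro lin_subspace_lin_ext[OF B] \<kappa>(2)) auto
    also have "lin_ext (\<lambda>a. lin_ext f (\<sigma>' a) - lin_ext \<sigma> (\<kappa> a)) c = lin_ext f (lin_ext \<sigma>' c)"
      using c(2) by (simp add: lin_ext_fun_diff lin_ext_lin_ext[symmetric])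
    finally have "lin_ext f (lin_ext \<sigma>' c) \<in> B" .
    moreover have "lin_ext \<sigma>' c \<in> Z'"
      using c(1) by (intro lin_subspace_lin_ext[OF Z'] family_basisD(1)[OF fb(3)]) auto
    ultimately show "c = 0" by (intro family_basisD(3)[OF fb(3) c(1)] hB)
  qed (use \<kappa>(1) fb(2) in simp_all)
qed

lemma family_basis_quotient_dim:
  assumes "lin_subspace Z" "lin_subspace B" "B \<subseteq> Z"
  shows "family_basis Z B (SOME S. basis_modulo Z B S) (\<lambda>s. s)"
  using basis_modulo_imp_family_basis[OF someI_ex[OF basis_modulo_exists[OF assms]] assms] .

lemma quotient_dim_eq_card:
  assumes "lin_subspace Z" "lin_subspace B" "B \<subseteq> Z" "family_basis Z B A \<sigma>" "finite A"
  shows "quotient_dim Z B = card A"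
proof -
  note S = family_basis_quotient_dim[OF assms(1-3)]
  let ?S = "SOME S. basis_modulo Z B S"
  \<comment> \<open>The identity map, written as the linear extension of the unit vectors, compares
    the two bases in both directions.\<close>
  have 1: "finite ?S \<and> card ?S \<le> card A"
    using family_basis_card_le[OF assms(4,5) S assms(2,1), of "\<lambda>b. Poly_Mapping.single b 1"] by simp
  then have "card A \<le> card ?S"
    using family_basis_card_le[OF S _ assms(4) assms(2,1), of "\<lambda>b. Poly_Mapping.single b 1"] by simp
  with 1 show ?thesis by (simp add: quotient_dim_def)
qed

text \<open>This includes the infinite-dimensional case, where both sides are 0.\<close>
lemma quotient_dim_cong:
  fixes Z B Z' B' :: "(nat \<Rightarrow>\<^sub>0 'k::field) set"
  assumes Z: "lin_subspace Z" "lin_subspace B" "B \<subseteq> Z"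
    and Z': "lin_subspace Z'" "lin_subspace B'" "B' \<subseteq> Z'"
    and f: "\<And>z. z \<in> Z \<Longrightarrow> lin_ext f z \<in> Z'" "\<And>z. z \<in> Z \<Longrightarrow> lin_ext f z \<in> B' \<Longrightarrow> z \<in> B"
    and g: "\<And>z. z \<in> Z' \<Longrightarrow> lin_ext g z \<in> Z" "\<And>z. z \<in> Z' \<Longrightarrow> lin_ext g z \<in> B \<Longrightarrow> z \<in> B'"
  shows "quotient_dim Z B = quotient_dim Z' B'"
proof -
  note S = family_basis_quotient_dim[OF Z] family_basis_quotient_dim[OF Z']
  let ?S = "SOME S. basis_modulo Z B S" and ?S' = "SOME S. basis_modulo Z' B' S"
  have "finite ?S \<Longrightarrow> finite ?S' \<and> card ?S' \<le> card ?S"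
    using family_basis_card_le[OF S(1) _ S(2) Z(2) Z'(1), of g] g by blast
  moreover have "finite ?S' \<Longrightarrow> finite ?S \<and> card ?S \<le> card ?S'"
    using family_basis_card_le[OF S(2) _ S(1) Z'(2) Z(1), of f] f by blast
  ultimately show ?thesis unfolding quotient_dim_def
    by (metis card.infinite le_antisym)
qed

section \<open>Graded free modules over polynomial rings\<close>

lemma poly_mapping_sum_single: "p = (\<Sum>m\<in>keys p. Poly_Mapping.single m (lookup p m))"
  by (rule poly_mapping_eqI) (auto simp: lookup_sum lookup_single when_def in_keys_iff)

lemma keys_add_nat: "keys (m + m' :: 'x \<Rightarrow>\<^sub>0 nat) = keys m \<union> keys m'"
  by (auto simp: in_keys_iff lookup_add)

lemma poly_ring_0 [simp]: "0 \<in> poly_ring X"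
  and poly_ring_1 [simp]: "1 \<in> poly_ring X"
  and poly_ring_Const [simp]: "Const c \<in> poly_ring X"
  by (auto simp: poly_ring_def Const_def)

lemma poly_ring_add: "p \<in> poly_ring X \<Longrightarrow> q \<in> poly_ring X \<Longrightarrow> p + q \<in> poly_ring X"
  unfolding poly_ring_def using Poly_Mapping.keys_add[of p q] by auto

lemma poly_ring_mult: "p \<in> poly_ring X \<Longrightarrow> q \<in> poly_ring X \<Longrightarrow> p * q \<in> poly_ring X"
  unfolding poly_ring_def using Poly_Mapping.keys_mult[of p q] by (fastforce simp: keys_add_nat)

lemma poly_ring_uminus: "p \<in> poly_ring X \<Longrightarrow> - p \<in> poly_ring X"
  by (auto simp: poly_ring_def in_keys_iff)

lemma poly_ring_diff: "p \<in> poly_ring X \<Longrightarrow> q \<in> poly_ring X \<Longrightarrow> p - q \<in> poly_ring X"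
  using poly_ring_add[of p X "- q"] poly_ring_uminus[of q] by simp

lemma poly_ring_sum: "(\<And>a. a \<in> A \<Longrightarrow> f a \<in> poly_ring X) \<Longrightarrow> (\<Sum>a\<in>A. f a) \<in> poly_ring X"
  by (induction A rule: infinite_finite_induct) (auto simp: poly_ring_add)

lemma poly_ring_single: "keys m \<subseteq> X \<Longrightarrow> Poly_Mapping.single m c \<in> poly_ring X"
  by (auto simp: poly_ring_def)

lemma mon_degree_superset:
  "finite A \<Longrightarrow> keys m \<subseteq> A \<Longrightarrow> mon_degree m = (\<Sum>x\<in>A. lookup m x)"
  unfolding mon_degree_def by (intro sum.mono_neutral_left) (auto simp: in_keys_iff)

lemma mon_degree_add: "mon_degree (m + m') = mon_degree m + mon_degree m'"
  by (simp add: mon_degree_superset[of "keys m \<union> keys m'"] keys_add_nat lookup_add sum.distrib)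

lemma mon_degree_0 [simp]: "mon_degree 0 = 0"
  and mon_degree_single [simp]: "mon_degree (Poly_Mapping.single x n) = n"
  by (auto simp: mon_degree_def)

lemma homogeneous_0 [simp]: "homogeneous n 0"
  by (simp add: homogeneous_def)

lemma homogeneous_1 [simp]: "homogeneous 0 1"
  by (simp add: homogeneous_def)

lemma homogeneous_add: "homogeneous n p \<Longrightarrow> homogeneous n q \<Longrightarrow> homogeneous n (p + q)"
  unfolding homogeneous_def using Poly_Mapping.keys_add[of p q] by auto

lemma homogeneous_uminus: "homogeneous n p \<Longrightarrow> homogeneous n (- p)"
  by (auto simp: homogeneous_def in_keys_iff)

lemma homogeneous_diff: "homogeneous n p \<Longrightarrow> homogeneous n q \<Longrightarrow> homogeneous n (p - q)"
  using homogeneous_add[of n p "- q"] homogeneous_uminus[of n q] by simp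

lemma homogeneous_mult: "homogeneous n p \<Longrightarrow> homogeneous k q \<Longrightarrow> homogeneous (n + k) (p * q)"
  unfolding homogeneous_def using Poly_Mapping.keys_mult[of p q] by (fastforce simp: mon_degree_add)

lemma lookup_Const_0 [simp]: "lookup (Const c) 0 = c"
  by (simp add: Const_def)

lemma Const_eq_0_iff: "Const c = 0 \<longleftrightarrow> c = 0"
  by (metis Const_def lookup_Const_0 lookup_zero single_zero)

text \<open>Exponents are natural numbers, so only the pair of trivial monomials contributes to the
  constant coefficient. This makes reduction modulo the variables compatible with products.\<close>

lemma lookup_times_0:
  "lookup (p * q :: ('x, 'k::comm_ring_1) mpoly) 0 = lookup p 0 * lookup q 0"
proof -
  have *: "m + m' = 0 \<longleftrightarrow> m = 0 \<and> m' = 0" for m m' :: "'x \<Rightarrow>\<^sub>0 nat"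
    by (metis Poly_Mapping.keys_eq_empty Un_empty keys_add_nat)
  have "p * q = (\<Sum>m\<in>keys p. \<Sum>m'\<in>keys q. Poly_Mapping.single (m + m') (lookup p m * lookup q m'))"
    by (subst poly_mapping_sum_single[of p], subst (1) poly_mapping_sum_single[of q])
      (simp add: sum_product mult_single)
  then have "lookup (p * q) 0 =
      (\<Sum>m\<in>keys p. \<Sum>m'\<in>keys q. if m = 0 \<and> m' = 0 then lookup p m * lookup q m' else 0)"
    by (simp add: lookup_sum lookup_single when_def *)
  also have "\<dots> = (\<Sum>m\<in>keys p. if m = 0 then lookup p m * lookup q 0 else 0)"
    by (intro sum.cong refl) (auto simp: in_keys_iff)
  also have "\<dots> = lookup p 0 * lookup q 0"
    by (auto simp: in_keys_iff)
  finally show ?thesis .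
qed

section \<open>Homogeneous components of polynomials\<close>

definition pcomp :: "int \<Rightarrow> ('x, 'k::comm_ring_1) mpoly \<Rightarrow> ('x, 'k) mpoly" where
  "pcomp n p = Poly_Mapping.mapp (\<lambda>m c. if int (mon_degree m) = n then c else 0) p"

lemma lookup_pcomp: "lookup (pcomp n p) m = (if int (mon_degree m) = n then lookup p m else 0)"
  by (auto simp: pcomp_def lookup_mapp when_def in_keys_iff)

lemma pcomp_0 [simp]: "pcomp n 0 = 0"
  and pcomp_add: "pcomp n (p + q) = pcomp n p + pcomp n q"
  by (auto intro!: poly_mapping_eqI simp: lookup_pcomp lookup_add)

lemma pcomp_sum: "pcomp n (\<Sum>a\<in>A. f a) = (\<Sum>a\<in>A. pcomp n (f a))"
  by (induction A rule: infinite_finite_induct) (auto simp: pcomp_add)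

lemma pcomp_homogeneous: "homogeneous n p \<Longrightarrow> pcomp n p = p"
  by (auto intro!: poly_mapping_eqI simp: lookup_pcomp homogeneous_def in_keys_iff)

lemma homogeneous_pcomp [simp]: "homogeneous n (pcomp n p)"
  by (auto simp: homogeneous_def in_keys_iff lookup_pcomp split: if_splits)

lemma poly_ring_pcomp: "p \<in> poly_ring X \<Longrightarrow> pcomp n p \<in> poly_ring X"
  by (auto simp: poly_ring_def in_keys_iff lookup_pcomp split: if_splits)

lemma pcomp_single:
  "pcomp n (Poly_Mapping.single m c) = (if int (mon_degree m) = n then Poly_Mapping.single m c else 0)"
  by (auto intro!: poly_mapping_eqI simp: lookup_pcomp lookup_single when_def)

lemma pcomp_mult:
  assumes "homogeneous k q"
  shows "pcomp (n + k) (p * q) = pcomp n p * q"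
proof -
  have *: "pcomp (n + k) (Poly_Mapping.single m a * q) = pcomp n (Poly_Mapping.single m a) * q" for m a
  proof -
    have "Poly_Mapping.single m a * q = (\<Sum>m'\<in>keys q. Poly_Mapping.single (m + m') (a * lookup q m'))"
      by (subst poly_mapping_sum_single[of q]) (simp add: sum_distrib_left mult_single)
    moreover have "pcomp (n + k) (Poly_Mapping.single (m + m') (a * lookup q m')) =
        (if int (mon_degree m) = n then Poly_Mapping.single (m + m') (a * lookup q m') else 0)"
      if "m' \<in> keys q" for m'
      using assms that by (auto simp: pcomp_single mon_degree_add homogeneous_def)
    ultimately show ?thesis by (simp add: pcomp_sum pcomp_single)
  qed
  show ?thesis
    by (subst (1 2) poly_mapping_sum_single[of p]) (simp add: sum_distrib_right pcomp_sum *)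
qed

text \<open>The passage from a free module to its tensor product with \<open>\<bbbK>\<close>.\<close>
definition eps :: "('b \<Rightarrow>\<^sub>0 ('x, 'k::comm_ring_1) mpoly) \<Rightarrow> ('b \<Rightarrow>\<^sub>0 'k)" where
  "eps v = Poly_Mapping.map (\<lambda>p. lookup p 0) v"

lemma lookup_eps [simp]: "lookup (eps v) b = lookup (lookup v b) 0"
  by (simp add: eps_def Poly_Mapping.map.rep_eq when_def)

lemma eps_simps [simp]:
  "eps 0 = 0" "eps (v + w) = eps v + eps w" "eps (v - w) = eps v - eps w" "eps (- v) = - eps v"
  "eps (scal r v) = scal (lookup r 0) (eps v)"
  "eps (Poly_Mapping.single b p) = Poly_Mapping.single b (lookup p 0)"
  by (auto intro!: poly_mapping_eqI simp: lookup_add lookup_minus lookup_times_0 lookup_single when_def)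

lemma eps_sum: "eps (\<Sum>a\<in>A. g a) = (\<Sum>a\<in>A. eps (g a))"
  by (induction A rule: infinite_finite_induct) auto

text \<open>Taking constant coefficients is a ring homomorphism and so commutes with products of
  matrices. Identities between maps of free modules thereby pass to the tensor product.\<close>

lemma eps_lin_ext: "eps (lin_ext f v) = lin_ext (\<lambda>b. eps (f b)) (eps v)"
proof -
  have "keys (eps v) \<subseteq> keys v" by (auto simp: in_keys_iff)
  then show ?thesis
    by (simp add: lin_ext_superset[OF finite_keys] lin_ext_def[of f] eps_sum)
qed

text \<open>A section of \<open>eps\<close>, used to carry vectors over the field into the free
  module, where the identities for the differentials can be applied.\<close>

definition const_lift :: "('b \<Rightarrow>\<^sub>0 'k) \<Rightarrow> ('b \<Rightarrow>\<^sub>0 ('x, 'k::comm_ring_1) mpoly)" where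
  "const_lift z = Poly_Mapping.map Const z"

lemma lookup_const_lift [simp]: "lookup (const_lift z) b = Const (lookup z b)"
  by (simp add: const_lift_def Poly_Mapping.map.rep_eq when_def Const_def)

lemma eps_const_lift [simp]: "eps (const_lift z) = z"
  by (auto intro!: poly_mapping_eqI)

lemma keys_const_lift [simp]: "keys (const_lift z) = keys z"
  by (simp add: set_eq_iff in_keys_iff Const_eq_0_iff)

section \<open>Free modules and their homogeneous elements\<close>

lemma free_module_def': "v \<in> free_module X B \<longleftrightarrow> keys v \<subseteq> B \<and> (\<forall>b. lookup v b \<in> poly_ring X)"
  unfolding free_module_def by (auto simp: in_keys_iff) (metis poly_ring_0 subsetD in_keys_iff)

lemma free_module_0 [simp]: "0 \<in> free_module X B"
  by (simp add: free_module_def')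

lemma free_module_add: "v \<in> free_module X B \<Longrightarrow> w \<in> free_module X B \<Longrightarrow> v + w \<in> free_module X B"
  unfolding free_module_def' using Poly_Mapping.keys_add[of v w] by (auto simp: lookup_add poly_ring_add)

lemma free_module_uminus: "v \<in> free_module X B \<Longrightarrow> - v \<in> free_module X B"
  by (auto simp: free_module_def' poly_ring_uminus)

lemma free_module_diff: "v \<in> free_module X B \<Longrightarrow> w \<in> free_module X B \<Longrightarrow> v - w \<in> free_module X B"
  using free_module_add[of v X B "- w"] free_module_uminus[of w] by simp

lemma free_module_scal: "r \<in> poly_ring X \<Longrightarrow> v \<in> free_module X B \<Longrightarrow> scal r v \<in> free_module X B"
  unfolding free_module_def' using keys_scal[of r v] by (auto simp: poly_ring_mult)

lemma free_module_sum:
  "(\<And>a. a \<in> A \<Longrightarrow> g a \<in> free_module X B) \<Longrightarrow> (\<Sum>a\<in>A. g a) \<in> free_module X B"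
  by (induction A rule: infinite_finite_induct) (auto simp: free_module_add)

lemma free_module_single:
  "b \<in> B \<Longrightarrow> p \<in> poly_ring X \<Longrightarrow> Poly_Mapping.single b p \<in> free_module X B"
  by (auto simp: free_module_def' lookup_single when_def)

lemma free_module_const_lift: "keys z \<subseteq> B \<Longrightarrow> const_lift z \<in> free_module X B"
  by (auto simp: free_module_def')

lemma free_module_lin_ext:
  "v \<in> free_module X B \<Longrightarrow> (\<And>b. b \<in> B \<Longrightarrow> f b \<in> free_module X B') \<Longrightarrow> lin_ext f v \<in> free_module X B'"
  unfolding lin_ext_def by (intro free_module_sum free_module_scal) (auto simp: free_module_def')

lemma keys_eps_subset: "v \<in> free_module X B \<Longrightarrow> keys (eps v) \<subseteq> B"
  by (auto simp: free_module_def' in_keys_iff) (metis lookup_eps in_keys_iff lookup_zero subsetD)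

definition hvec :: "(nat \<Rightarrow> int) \<Rightarrow> int \<Rightarrow> (nat \<Rightarrow>\<^sub>0 ('x, 'k::comm_ring_1) mpoly) \<Rightarrow> bool" where
  "hvec dg n v \<longleftrightarrow> (\<forall>c. homogeneous (n - dg c) (lookup v c))"

definition vcomp :: "(nat \<Rightarrow> int) \<Rightarrow> int \<Rightarrow> (nat \<Rightarrow>\<^sub>0 ('x, 'k::comm_ring_1) mpoly) \<Rightarrow> (nat \<Rightarrow>\<^sub>0 ('x, 'k) mpoly)" where
  "vcomp dg n v = Poly_Mapping.mapp (\<lambda>c p. pcomp (n - dg c) p) v"

lemma lookup_vcomp [simp]: "lookup (vcomp dg n v) c = pcomp (n - dg c) (lookup v c)"
  by (auto simp: vcomp_def lookup_mapp when_def in_keys_iff)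

lemma vcomp_0 [simp]: "vcomp dg n 0 = 0"
  and vcomp_add: "vcomp dg n (v + w) = vcomp dg n v + vcomp dg n w"
  by (rule poly_mapping_eqI, simp add: lookup_add pcomp_add)+

lemma vcomp_sum: "vcomp dg n (\<Sum>a\<in>A. f a) = (\<Sum>a\<in>A. vcomp dg n (f a))"
  by (induction A rule: infinite_finite_induct) (auto simp: vcomp_add)

lemma vcomp_hvec: "hvec dg n v \<Longrightarrow> vcomp dg n v = v"
  by (rule poly_mapping_eqI) (simp add: pcomp_homogeneous hvec_def)

lemma hvec_vcomp [simp]: "hvec dg n (vcomp dg n v)"
  by (simp add: hvec_def)

lemma free_module_vcomp: "v \<in> free_module X B \<Longrightarrow> vcomp dg n v \<in> free_module X B"
  by (auto simp: free_module_def' poly_ring_pcomp in_keys_iff) (metis pcomp_0 in_keys_iff subsetD)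

lemma hvec_0 [simp]: "hvec dg n 0"
  and hvec_add: "hvec dg n v \<Longrightarrow> hvec dg n w \<Longrightarrow> hvec dg n (v + w)"
  and hvec_diff: "hvec dg n v \<Longrightarrow> hvec dg n w \<Longrightarrow> hvec dg n (v - w)"
  by (simp_all add: hvec_def lookup_add homogeneous_add lookup_minus homogeneous_diff)

lemma hvec_sum: "(\<And>a. a \<in> A \<Longrightarrow> hvec dg n (g a)) \<Longrightarrow> hvec dg n (\<Sum>a\<in>A. g a)"
  by (induction A rule: infinite_finite_induct) (auto simp: hvec_add)

lemma hvec_scal: "homogeneous k r \<Longrightarrow> hvec dg n v \<Longrightarrow> hvec dg (k + n) (scal r v)"
  unfolding hvec_def using homogeneous_mult[of k r] by (metis add_diff_eq lookup_scal)

lemma hvec_lin_ext: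
  assumes "hvec dg n v" "\<And>b. b \<in> keys v \<Longrightarrow> hvec dg' (dg b) (f b)"
  shows "hvec dg' n (lin_ext f v)"
  unfolding lin_ext_def
proof (rule hvec_sum)
  fix b assume "b \<in> keys v"
  then have "hvec dg' ((n - dg b) + dg b) (scal (lookup v b) (f b))"
    using assms by (intro hvec_scal) (auto simp: hvec_def)
  then show "hvec dg' n (scal (lookup v b) (f b))" by simp
qed

lemma vcomp_scal: "hvec dg n v \<Longrightarrow> vcomp dg (k + n) (scal r v) = scal (pcomp k r) v"
  unfolding hvec_def
  by (rule poly_mapping_eqI) (simp add: pcomp_mult add_diff_eq[symmetric])

text \<open>A degree-preserving map commutes with taking components, so a preimage of a homogeneous
  element can be replaced by its component of that degree.\<close>

lemma lin_ext_vcomp: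
  assumes "\<And>b. b \<in> keys v \<Longrightarrow> hvec dg' (dg b) (f b)"
  shows "lin_ext f (vcomp dg n v) = vcomp dg' n (lin_ext f v)"
proof -
  have sub: "keys (vcomp dg n v) \<subseteq> keys v" by (auto simp: vcomp_def intro: subsetD[OF keys_mapp_subset])
  have "vcomp dg' n (scal (lookup v b) (f b)) = scal (pcomp (n - dg b) (lookup v b)) (f b)"
    if "b \<in> keys v" for b
    using vcomp_scal[OF assms[OF that], of "n - dg b" "lookup v b"] by simp
  then show ?thesis
    by (simp add: lin_ext_superset[OF finite_keys sub] lin_ext_def[of f v] vcomp_sum)
qed

section \<open>Degree-preserving maps of free modules\<close>

definition gmap :: "'x set \<Rightarrow> nat set \<Rightarrow> (nat \<Rightarrow> int) \<Rightarrow> nat set \<Rightarrow> (nat \<Rightarrow> int) \<Rightarrow>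
    (nat \<Rightarrow> (nat \<Rightarrow>\<^sub>0 ('x, 'k::comm_ring_1) mpoly)) \<Rightarrow> bool" where
  "gmap X B dg B' dg' f \<longleftrightarrow> (\<forall>b\<in>B. f b \<in> free_module X B' \<and> hvec dg' (dg b) (f b))"

lemma free_module_keys: "v \<in> free_module X B \<Longrightarrow> b \<in> keys v \<Longrightarrow> b \<in> B"
  by (auto simp: free_module_def)

lemma gmap_free_module:
  "gmap X B dg B' dg' f \<Longrightarrow> v \<in> free_module X B \<Longrightarrow> lin_ext f v \<in> free_module X B'"
  by (rule free_module_lin_ext) (auto simp: gmap_def)

lemma gmap_hvec:
  "gmap X B dg B' dg' f \<Longrightarrow> v \<in> free_module X B \<Longrightarrow> hvec dg n v \<Longrightarrow> hvec dg' n (lin_ext f v)"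
  by (rule hvec_lin_ext) (auto simp: gmap_def dest: free_module_keys)

lemma gmap_vcomp:
  "gmap X B dg B' dg' f \<Longrightarrow> v \<in> free_module X B \<Longrightarrow>
    lin_ext f (vcomp dg n v) = vcomp dg' n (lin_ext f v)"
  by (rule lin_ext_vcomp) (auto simp: gmap_def dest: free_module_keys)

lemma gmap_comp:
  "gmap X B dg B' dg' f \<Longrightarrow> gmap X B' dg' B'' dg'' g \<Longrightarrow> gmap X B dg B'' dg'' (\<lambda>b. lin_ext g (f b))"
  unfolding gmap_def[of X B] by (auto intro: gmap_free_module gmap_hvec)

lemma gmap_diff:
  "gmap X B dg B' dg' f \<Longrightarrow> gmap X B dg B' dg' g \<Longrightarrow> gmap X B dg B' dg' (\<lambda>b. f b - g b)"
  by (auto simp: gmap_def free_module_diff hvec_diff)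

lemma gmap_0 [simp]: "gmap X B dg B' dg' (\<lambda>b. 0)"
  by (auto simp: gmap_def)

lemma gmap_unit: "gmap X B dg B dg (\<lambda>b. Poly_Mapping.single b 1)"
  by (auto simp: gmap_def free_module_single hvec_def lookup_single when_def)

text \<open>A homogeneous entry has a nonzero constant coefficient only in degree 0, so the reduced
  map connects basis elements of equal degree.\<close>

lemma gmap_eps_keys:
  assumes "gmap X B dg B' dg' f" "keys z \<subseteq> {b \<in> B. dg b = n}"
  shows "keys (lin_ext (\<lambda>b. eps (f b)) z) \<subseteq> {b \<in> B'. dg' b = n}"
proof
  fix c assume "c \<in> keys (lin_ext (\<lambda>b. eps (f b)) z)"
  then obtain b where b: "b \<in> keys z" "c \<in> keys (eps (f b))" using keys_lin_ext by fastforce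
  then have fb: "f b \<in> free_module X B'" "hvec dg' n (f b)" using assms by (auto simp: gmap_def)
  have "0 \<in> keys (lookup (f b) c)" using b by (simp add: in_keys_iff)
  then have "n - dg' c = 0" using fb(2) by (force simp: hvec_def homogeneous_def)
  then show "c \<in> {b \<in> B'. dg' b = n}" using b keys_eps_subset[OF fb(1)] by auto
qed

section \<open>Comparison of graded free resolutions\<close>

definition ring_ideal :: "'x set \<Rightarrow> ('x, 'k::comm_ring_1) mpoly set \<Rightarrow> bool" where
  "ring_ideal X I \<longleftrightarrow> I \<subseteq> poly_ring X \<and> 0 \<in> I \<and> (\<forall>p\<in>I. \<forall>q\<in>I. p + q \<in> I) \<and>
     (\<forall>r\<in>poly_ring X. \<forall>p\<in>I. r * p \<in> I)"

lemma ring_idealD: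
  assumes "ring_ideal X I"
  shows "p \<in> I \<Longrightarrow> p \<in> poly_ring X" "0 \<in> I" "p \<in> I \<Longrightarrow> q \<in> I \<Longrightarrow> p + q \<in> I"
    "r \<in> poly_ring X \<Longrightarrow> p \<in> I \<Longrightarrow> r * p \<in> I" "r \<in> poly_ring X \<Longrightarrow> p \<in> I \<Longrightarrow> p * r \<in> I"
    "p \<in> I \<Longrightarrow> - p \<in> I" "p \<in> I \<Longrightarrow> q \<in> I \<Longrightarrow> p - q \<in> I"
proof -
  show 1: "p \<in> I \<Longrightarrow> p \<in> poly_ring X" "0 \<in> I" "p \<in> I \<Longrightarrow> q \<in> I \<Longrightarrow> p + q \<in> I"
    "r \<in> poly_ring X \<Longrightarrow> p \<in> I \<Longrightarrow> r * p \<in> I" "r \<in> poly_ring X \<Longrightarrow> p \<in> I \<Longrightarrow> p * r \<in> I" for p q r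
    using assms by (auto simp: ring_ideal_def mult.commute)
  show 2: "p \<in> I \<Longrightarrow> - p \<in> I" for p
    using 1(4)[OF poly_ring_uminus[OF poly_ring_1], of p] by simp
  show "p \<in> I \<Longrightarrow> q \<in> I \<Longrightarrow> p - q \<in> I"
    using 1(3)[of p "- q"] 2[of q] by simp
qed

lemma ring_ideal_sum: "ring_ideal X I \<Longrightarrow> (\<And>a. a \<in> A \<Longrightarrow> f a \<in> I) \<Longrightarrow> (\<Sum>a\<in>A. f a) \<in> I"
  by (induction A rule: infinite_finite_induct) (auto simp: ring_idealD)

lemma ring_ideal_zero: "ring_ideal X {0}"
  by (auto simp: ring_ideal_def)

definition entries_in :: "('x, 'k::comm_ring_1) mpoly set \<Rightarrow> (nat \<Rightarrow>\<^sub>0 ('x, 'k) mpoly) \<Rightarrow> bool" where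
  "entries_in J v \<longleftrightarrow> (\<forall>c. lookup v c \<in> J)"

lemma entries_in_zero_ideal [simp]: "entries_in {0} v \<longleftrightarrow> v = 0"
  by (auto simp: entries_in_def intro: poly_mapping_eqI)

lemma entries_inD:
  assumes "ring_ideal X J"
  shows "entries_in J 0" "entries_in J v \<Longrightarrow> entries_in J w \<Longrightarrow> entries_in J (v + w)"
    "entries_in J v \<Longrightarrow> entries_in J (- v)" "entries_in J v \<Longrightarrow> entries_in J w \<Longrightarrow> entries_in J (v - w)"
  using assms by (auto simp: entries_in_def lookup_add lookup_minus ring_idealD)

lemma entries_in_lin_ext1:
  assumes "ring_ideal X J" "entries_in J v" "v \<in> free_module X B" "\<And>b. b \<in> B \<Longrightarrow> f b \<in> free_module X B'"
  shows "entries_in J (lin_ext f v)"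
  unfolding entries_in_def lookup_lin_ext using assms
  by (auto intro!: ring_ideal_sum[OF assms(1)] ring_idealD(5)[OF assms(1)]
      simp: entries_in_def free_module_def')

lemma entries_in_lin_ext2:
  assumes "ring_ideal X J" "v \<in> free_module X B" "\<And>b. b \<in> B \<Longrightarrow> entries_in J (f b)"
  shows "entries_in J (lin_ext f v)"
  unfolding entries_in_def lookup_lin_ext using assms
  by (auto intro!: ring_ideal_sum[OF assms(1)] ring_idealD(4)[OF assms(1)]
      simp: entries_in_def free_module_def')

text \<open>The augmented complex \<open>\<cdots> \<rightarrow> F\<^sub>1 \<rightarrow> F\<^sub>0 \<rightarrow> R\<close>, shifted by one so that \<open>R\<close> is the free module in
  position 0. It is exact up to \<open>xnull I\<close>, which is \<open>I\<close> in position 0 and zero elsewhere; this treats the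
  augmentation and the differentials alike.\<close>
definition xbasis :: "('x, 'k::comm_ring_1) free_complex \<Rightarrow> nat \<Rightarrow> nat set" where
  "xbasis F n = (case n of 0 \<Rightarrow> {0} | Suc i \<Rightarrow> basis F i)"

definition xdeg :: "('x, 'k::comm_ring_1) free_complex \<Rightarrow> nat \<Rightarrow> nat \<Rightarrow> int" where
  "xdeg F n = (case n of 0 \<Rightarrow> (\<lambda>_. 0) | Suc i \<Rightarrow> bdeg F i)"

definition xdiff :: "('x, 'k::comm_ring_1) free_complex \<Rightarrow> nat \<Rightarrow> nat \<Rightarrow> (nat \<Rightarrow>\<^sub>0 ('x, 'k) mpoly)" where
  "xdiff F n = (case n of 0 \<Rightarrow> (\<lambda>b. Poly_Mapping.single 0 (aug F b)) | Suc i \<Rightarrow> diff F i)"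

definition xnull :: "('x, 'k::comm_ring_1) mpoly set \<Rightarrow> nat \<Rightarrow> ('x, 'k) mpoly set" where
  "xnull I n = (if n = 0 then I else {0})"

lemma xsimps [simp]:
  "xbasis F 0 = {0}" "xbasis F (Suc i) = basis F i" "xdeg F 0 = (\<lambda>_. 0)" "xdeg F (Suc i) = bdeg F i"
  "xdiff F 0 = (\<lambda>b. Poly_Mapping.single 0 (aug F b))" "xdiff F (Suc i) = diff F i"
  "xnull I 0 = I" "xnull I (Suc i) = {0}"
  by (simp_all add: xbasis_def xdeg_def xdiff_def xnull_def)

lemma ring_ideal_xnull: "ring_ideal X I \<Longrightarrow> ring_ideal X (xnull I n)"
  by (simp add: xnull_def ring_ideal_zero)

lemma lin_ext_xdiff_0: "lin_ext (xdiff F 0) v = Poly_Mapping.single 0 (aug_map F v)"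
  by (rule poly_mapping_eqI) (simp add: lookup_lin_ext aug_map_def lookup_single when_def)

lemma entries_in_single: "ring_ideal X I \<Longrightarrow> entries_in I (Poly_Mapping.single b p) \<longleftrightarrow> p \<in> I"
  by (auto simp: entries_in_def lookup_single when_def ring_idealD)

lemma free_module_0_basis: "v \<in> free_module X {0} \<Longrightarrow> v = Poly_Mapping.single 0 (lookup v 0)"
  by (rule poly_mapping_eqI) (auto simp: free_module_def lookup_single when_def in_keys_iff)

context
  fixes X :: "'x set" and I :: "('x, 'k::comm_ring_1) mpoly set" and F :: "('x, 'k) free_complex"
  assumes res: "graded_free_resolution X I F" and I: "ring_ideal X I"
    and hom: "\<And>n p. p \<in> I \<Longrightarrow> pcomp n p \<in> I"
begin

lemma gmap_xdiff: "gmap X (xbasis F (Suc n)) (xdeg F (Suc n)) (xbasis F n) (xdeg F n) (xdiff F n)"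
proof (cases n)
  case 0
  then show ?thesis using res
    by (auto simp: gmap_def graded_free_resolution_def hvec_def lookup_single when_def intro!: free_module_single)
next
  case (Suc i)
  have "homogeneous (bdeg F (Suc i) b - bdeg F i c) (lookup (diff F i b) c)" if "b \<in> basis F (Suc i)" for b c
  proof (cases "c \<in> basis F i")
    case True
    then show ?thesis using res that by (auto simp: graded_free_resolution_def)
  next
    case False
    have "diff F i b \<in> free_module X (basis F i)" using res that by (auto simp: graded_free_resolution_def)
    then have "lookup (diff F i b) c = 0" using False by (auto simp: free_module_def in_keys_iff)
    then show ?thesis by simp
  qed
  then show ?thesis using res Suc
    by (auto simp: gmap_def graded_free_resolution_def hvec_def)
qed

lemma xdiff_exact_iff:
  assumes "v \<in> free_module X (xbasis F (Suc n))"
  shows "entries_in (xnull I n) (lin_ext (xdiff F n) v) \<longleftrightarrow>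
    v \<in> lin_ext (xdiff F (Suc n)) ` free_module X (xbasis F (Suc (Suc n)))"
proof (cases n)
  case 0
  have "{v \<in> free_module X (basis F 0). aug_map F v \<in> I} = lin_ext (diff F 0) ` free_module X (basis F 1)"
    using res unfolding graded_free_resolution_def by blast
  then show ?thesis using assms 0 lin_ext_xdiff_0[of F v]
    by (auto simp: entries_in_single[OF I])
next
  case (Suc i)
  have "{v \<in> free_module X (basis F (Suc i)). lin_ext (diff F i) v = 0} =
       lin_ext (diff F (Suc i)) ` free_module X (basis F (Suc (Suc i)))"
    using res unfolding graded_free_resolution_def by blast
  then show ?thesis using assms Suc by auto
qed

lemma xdiff_xdiff:
  assumes "v \<in> free_module X (xbasis F (Suc (Suc n)))"
  shows "entries_in (xnull I n) (lin_ext (xdiff F n) (lin_ext (xdiff F (Suc n)) v))"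
  using xdiff_exact_iff[of "lin_ext (xdiff F (Suc n)) v" n] assms gmap_free_module[OF gmap_xdiff] by blast

text \<open>Exactness supplies some preimage, and its component of degree \<open>d\<close> is still
  one. In position 0, where preimages are taken modulo \<open>I\<close>, this uses that
  \<open>I\<close> contains the homogeneous components of its elements.\<close>

lemma xexact:
  assumes v: "v \<in> free_module X (xbasis F n)" "hvec (xdeg F n) d v"
    and cyc: "\<And>k. n = Suc k \<Longrightarrow> entries_in (xnull I k) (lin_ext (xdiff F k) v)"
  shows "\<exists>w\<in>free_module X (xbasis F (Suc n)). hvec (xdeg F (Suc n)) d w \<and>
    entries_in (xnull I n) (lin_ext (xdiff F n) w - v)"
proof (cases n)
  case 0
  have "lookup v 0 \<in> poly_ring X" using v by (simp add: free_module_def')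
  moreover have "\<forall>r\<in>poly_ring X. \<exists>w\<in>free_module X (basis F 0). aug_map F w - r \<in> I"
    using res unfolding graded_free_resolution_def by (elim conjE)
  ultimately obtain w where w: "w \<in> free_module X (basis F 0)" "aug_map F w - lookup v 0 \<in> I"
    by blast
  have h: "homogeneous d (lookup v 0)" using v 0 by (auto simp: hvec_def)
  define r where "r = aug_map F w - lookup v 0"
  let ?w = "vcomp (bdeg F 0) d w"
  have eq: "lin_ext (xdiff F 0) ?w = Poly_Mapping.single 0 (pcomp d (aug_map F w))"
  proof -
    have "lin_ext (xdiff F 0) ?w = vcomp (xdeg F 0) d (lin_ext (xdiff F 0) w)"
      using gmap_vcomp[OF gmap_xdiff[of 0]] w by simp
    also have "\<dots> = Poly_Mapping.single 0 (pcomp d (aug_map F w))"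
      unfolding lin_ext_xdiff_0 by (rule poly_mapping_eqI) (simp add: lookup_single when_def)
    finally show ?thesis .
  qed
  have "r \<in> I" using w by (simp add: r_def)
  then have "pcomp d r \<in> I" using hom by blast
  moreover have "pcomp d r = pcomp d (aug_map F w) - lookup v 0"
  proof -
    have "pcomp d (aug_map F w) = pcomp d (r + lookup v 0)" by (simp add: r_def)
    also have "\<dots> = pcomp d r + lookup v 0" using pcomp_homogeneous[OF h] by (simp add: pcomp_add)
    finally show ?thesis by simp
  qed
  moreover have "v = Poly_Mapping.single 0 (lookup v 0)"
    using v(1) 0 free_module_0_basis by simp
  then have "lin_ext (xdiff F 0) ?w - v = Poly_Mapping.single 0 (pcomp d (aug_map F w) - lookup v 0)"
    unfolding eq by (metis single_diff)
  ultimately have "entries_in I (lin_ext (xdiff F 0) ?w - v)"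
    by (simp add: entries_in_single[OF I])
  then show ?thesis using 0 w(1) by (intro bexI[of _ ?w]) (simp_all add: free_module_vcomp)
next
  case (Suc k)
  then obtain w where w: "w \<in> free_module X (xbasis F (Suc n))" "v = lin_ext (xdiff F n) w"
    using cyc[OF Suc] xdiff_exact_iff[of v k] v by auto
  let ?w = "vcomp (xdeg F (Suc n)) d w"
  have "lin_ext (xdiff F n) ?w = vcomp (xdeg F n) d v"
    using gmap_vcomp[OF gmap_xdiff w(1)] w(2) by simp
  then have "lin_ext (xdiff F n) ?w = v" using vcomp_hvec[OF v(2)] by simp
  moreover have "?w \<in> free_module X (xbasis F (Suc n))" using w(1) by (rule free_module_vcomp)
  ultimately show ?thesis
    using hvec_vcomp[of "xdeg F (Suc n)" d w] entries_inD(1)[OF ring_ideal_xnull[OF I]] by (metis diff_self)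
qed

end

text \<open>The comparison theorem: the identity of R in position 0 is lifted one position at a
  time, by freeness of \<open>F\<close> and exactness of \<open>F'\<close>.\<close>

lemma chain_map_exists:
  assumes res: "graded_free_resolution X I F" "graded_free_resolution X I F'"
    and I: "ring_ideal X I" and hom: "\<And>n p. p \<in> I \<Longrightarrow> pcomp n p \<in> I"
  shows "\<exists>\<phi>. \<phi> 0 = (\<lambda>b. Poly_Mapping.single b 1) \<and>
    (\<forall>n. gmap X (xbasis F n) (xdeg F n) (xbasis F' n) (xdeg F' n) (\<phi> n)) \<and>
    (\<forall>n. \<forall>b\<in>xbasis F (Suc n).
       entries_in (xnull I n) (lin_ext (xdiff F' n) (\<phi> (Suc n) b) - lin_ext (\<phi> n) (xdiff F n b)))"
proof -
  \<comment> \<open>The recursion sees only the latest map, so \<open>P\<close> records that this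
    map sends cycles to cycles; that is the condition for solving the next lifting problem.\<close>
  define P where "P = (\<lambda>n \<phi>. gmap X (xbasis F n) (xdeg F n) (xbasis F' n) (xdeg F' n) \<phi> \<and>
    (n = 0 \<longrightarrow> \<phi> = (\<lambda>b. Poly_Mapping.single b 1)) \<and>
    (\<forall>k v. n = Suc k \<longrightarrow> v \<in> free_module X (xbasis F n) \<longrightarrow> entries_in (xnull I k) (lin_ext (xdiff F k) v) \<longrightarrow>
       entries_in (xnull I k) (lin_ext (xdiff F' k) (lin_ext \<phi> v))))"
  define Q where "Q = (\<lambda>n \<phi> \<psi>. \<forall>b\<in>xbasis F (Suc n).
       entries_in (xnull I n) (lin_ext (xdiff F' n) (\<psi> b) - lin_ext \<phi> (xdiff F n b)))"
  have "\<exists>\<phi>. \<forall>n. P n (\<phi> n) \<and> Q n (\<phi> n) (\<phi> (Suc n))"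
  proof (rule dependent_nat_choice)
    show "\<exists>\<phi>. P 0 \<phi>" using gmap_unit[of X "{0}" "\<lambda>_. 0"] by (simp add: P_def)
  next
    fix \<phi> n assume P: "P n \<phi>"
    note J = ring_ideal_xnull[OF I, of n]
    note gm = gmap_xdiff[OF res(1) I hom, of n]
    note gm' = gmap_xdiff[OF res(2) I hom, of n]
    have g: "gmap X (xbasis F n) (xdeg F n) (xbasis F' n) (xdeg F' n) \<phi>" using P by (simp add: P_def)
    have "\<exists>w. w \<in> free_module X (xbasis F' (Suc n)) \<and> hvec (xdeg F' (Suc n)) (xdeg F (Suc n) b) w \<and>
        entries_in (xnull I n) (lin_ext (xdiff F' n) w - lin_ext \<phi> (xdiff F n b))"
      if b: "b \<in> xbasis F (Suc n)" for b
    proof -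
      have *: "xdiff F n b \<in> free_module X (xbasis F n)" "hvec (xdeg F n) (xdeg F (Suc n) b) (xdiff F n b)"
        using gm b by (auto simp: gmap_def)
      have "\<exists>w\<in>free_module X (xbasis F' (Suc n)). hvec (xdeg F' (Suc n)) (xdeg F (Suc n) b) w \<and>
        entries_in (xnull I n) (lin_ext (xdiff F' n) w - lin_ext \<phi> (xdiff F n b))"
      proof (rule xexact[OF res(2) I hom])
        show "lin_ext \<phi> (xdiff F n b) \<in> free_module X (xbasis F' n)"
          using g *(1) by (rule gmap_free_module)
        show "hvec (xdeg F' n) (xdeg F (Suc n) b) (lin_ext \<phi> (xdiff F n b))"
          using g * by (rule gmap_hvec)
        fix k assume k: "n = Suc k"
        have "entries_in (xnull I k) (lin_ext (xdiff F k) (lin_ext (xdiff F n) (Poly_Mapping.single b 1)))"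
          unfolding k by (rule xdiff_xdiff[OF res(1) I hom]) (use b k in \<open>auto intro: free_module_single\<close>)
        then show "entries_in (xnull I k) (lin_ext (xdiff F' k) (lin_ext \<phi> (xdiff F n b)))"
          using P k *(1) by (simp add: P_def)
      qed
      then show ?thesis by blast
    qed
    then obtain \<psi> where \<psi>: "\<And>b. b \<in> xbasis F (Suc n) \<Longrightarrow> \<psi> b \<in> free_module X (xbasis F' (Suc n)) \<and>
        hvec (xdeg F' (Suc n)) (xdeg F (Suc n) b) (\<psi> b) \<and>
        entries_in (xnull I n) (lin_ext (xdiff F' n) (\<psi> b) - lin_ext \<phi> (xdiff F n b))"
      by metis
    have Q: "Q n \<phi> \<psi>" using \<psi> by (simp add: Q_def)
    moreover have "P (Suc n) \<psi>"
      unfolding P_def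
    proof (intro conjI allI impI)
      show "gmap X (xbasis F (Suc n)) (xdeg F (Suc n)) (xbasis F' (Suc n)) (xdeg F' (Suc n)) \<psi>"
        unfolding gmap_def using \<psi> by blast
      fix k v assume k: "Suc n = Suc k" and v: "v \<in> free_module X (xbasis F (Suc n))"
        and "entries_in (xnull I k) (lin_ext (xdiff F k) v)"
      then have null: "entries_in (xnull I n) (lin_ext (xdiff F n) v)" by simp
      have "entries_in (xnull I n) (lin_ext (\<lambda>b. lin_ext (xdiff F' n) (\<psi> b) - lin_ext \<phi> (xdiff F n b)) v)"
        using J v Q[unfolded Q_def] by (intro entries_in_lin_ext2) auto
      moreover have "entries_in (xnull I n) (lin_ext \<phi> (lin_ext (xdiff F n) v))"
        by (rule entries_in_lin_ext1[OF J null gmap_free_module[OF gm v]])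
          (use g in \<open>auto simp: gmap_def\<close>)
      ultimately have "entries_in (xnull I n) (lin_ext (\<lambda>b. lin_ext (xdiff F' n) (\<psi> b) - lin_ext \<phi> (xdiff F n b)) v
          + lin_ext \<phi> (lin_ext (xdiff F n) v))"
        by (rule entries_inD(2)[OF J])
      then show "entries_in (xnull I k) (lin_ext (xdiff F' k) (lin_ext \<psi> v))"
        using k by (simp add: lin_ext_fun_diff lin_ext_lin_ext)
    qed simp
    ultimately show "\<exists>\<psi>. P (Suc n) \<psi> \<and> Q n \<phi> \<psi>" by blast
  qed
  then obtain \<phi> where "\<And>n. P n (\<phi> n) \<and> Q n (\<phi> n) (\<phi> (Suc n))" by blast
  then have "\<And>n. P n (\<phi> n)" "\<And>n. Q n (\<phi> n) (\<phi> (Suc n))" by blast+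
  then show ?thesis unfolding P_def Q_def by (intro exI[of _ \<phi>]) blast
qed

text \<open>A chain map that vanishes in position 0 is contracted by lifting once more. The
  resulting identity is an equality and not a congruence, because \<open>xnull\<close> is zero from
  position 1 on.\<close>

lemma null_homotopy_exists:
  assumes res: "graded_free_resolution X I F" "graded_free_resolution X I F'"
    and I: "ring_ideal X I" and hom: "\<And>n p. p \<in> I \<Longrightarrow> pcomp n p \<in> I"
    and g: "\<And>n. gmap X (xbasis F n) (xdeg F n) (xbasis F' n) (xdeg F' n) (\<gamma> n)"
    and g0: "\<gamma> 0 = (\<lambda>b. 0)"
    and chain: "\<And>n b. b \<in> xbasis F (Suc n) \<Longrightarrow>
       entries_in (xnull I n) (lin_ext (xdiff F' n) (\<gamma> (Suc n) b) - lin_ext (\<gamma> n) (xdiff F n b))"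
  shows "\<exists>s. s 0 = (\<lambda>b. 0) \<and>
    (\<forall>n. gmap X (xbasis F n) (xdeg F n) (xbasis F' (Suc n)) (xdeg F' (Suc n)) (s n)) \<and>
    (\<forall>n. \<forall>b\<in>xbasis F (Suc n).
       \<gamma> (Suc n) b = lin_ext (xdiff F' (Suc n)) (s (Suc n) b) + lin_ext (s n) (xdiff F n b))"
proof -
  \<comment> \<open>On cycles \<open>\<gamma>\<close> agrees, modulo \<open>xnull\<close>, with the
    differential applied after \<open>s\<close>. This makes the element \<open>?u\<close> below a
    cycle, whose lift defines the next map.\<close>
  define P where "P = (\<lambda>n s. gmap X (xbasis F n) (xdeg F n) (xbasis F' (Suc n)) (xdeg F' (Suc n)) s \<and>
    (n = 0 \<longrightarrow> s = (\<lambda>b. 0)) \<and>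
    (\<forall>v. v \<in> free_module X (xbasis F n) \<longrightarrow> (\<forall>k. n = Suc k \<longrightarrow> entries_in (xnull I k) (lin_ext (xdiff F k) v)) \<longrightarrow>
       entries_in (xnull I n) (lin_ext (\<gamma> n) v - lin_ext (xdiff F' n) (lin_ext s v))))"
  define Q where "Q = (\<lambda>n s t. \<forall>b\<in>xbasis F (Suc n).
       \<gamma> (Suc n) b = lin_ext (xdiff F' (Suc n)) (t b) + lin_ext s (xdiff F n b))"
  have "\<exists>s. \<forall>n. P n (s n) \<and> Q n (s n) (s (Suc n))"
  proof (rule dependent_nat_choice)
    show "\<exists>s. P 0 s" by (simp add: P_def g0 entries_inD(1)[OF I])
  next
    fix s n assume P: "P n s"
    note J = ring_ideal_xnull[OF I, of n]
    note gm = gmap_xdiff[OF res(1) I hom, of n]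
    have gs: "gmap X (xbasis F n) (xdeg F n) (xbasis F' (Suc n)) (xdeg F' (Suc n)) s"
      using P by (simp add: P_def)
    have "\<exists>w. w \<in> free_module X (xbasis F' (Suc (Suc n))) \<and> hvec (xdeg F' (Suc (Suc n))) (xdeg F (Suc n) b) w \<and>
        \<gamma> (Suc n) b = lin_ext (xdiff F' (Suc n)) w + lin_ext s (xdiff F n b)"
      if b: "b \<in> xbasis F (Suc n)" for b
    proof -
      have *: "xdiff F n b \<in> free_module X (xbasis F n)" "hvec (xdeg F n) (xdeg F (Suc n) b) (xdiff F n b)"
        using gm b by (auto simp: gmap_def)
      have **: "\<gamma> (Suc n) b \<in> free_module X (xbasis F' (Suc n))" "hvec (xdeg F' (Suc n)) (xdeg F (Suc n) b) (\<gamma> (Suc n) b)"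
        using g[of "Suc n"] b by (auto simp: gmap_def)
      let ?u = "\<gamma> (Suc n) b - lin_ext s (xdiff F n b)"
      have "\<exists>w\<in>free_module X (xbasis F' (Suc (Suc n))). hvec (xdeg F' (Suc (Suc n))) (xdeg F (Suc n) b) w \<and>
        entries_in (xnull I (Suc n)) (lin_ext (xdiff F' (Suc n)) w - ?u)"
      proof (rule xexact[OF res(2) I hom])
        show "?u \<in> free_module X (xbasis F' (Suc n))"
          by (intro free_module_diff ** gmap_free_module[OF gs] *)
        show "hvec (xdeg F' (Suc n)) (xdeg F (Suc n) b) ?u"
          by (intro hvec_diff ** gmap_hvec[OF gs] *)
        fix k assume "Suc n = Suc k"
        then have k: "k = n" by simp
        have "entries_in (xnull I k) (lin_ext (xdiff F k) (lin_ext (xdiff F n) (Poly_Mapping.single b 1)))"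
          if "n = Suc k" for k
          unfolding that by (rule xdiff_xdiff[OF res(1) I hom]) (use b that in \<open>auto intro: free_module_single\<close>)
        then have "entries_in (xnull I n) (lin_ext (\<gamma> n) (xdiff F n b) - lin_ext (xdiff F' n) (lin_ext s (xdiff F n b)))"
          using P *(1) by (simp add: P_def)
        from entries_inD(2)[OF J chain[OF b] this]
        show "entries_in (xnull I k) (lin_ext (xdiff F' k) ?u)"
          by (simp add: k lin_ext_diff)
      qed
      then show ?thesis by (auto simp: algebra_simps)
    qed
    then obtain t where t: "\<And>b. b \<in> xbasis F (Suc n) \<Longrightarrow> t b \<in> free_module X (xbasis F' (Suc (Suc n))) \<and>
        hvec (xdeg F' (Suc (Suc n))) (xdeg F (Suc n) b) (t b) \<and>
        \<gamma> (Suc n) b = lin_ext (xdiff F' (Suc n)) (t b) + lin_ext s (xdiff F n b)"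
      by metis
    have Q: "Q n s t" using t by (simp add: Q_def)
    moreover have "P (Suc n) t"
      unfolding P_def
    proof (intro conjI allI impI)
      show "gmap X (xbasis F (Suc n)) (xdeg F (Suc n)) (xbasis F' (Suc (Suc n))) (xdeg F' (Suc (Suc n))) t"
        unfolding gmap_def using t by blast
      fix v assume v: "v \<in> free_module X (xbasis F (Suc n))"
        and "\<forall>k. Suc n = Suc k \<longrightarrow> entries_in (xnull I k) (lin_ext (xdiff F k) v)"
      then have null: "entries_in (xnull I n) (lin_ext (xdiff F n) v)" by simp
      \<comment> \<open>For n = 0 the vector \<open>v\<close> is a cycle only modulo
        \<open>I\<close>, so the term vanishes for another reason: \<open>s\<close> is 0
        there.\<close>
      have "lin_ext s (lin_ext (xdiff F n) v) = 0"
      proof (cases n)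
        case 0
        then show ?thesis using P by (simp add: P_def)
      qed (use null in simp)
      moreover have "lin_ext (\<gamma> (Suc n)) v =
          lin_ext (\<lambda>b. lin_ext (xdiff F' (Suc n)) (t b) + lin_ext s (xdiff F n b)) v"
        by (rule lin_ext_cong) (use Q v in \<open>auto simp: Q_def dest: free_module_keys\<close>)
      ultimately show "entries_in (xnull I (Suc n)) (lin_ext (\<gamma> (Suc n)) v - lin_ext (xdiff F' (Suc n)) (lin_ext t v))"
        by (simp add: lin_ext_fun_add lin_ext_lin_ext)
    qed simp
    ultimately show "\<exists>t. P (Suc n) t \<and> Q n s t" by blast
  qed
  then obtain s where "\<And>n. P n (s n) \<and> Q n (s n) (s (Suc n))" by blast
  then have "\<And>n. P n (s n)" "\<And>n. Q n (s n) (s (Suc n))" by blast+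
  then show ?thesis unfolding P_def Q_def by (intro exI[of _ s]) blast
qed

section \<open>Independence of Tor from the resolution\<close>

lemma tensor_diff_eps: "tensor_diff F i = lin_ext (\<lambda>b. eps (diff F i b))"
  by (simp add: tensor_diff_def eps_def)

lemma lin_subspace_tensor_part: "lin_subspace (tensor_part F i j)"
  unfolding lin_subspace_def tensor_part_def mem_Collect_eq
  by (intro conjI ballI allI; (intro order_trans[OF Poly_Mapping.keys_add] order_trans[OF keys_scal])?) auto

lemma lin_subspace_tor_cycles: "lin_subspace (tor_cycles F i j)"
  using lin_subspaceD[OF lin_subspace_tensor_part]
  by (auto simp: tor_cycles_def tensor_diff_eps lin_subspace_def lin_ext_add lin_ext_scal split: nat.split)

lemma lin_subspace_tor_boundaries: "lin_subspace (tor_boundaries F i j)"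
  unfolding lin_subspace_def tor_boundaries_def tensor_diff_eps
proof (intro conjI ballI allI)
  note V = lin_subspaceD[OF lin_subspace_tensor_part[of F "Suc i" j]]
  let ?D = "lin_ext (\<lambda>b. eps (diff F i b))"
  show "0 \<in> ?D ` tensor_part F (Suc i) j" using V(1) by (intro image_eqI[of _ _ 0]) auto
  show "x + y \<in> ?D ` tensor_part F (Suc i) j"
    if "x \<in> ?D ` tensor_part F (Suc i) j" "y \<in> ?D ` tensor_part F (Suc i) j" for x y
    using that V(2) by (auto simp: lin_ext_add[symmetric])
  show "scal r x \<in> ?D ` tensor_part F (Suc i) j" if "x \<in> ?D ` tensor_part F (Suc i) j" for r x
    using that V(3) by (auto simp: lin_ext_scal[symmetric])
qed

lemma tor_cycles_Suc: "z \<in> tor_cycles F (Suc i) j \<longleftrightarrow>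
    keys z \<subseteq> {b \<in> basis F (Suc i). bdeg F (Suc i) b = j} \<and> lin_ext (\<lambda>b. eps (diff F i b)) z = 0"
  by (simp add: tor_cycles_def tensor_part_def tensor_diff_eps)

lemma tor_cycles_keys: "z \<in> tor_cycles F i j \<Longrightarrow> keys z \<subseteq> {b \<in> basis F i. bdeg F i b = j}"
  by (auto simp: tor_cycles_def tensor_part_def split: nat.splits)

lemma tor_boundaries_iff: "z \<in> tor_boundaries F i j \<longleftrightarrow>
    (\<exists>w. keys w \<subseteq> {b \<in> basis F (Suc i). bdeg F (Suc i) b = j} \<and> z = lin_ext (\<lambda>b. eps (diff F i b)) w)"
  by (auto simp: tor_boundaries_def tensor_part_def tensor_diff_eps)

context
  fixes X :: "'x set" and I :: "('x, 'k::field) mpoly set"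
  assumes I: "ring_ideal X I" and hom: "\<And>n p. p \<in> I \<Longrightarrow> pcomp n p \<in> I"
begin

lemma tor_boundaries_subset:
  assumes "graded_free_resolution X I F"
  shows "tor_boundaries F i j \<subseteq> tor_cycles F i j"
proof
  fix z assume "z \<in> tor_boundaries F i j"
  then obtain w where w: "keys w \<subseteq> {b \<in> basis F (Suc i). bdeg F (Suc i) b = j}"
      "z = lin_ext (\<lambda>b. eps (diff F i b)) w" by (auto simp: tor_boundaries_iff)
  have gm: "gmap X (basis F (Suc i)) (bdeg F (Suc i)) (basis F i) (bdeg F i) (diff F i)"
    using gmap_xdiff[OF assms I hom, of "Suc i"] by simp
  have k: "keys z \<subseteq> {b \<in> basis F i. bdeg F i b = j}"
    unfolding w(2) by (rule gmap_eps_keys[OF gm w(1)])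
  show "z \<in> tor_cycles F i j"
  proof (cases i)
    case 0
    then show ?thesis using k by (simp add: tor_cycles_def tensor_part_def)
  next
    case (Suc n)
    have "const_lift w \<in> free_module X (xbasis F (Suc (Suc (Suc n))))"
      using w(1) Suc by (intro free_module_const_lift) auto
    from xdiff_xdiff[OF assms I hom this]
    have "lin_ext (diff F n) (lin_ext (diff F i) (const_lift w)) = 0" using Suc by simp
    moreover have "lin_ext (\<lambda>b. eps (diff F n b)) z = eps (lin_ext (diff F n) (lin_ext (diff F i) (const_lift w)))"
      unfolding w(2) by (simp add: eps_lin_ext)
    ultimately have "lin_ext (\<lambda>b. eps (diff F n b)) z = 0" by simp
    then show ?thesis using k Suc by (simp add: tor_cycles_Suc)
  qed
qed

text \<open>Indices are shifted by one: \<open>\<phi> (Suc i)\<close> acts on the module in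
  homological degree \<open>i\<close>, since position 0 of the augmented complex is R.\<close>

lemma tensor_chain_map:
  assumes chain: "\<And>n b. b \<in> xbasis F (Suc n) \<Longrightarrow>
       entries_in (xnull I n) (lin_ext (xdiff F' n) (\<phi> (Suc n) b) - lin_ext (\<phi> n) (xdiff F n b))"
    and z: "keys z \<subseteq> basis F (Suc i)"
  shows "lin_ext (\<lambda>b. eps (diff F' i b)) (lin_ext (\<lambda>b. eps (\<phi> (Suc (Suc i)) b)) z) =
    lin_ext (\<lambda>b. eps (\<phi> (Suc i) b)) (lin_ext (\<lambda>b. eps (diff F i b)) z)"
proof -
  have "lin_ext (diff F' i) (\<phi> (Suc (Suc i)) b) = lin_ext (\<phi> (Suc i)) (diff F i b)"
    if "b \<in> keys z" for b
    using chain[of b "Suc i"] z that by auto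
  then have "lin_ext (\<lambda>b. eps (lin_ext (diff F' i) (\<phi> (Suc (Suc i)) b))) z =
      lin_ext (\<lambda>b. eps (lin_ext (\<phi> (Suc i)) (diff F i b))) z"
    by (intro lin_ext_cong) simp
  then show ?thesis by (simp add: lin_ext_lin_ext eps_lin_ext)
qed

text \<open>Comparison maps in both directions compose to the identity up to homotopy.\<close>
lemma tor_injection_exists:
  assumes res: "graded_free_resolution X I F" "graded_free_resolution X I F'"
  shows "\<exists>f. \<forall>z\<in>tor_cycles F i j. lin_ext f z \<in> tor_cycles F' i j \<and>
    (lin_ext f z \<in> tor_boundaries F' i j \<longrightarrow> z \<in> tor_boundaries F i j)"
proof -
  from chain_map_exists[OF res I hom] obtain \<phi> where \<phi>: "\<phi> 0 = (\<lambda>b. Poly_Mapping.single b 1)"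
    "\<And>n. gmap X (xbasis F n) (xdeg F n) (xbasis F' n) (xdeg F' n) (\<phi> n)"
    "\<And>n b. b \<in> xbasis F (Suc n) \<Longrightarrow>
       entries_in (xnull I n) (lin_ext (xdiff F' n) (\<phi> (Suc n) b) - lin_ext (\<phi> n) (xdiff F n b))"
    by blast
  from chain_map_exists[OF res(2,1) I hom] obtain \<psi> where \<psi>: "\<psi> 0 = (\<lambda>b. Poly_Mapping.single b 1)"
    "\<And>n. gmap X (xbasis F' n) (xdeg F' n) (xbasis F n) (xdeg F n) (\<psi> n)"
    "\<And>n b. b \<in> xbasis F' (Suc n) \<Longrightarrow>
       entries_in (xnull I n) (lin_ext (xdiff F n) (\<psi> (Suc n) b) - lin_ext (\<psi> n) (xdiff F' n b))"
    by blast
  define \<gamma> where "\<gamma> = (\<lambda>n b. Poly_Mapping.single b 1 - lin_ext (\<psi> n) (\<phi> n b))"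
  have "\<exists>s. s 0 = (\<lambda>b. 0) \<and>
    (\<forall>n. gmap X (xbasis F n) (xdeg F n) (xbasis F (Suc n)) (xdeg F (Suc n)) (s n)) \<and>
    (\<forall>n. \<forall>b\<in>xbasis F (Suc n).
       \<gamma> (Suc n) b = lin_ext (xdiff F (Suc n)) (s (Suc n) b) + lin_ext (s n) (xdiff F n b))"
  proof (rule null_homotopy_exists[OF res(1,1) I hom])
    show "gmap X (xbasis F n) (xdeg F n) (xbasis F n) (xdeg F n) (\<gamma> n)" for n
      unfolding \<gamma>_def by (intro gmap_diff gmap_unit gmap_comp[OF \<phi>(2) \<psi>(2)])
    show "\<gamma> 0 = (\<lambda>b. 0)" by (simp add: \<gamma>_def \<phi>(1) \<psi>(1))
    fix n b assume b: "b \<in> xbasis F (Suc n)"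
    note J = ring_ideal_xnull[OF I, of n]
    \<comment> \<open>\<open>?x\<close> is the failure of \<open>\<psi>\<close> to commute with the
      differentials, evaluated at \<open>\<phi> (Suc n) b\<close>; \<open>?y\<close> is the image
      under \<open>\<psi>\<close> of the same failure for \<open>\<phi>\<close>. Their sum is the
      negative of the failure for \<open>\<gamma>\<close>.\<close>
    let ?x = "lin_ext (\<lambda>c. lin_ext (xdiff F n) (\<psi> (Suc n) c) - lin_ext (\<psi> n) (xdiff F' n c)) (\<phi> (Suc n) b)"
    let ?y = "lin_ext (\<psi> n) (lin_ext (xdiff F' n) (\<phi> (Suc n) b) - lin_ext (\<phi> n) (xdiff F n b))"
    have \<phi>b: "\<phi> (Suc n) b \<in> free_module X (xbasis F' (Suc n))" using \<phi>(2)[of "Suc n"] b by (auto simp: gmap_def)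
    have "entries_in (xnull I n) ?x"
      using J \<phi>b \<psi>(3) by (rule entries_in_lin_ext2)
    moreover have "entries_in (xnull I n) ?y"
    proof (rule entries_in_lin_ext1[OF J \<phi>(3)[OF b]])
      have "xdiff F n b \<in> free_module X (xbasis F n)"
        using gmap_xdiff[OF res(1) I hom, of n] b by (auto simp: gmap_def)
      then show "lin_ext (xdiff F' n) (\<phi> (Suc n) b) - lin_ext (\<phi> n) (xdiff F n b) \<in> free_module X (xbasis F' n)"
        by (intro free_module_diff gmap_free_module[OF gmap_xdiff[OF res(2) I hom]] \<phi>b gmap_free_module[OF \<phi>(2)])
      show "\<psi> n c \<in> free_module X (xbasis F n)" if "c \<in> xbasis F' n" for c
        using \<psi>(2)[of n] that by (auto simp: gmap_def)
    qed
    ultimately have "entries_in (xnull I n) (- (?x + ?y))" by (intro entries_inD[OF J])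
    also have "- (?x + ?y) = lin_ext (xdiff F n) (\<gamma> (Suc n) b) - lin_ext (\<gamma> n) (xdiff F n b)"
      by (simp add: \<gamma>_def lin_ext_fun_diff lin_ext_diff lin_ext_lin_ext)
    finally show "entries_in (xnull I n) (lin_ext (xdiff F n) (\<gamma> (Suc n) b) - lin_ext (\<gamma> n) (xdiff F n b))" .
  qed
  then obtain s where s: "s 0 = (\<lambda>b. 0)"
    "\<And>n. gmap X (xbasis F n) (xdeg F n) (xbasis F (Suc n)) (xdeg F (Suc n)) (s n)"
    "\<And>n b. b \<in> xbasis F (Suc n) \<Longrightarrow>
       \<gamma> (Suc n) b = lin_ext (xdiff F (Suc n)) (s (Suc n) b) + lin_ext (s n) (xdiff F n b)"
    by blast
  let ?f = "\<lambda>b. eps (\<phi> (Suc i) b)" and ?g = "\<lambda>b. eps (\<psi> (Suc i) b)"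
  show ?thesis
  proof (intro exI[of _ ?f] ballI conjI impI)
    fix z assume z: "z \<in> tor_cycles F i j"
    have kz: "keys z \<subseteq> {b \<in> xbasis F (Suc i). xdeg F (Suc i) b = j}"
      using tor_cycles_keys[OF z] by simp
    have kfz: "keys (lin_ext ?f z) \<subseteq> {b \<in> basis F' i. bdeg F' i b = j}"
      using gmap_eps_keys[OF \<phi>(2) kz] by simp
    show "lin_ext ?f z \<in> tor_cycles F' i j"
    proof (cases i)
      case 0
      then show ?thesis using kfz by (simp add: tor_cycles_def tensor_part_def)
    next
      case (Suc k)
      have "lin_ext (\<lambda>b. eps (diff F' k b)) (lin_ext ?f z) =
          lin_ext (\<lambda>b. eps (\<phi> (Suc k) b)) (lin_ext (\<lambda>b. eps (diff F k b)) z)"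
        unfolding Suc by (rule tensor_chain_map[OF \<phi>(3)]) (use kz Suc in auto)
      then show ?thesis using kfz z unfolding Suc tor_cycles_Suc by simp
    qed
    assume "lin_ext ?f z \<in> tor_boundaries F' i j"
    then obtain w where w: "keys w \<subseteq> {b \<in> basis F' (Suc i). bdeg F' (Suc i) b = j}"
      "lin_ext ?f z = lin_ext (\<lambda>b. eps (diff F' i b)) w" by (auto simp: tor_boundaries_iff)
    have "lin_ext ?g (lin_ext ?f z) =
        lin_ext (\<lambda>b. eps (diff F i b)) (lin_ext (\<lambda>b. eps (\<psi> (Suc (Suc i)) b)) w)"
      unfolding w(2) by (rule tensor_chain_map[OF \<psi>(3), symmetric]) (use w(1) in auto)
    moreover have "keys (lin_ext (\<lambda>b. eps (\<psi> (Suc (Suc i)) b)) w) \<subseteq> {b \<in> basis F (Suc i). bdeg F (Suc i) b = j}"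
      using gmap_eps_keys[OF \<psi>(2)[of "Suc (Suc i)"]] w(1) by simp
    ultimately have gfz: "lin_ext ?g (lin_ext ?f z) \<in> tor_boundaries F i j"
      by (auto simp: tor_boundaries_iff)
    have "lin_ext (\<lambda>b. eps (\<gamma> (Suc i) b)) z =
        lin_ext (\<lambda>b. eps (lin_ext (xdiff F (Suc i)) (s (Suc i) b) + lin_ext (s i) (xdiff F i b))) z"
      by (rule lin_ext_cong) (use kz s(3) in auto)
    also have "\<dots> = lin_ext (\<lambda>b. eps (diff F i b)) (lin_ext (\<lambda>b. eps (s (Suc i) b)) z) +
        lin_ext (\<lambda>b. eps (s i b)) (lin_ext (\<lambda>b. eps (xdiff F i b)) z)"
      by (simp add: lin_ext_fun_add eps_lin_ext lin_ext_lin_ext)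
    \<comment> \<open>In positive degree the cycle condition on \<open>z\<close> kills this term. In
      degree 0 there is no such condition, and \<open>s 0 = 0\<close> is used instead.\<close>
    also have "lin_ext (\<lambda>b. eps (s i b)) (lin_ext (\<lambda>b. eps (xdiff F i b)) z) = 0"
    proof (cases i)
      case 0
      then show ?thesis by (simp add: s(1))
    next
      case (Suc k)
      then show ?thesis using z by (simp add: tor_cycles_Suc)
    qed
    finally have hz: "lin_ext (\<lambda>b. eps (\<gamma> (Suc i) b)) z =
      lin_ext (\<lambda>b. eps (diff F i b)) (lin_ext (\<lambda>b. eps (s (Suc i) b)) z)" by simp
    have "lin_ext (\<lambda>b. eps (\<gamma> (Suc i) b)) z = z - lin_ext ?g (lin_ext ?f z)"
      by (simp add: \<gamma>_def lin_ext_fun_diff lin_ext_lin_ext eps_lin_ext)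
    moreover have "keys (lin_ext (\<lambda>b. eps (s (Suc i) b)) z) \<subseteq> {b \<in> basis F (Suc i). bdeg F (Suc i) b = j}"
      using gmap_eps_keys[OF s(2) kz] by simp
    ultimately have "z - lin_ext ?g (lin_ext ?f z) \<in> tor_boundaries F i j"
      using hz by (auto simp: tor_boundaries_iff)
    from lin_subspaceD(2)[OF lin_subspace_tor_boundaries this gfz]
    show "z \<in> tor_boundaries F i j" by simp
  qed
qed

text \<open>Maps in both directions that detect boundaries force equal dimensions, so the arbitrary
  resolution inside \<open>betti\<close> may be replaced by any given one, in particular by a
  mapping cone.\<close>

lemma betti_eq:
  assumes "graded_free_resolution X I F" "i \<ge> 0" "j \<ge> 0"
  shows "betti X I i j = quotient_dim (tor_cycles F (nat i) j) (tor_boundaries F (nat i) j)"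
proof -
  define F' where "F' = (SOME F. graded_free_resolution X I F)"
  have res': "graded_free_resolution X I F'" unfolding F'_def using assms(1) by (rule someI)
  obtain f g where
    "\<forall>z\<in>tor_cycles F' (nat i) j. lin_ext f z \<in> tor_cycles F (nat i) j \<and>
      (lin_ext f z \<in> tor_boundaries F (nat i) j \<longrightarrow> z \<in> tor_boundaries F' (nat i) j)"
    "\<forall>z\<in>tor_cycles F (nat i) j. lin_ext g z \<in> tor_cycles F' (nat i) j \<and>
      (lin_ext g z \<in> tor_boundaries F' (nat i) j \<longrightarrow> z \<in> tor_boundaries F (nat i) j)"
    using tor_injection_exists[OF res' assms(1)] tor_injection_exists[OF assms(1) res'] by blast
  then have "quotient_dim (tor_cycles F' (nat i) j) (tor_boundaries F' (nat i) j) =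
      quotient_dim (tor_cycles F (nat i) j) (tor_boundaries F (nat i) j)"
    by (intro quotient_dim_cong[where f = f and g = g] lin_subspace_tor_cycles lin_subspace_tor_boundaries
        tor_boundaries_subset res' assms(1)) auto
  then show ?thesis using assms by (simp add: betti_def F'_def[symmetric])
qed

end

section \<open>The mapping cone of a nonzerodivisor\<close>

text \<open>Bases of a \<open>free_complex\<close> are sets of natural numbers, so a direct sum is
  encoded by placing its summands on the even and the odd numbers.\<close>

definition in0 :: "(nat \<Rightarrow>\<^sub>0 'r::comm_ring_1) \<Rightarrow> (nat \<Rightarrow>\<^sub>0 'r)" where
  "in0 = lin_ext (\<lambda>b. Poly_Mapping.single (2 * b) 1)"

definition in1 :: "(nat \<Rightarrow>\<^sub>0 'r::comm_ring_1) \<Rightarrow> (nat \<Rightarrow>\<^sub>0 'r)" where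
  "in1 = lin_ext (\<lambda>b. Poly_Mapping.single (2 * b + 1) 1)"

definition pr0 :: "(nat \<Rightarrow>\<^sub>0 'r::comm_ring_1) \<Rightarrow> (nat \<Rightarrow>\<^sub>0 'r)" where
  "pr0 = lin_ext (\<lambda>n. if even n then Poly_Mapping.single (n div 2) 1 else 0)"

definition pr1 :: "(nat \<Rightarrow>\<^sub>0 'r::comm_ring_1) \<Rightarrow> (nat \<Rightarrow>\<^sub>0 'r)" where
  "pr1 = lin_ext (\<lambda>n. if even n then 0 else Poly_Mapping.single (n div 2) 1)"

lemmas in_pr_defs = in0_def in1_def pr0_def pr1_def

lemma in_pr_linear:
  "in0 0 = 0" "in0 (u + v) = in0 u + in0 v" "in0 (u - v) = in0 u - in0 v" "in0 (- u) = - in0 u"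
  "in1 0 = 0" "in1 (u + v) = in1 u + in1 v" "in1 (u - v) = in1 u - in1 v" "in1 (- u) = - in1 u"
  "pr0 0 = 0" "pr0 (u + v) = pr0 u + pr0 v" "pr0 (u - v) = pr0 u - pr0 v"
  "pr1 0 = 0" "pr1 (u + v) = pr1 u + pr1 v" "pr1 (u - v) = pr1 u - pr1 v"
  by (simp_all add: in_pr_defs lin_ext_add lin_ext_diff lin_ext_uminus)

lemma pr_in [simp]: "pr0 (in0 v) = v" "pr0 (in1 v) = 0" "pr1 (in0 v) = 0" "pr1 (in1 v) = v"
  by (simp_all add: in_pr_defs lin_ext_lin_ext)

lemma in_pr_decomp: "in0 (pr0 w) + in1 (pr1 w) = w"
proof -
  have "in0 (pr0 w) + in1 (pr1 w) = lin_ext (\<lambda>b. Poly_Mapping.single b 1) w"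
    unfolding in_pr_defs lin_ext_lin_ext lin_ext_fun_add[symmetric]
    by (rule lin_ext_cong) auto
  then show ?thesis by simp
qed

lemma in0_single [simp]: "in0 (Poly_Mapping.single b r) = Poly_Mapping.single (2 * b) r"
  and in1_single [simp]: "in1 (Poly_Mapping.single b r) = Poly_Mapping.single (2 * b + 1) r"
  by (simp_all add: in0_def in1_def scal_single)

lemma keys_in0: "keys (in0 v) \<subseteq> (\<lambda>b. 2 * b) ` keys v"
  and keys_in1: "keys (in1 v) \<subseteq> (\<lambda>b. 2 * b + 1) ` keys v"
  unfolding in0_def in1_def by (rule order_trans[OF keys_lin_ext], (auto)[1])+

lemma keys_pr0: "keys (pr0 w) \<subseteq> {b. 2 * b \<in> keys w}"
  and keys_pr1: "keys (pr1 w) \<subseteq> {b. 2 * b + 1 \<in> keys w}"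
  unfolding pr0_def pr1_def
  by (rule order_trans[OF keys_lin_ext], (auto split: if_splits elim!: oddE evenE)[1])+

lemma eps_in: "eps (in0 v) = in0 (eps v)" "eps (in1 v) = in1 (eps v)"
  by (simp_all add: in_pr_defs eps_lin_ext)

text \<open>The mapping cone of multiplication by \<open>f\<close> on the complex \<open>F\<close>: the basis elements with even number
  form \<open>F\<^sub>i\<close>, those with odd number \<open>F\<^bsub>i-1\<^esub>(- d)\<close>.\<close>
definition cone :: "('x, 'k::comm_ring_1) mpoly \<Rightarrow> int \<Rightarrow> ('x, 'k) free_complex \<Rightarrow> ('x, 'k) free_complex" where
  "cone f d F = \<lparr>
     basis = (\<lambda>i. (\<lambda>b. 2 * b) ` basis F i \<union> (case i of 0 \<Rightarrow> {} | Suc k \<Rightarrow> (\<lambda>b. 2 * b + 1) ` basis F k)),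
     bdeg = (\<lambda>i n. if even n then bdeg F i (n div 2) else (case i of 0 \<Rightarrow> 0 | Suc k \<Rightarrow> bdeg F k (n div 2) + d)),
     diff = (\<lambda>i n. if even n then in0 (diff F i (n div 2))
       else in0 (Poly_Mapping.single (n div 2) f) - (case i of 0 \<Rightarrow> 0 | Suc k \<Rightarrow> in1 (diff F k (n div 2)))),
     aug = (\<lambda>n. aug F (n div 2))\<rparr>"

text \<open>\<open>diff\<close> is indexed by its target. This is the differential leaving
  homological degree \<open>i\<close>, with value 0 in degree 0.\<close>

definition lower_diff :: "('x, 'k::comm_ring_1) free_complex \<Rightarrow> nat \<Rightarrow> (nat \<Rightarrow>\<^sub>0 ('x, 'k) mpoly) \<Rightarrow> (nat \<Rightarrow>\<^sub>0 ('x, 'k) mpoly)" where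
  "lower_diff F i v = (case i of 0 \<Rightarrow> 0 | Suc k \<Rightarrow> lin_ext (diff F k) v)"

lemma cone_diff_in0: "lin_ext (diff (cone f d F) i) (in0 u) = in0 (lin_ext (diff F i) u)"
  by (simp add: cone_def in0_def lin_ext_lin_ext)

text \<open>With the minus sign the differential squares to zero: the two occurrences of f d v
  cancel.\<close>

lemma cone_diff_in1:
  "lin_ext (diff (cone f d F) i) (in1 v) = in0 (scal f v) - in1 (lower_diff F i v)"
proof -
  have "lin_ext (diff (cone f d F) i) (in1 v) =
      lin_ext (\<lambda>b. in0 (Poly_Mapping.single b f) - (case i of 0 \<Rightarrow> 0 | Suc k \<Rightarrow> in1 (diff F k b))) v"
    unfolding in1_def lin_ext_lin_ext
    by (rule lin_ext_cong) (simp add: cone_def in1_def split: nat.split)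
  also have "\<dots> = in0 (lin_ext (\<lambda>b. Poly_Mapping.single b f) v) - in1 (lower_diff F i v)"
    by (cases i) (simp_all add: lin_ext_fun_diff in0_def in1_def lin_ext_lin_ext lower_diff_def)
  also have "lin_ext (\<lambda>b. Poly_Mapping.single b f) v = lin_ext (\<lambda>b. scal f (Poly_Mapping.single b 1)) v"
    by (simp add: scal_single)
  also have "\<dots> = scal f v" unfolding lin_ext_fun_scal by simp
  finally show ?thesis .
qed

lemma cone_basis:
  "basis (cone f d F) 0 = (\<lambda>b. 2 * b) ` basis F 0"
  "basis (cone f d F) (Suc k) = (\<lambda>b. 2 * b) ` basis F (Suc k) \<union> (\<lambda>b. 2 * b + 1) ` basis F k"
  by (simp_all add: cone_def)

lemma cone_bdeg [simp]:
  "bdeg (cone f d F) i (2 * b) = bdeg F i b"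
  "bdeg (cone f d F) (Suc k) (Suc (2 * b)) = bdeg F k b + d"
  by (simp_all add: cone_def)

lemma aug_map_eq: "aug_map F v = lookup (lin_ext (\<lambda>b. Poly_Mapping.single (0::nat) (aug F b)) v) 0"
  by (simp add: aug_map_def lookup_lin_ext)

lemma aug_map_linear:
  "aug_map F (u + v) = aug_map F u + aug_map F v" "aug_map F (u - v) = aug_map F u - aug_map F v"
  "aug_map F (- u) = - aug_map F u" "aug_map F (scal r v) = r * aug_map F v" "aug_map F 0 = 0"
  by (simp_all add: aug_map_eq lin_ext_add lin_ext_diff lin_ext_scal lin_ext_uminus lookup_add lookup_minus)

lemma cone_aug_in0: "aug_map (cone f d F) (in0 v) = aug_map F v"
  by (simp add: aug_map_eq cone_def in0_def lin_ext_lin_ext)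

lemma free_module_in0: "v \<in> free_module X B \<Longrightarrow> in0 v \<in> free_module X ((\<lambda>b. 2 * b) ` B \<union> B')"
  unfolding in0_def by (erule free_module_lin_ext) (auto intro: free_module_single)

lemma free_module_in1: "v \<in> free_module X B \<Longrightarrow> in1 v \<in> free_module X (B' \<union> (\<lambda>b. 2 * b + 1) ` B)"
  unfolding in1_def by (erule free_module_lin_ext) (auto intro: free_module_single)

lemma free_module_pr0:
  assumes "w \<in> free_module X ((\<lambda>b. 2 * b) ` B0 \<union> (\<lambda>b. 2 * b + 1) ` B1)"
  shows "pr0 w \<in> free_module X B0"
  using assms unfolding pr0_def
  by (rule free_module_lin_ext) (auto intro!: free_module_single)

lemma free_module_pr1:
  assumes "w \<in> free_module X ((\<lambda>b. 2 * b) ` B0 \<union> (\<lambda>b. 2 * b + 1) ` B1)"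
  shows "pr1 w \<in> free_module X B1"
  using assms unfolding pr1_def
  by (rule free_module_lin_ext) (auto intro!: free_module_single)

lemma cone_free_module_Suc:
  "w \<in> free_module X (basis (cone f d F) (Suc k)) \<longleftrightarrow>
    (\<exists>u\<in>free_module X (basis F (Suc k)). \<exists>v\<in>free_module X (basis F k). w = in0 u + in1 v)"
proof
  assume w: "w \<in> free_module X (basis (cone f d F) (Suc k))"
  show "\<exists>u\<in>free_module X (basis F (Suc k)). \<exists>v\<in>free_module X (basis F k). w = in0 u + in1 v"
    using free_module_pr0[OF w[unfolded cone_basis]] free_module_pr1[OF w[unfolded cone_basis]]
      in_pr_decomp[of w] by metis
next
  assume "\<exists>u\<in>free_module X (basis F (Suc k)). \<exists>v\<in>free_module X (basis F k). w = in0 u + in1 v"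
  then show "w \<in> free_module X (basis (cone f d F) (Suc k))"
    unfolding cone_basis by (elim bexE, hypsubst) (intro free_module_add free_module_in0 free_module_in1)
qed

lemma cone_free_module_0:
  "w \<in> free_module X (basis (cone f d F) 0) \<longleftrightarrow> (\<exists>u\<in>free_module X (basis F 0). w = in0 u)"
proof
  assume "w \<in> free_module X (basis (cone f d F) 0)"
  then have w: "w \<in> free_module X ((\<lambda>b. 2 * b) ` basis F 0 \<union> (\<lambda>b. 2 * b + 1) ` {})"
    by (simp add: cone_basis)
  have "pr1 w \<in> free_module X {}" by (rule free_module_pr1[OF w])
  then have "pr1 w = 0" by (simp add: free_module_def')
  then show "\<exists>u\<in>free_module X (basis F 0). w = in0 u"
    using free_module_pr0[OF w] in_pr_decomp[of w] by (metis add.right_neutral in_pr_linear(5))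
next
  assume "\<exists>u\<in>free_module X (basis F 0). w = in0 u"
  then show "w \<in> free_module X (basis (cone f d F) 0)"
    using free_module_in0[where B' = "{}"] by (auto simp: cone_basis)
qed

lemma in_add_eq_iff: "in0 u + in1 v = in0 u' + in1 v' \<longleftrightarrow> u = u' \<and> v = v'"
proof
  assume eq: "in0 u + in1 v = in0 u' + in1 v'"
  show "u = u' \<and> v = v'"
    using arg_cong[OF eq, of pr0] arg_cong[OF eq, of pr1] by (simp add: in_pr_linear)
qed simp

lemma in_add_eq_0_iff: "in0 u + in1 v = 0 \<longleftrightarrow> u = 0 \<and> v = 0"
  using in_add_eq_iff[of u v 0 0] by (simp add: in_pr_linear)

definition ideal_plus :: "'x set \<Rightarrow> ('x, 'k::comm_ring_1) mpoly set \<Rightarrow> ('x, 'k) mpoly \<Rightarrow> ('x, 'k) mpoly set" where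
  "ideal_plus X I f = {g + r * f | g r. g \<in> I \<and> r \<in> poly_ring X}"

lemma hvec_in0:
  "hvec (bdeg F i) n v \<Longrightarrow> hvec (bdeg (cone f d F) i) n (in0 v)"
  unfolding in0_def by (erule hvec_lin_ext) (auto simp: hvec_def lookup_single when_def)

lemma hvec_in1:
  "hvec (bdeg F k) n v \<Longrightarrow> hvec (bdeg (cone f d F) (Suc k)) (n + d) (in1 v)"
  unfolding in1_def
  by (rule hvec_lin_ext[where dg = "\<lambda>b. bdeg F k b + d"]) (auto simp: hvec_def lookup_single when_def)

section \<open>Exactness of the cone\<close>

context
  fixes X :: "'x set" and I :: "('x, 'k::field) mpoly set" and F :: "('x, 'k) free_complex"
    and f :: "('x, 'k) mpoly" and d :: int
  assumes I: "ring_ideal X I" and hom: "\<And>n p. p \<in> I \<Longrightarrow> pcomp n p \<in> I"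
    and res: "graded_free_resolution X I F"
    and f: "f \<in> poly_ring X" "homogeneous d f"
    and nzd: "\<And>p. p \<in> poly_ring X \<Longrightarrow> f * p \<in> I \<Longrightarrow> p \<in> I"
begin

lemma diff_gmap: "gmap X (basis F (Suc i)) (bdeg F (Suc i)) (basis F i) (bdeg F i) (diff F i)"
  using gmap_xdiff[OF res I hom, of "Suc i"] by simp

lemma aug_map_poly_ring: "v \<in> free_module X (basis F 0) \<Longrightarrow> aug_map F v \<in> poly_ring X"
  using res unfolding aug_map_def graded_free_resolution_def
  by (intro poly_ring_sum poly_ring_mult) (auto simp: free_module_def')

lemma aug_map_exact_iff: "v \<in> free_module X (basis F 0) \<Longrightarrow>
    aug_map F v \<in> I \<longleftrightarrow> v \<in> lin_ext (diff F 0) ` free_module X (basis F 1)"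
  using xdiff_exact_iff[OF res I hom, of v 0] lin_ext_xdiff_0[of F v]
  by (simp add: entries_in_single[OF I])

lemma diff_exact_iff: "v \<in> free_module X (basis F (Suc i)) \<Longrightarrow>
    lin_ext (diff F i) v = 0 \<longleftrightarrow> v \<in> lin_ext (diff F (Suc i)) ` free_module X (basis F (Suc (Suc i)))"
  using xdiff_exact_iff[OF res I hom, of v "Suc i"] by simp

lemma diff_free_module: "v \<in> free_module X (basis F (Suc i)) \<Longrightarrow> lin_ext (diff F i) v \<in> free_module X (basis F i)"
  by (rule gmap_free_module[OF diff_gmap])

lemma lower_diff_diff: "u \<in> free_module X (basis F (Suc i)) \<Longrightarrow> lower_diff F i (lin_ext (diff F i) u) = 0"
proof (cases i)
  case (Suc k)
  assume "u \<in> free_module X (basis F (Suc i))"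
  then show ?thesis using Suc diff_exact_iff[of "lin_ext (diff F i) u" k] diff_free_module
    by (auto simp: lower_diff_def)
qed (simp add: lower_diff_def)

lemma cone_aug_kernel:
  "{w \<in> free_module X (basis (cone f d F) 0). aug_map (cone f d F) w \<in> ideal_plus X I f} =
    lin_ext (diff (cone f d F) 0) ` free_module X (basis (cone f d F) 1)"
proof (intro set_eqI iffI)
  fix w assume w: "w \<in> {w \<in> free_module X (basis (cone f d F) 0). aug_map (cone f d F) w \<in> ideal_plus X I f}"
  then obtain u where u: "u \<in> free_module X (basis F 0)" "w = in0 u" by (auto simp: cone_free_module_0)
  obtain g r where gr: "aug_map F u = g + r * f" "g \<in> I" "r \<in> poly_ring X"
    using w by (auto simp: u(2) cone_aug_in0 ideal_plus_def)
  have "\<forall>r\<in>poly_ring X. \<exists>w\<in>free_module X (basis F 0). aug_map F w - r \<in> I"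
    using res unfolding graded_free_resolution_def by (elim conjE)
  then obtain v where v: "v \<in> free_module X (basis F 0)" "aug_map F v - r \<in> I" using gr(3) by blast
  \<comment> \<open>Subtracting \<open>f\<close> times a lift \<open>v\<close> of the multiplier
    \<open>r\<close> leaves an augmentation in \<open>I\<close>, so the difference is a
    boundary.\<close>
  have "aug_map F (u - scal f v) = g - f * (aug_map F v - r)"
    by (simp add: aug_map_linear gr(1) algebra_simps)
  also have "\<dots> \<in> I" using ring_idealD(4)[OF I f(1) v(2)] gr(2) by (intro ring_idealD(7)[OF I])
  finally obtain u' where u': "u' \<in> free_module X (basis F 1)" "u - scal f v = lin_ext (diff F 0) u'"
    using aug_map_exact_iff[of "u - scal f v"] u v by (auto intro: free_module_diff free_module_scal f)
  have "w = lin_ext (diff (cone f d F) 0) (in0 u' + in1 v)"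
    using u'(2) by (simp add: u(2) lin_ext_add cone_diff_in0 cone_diff_in1 lower_diff_def in_pr_linear
        in_pr_linear(2)[symmetric] algebra_simps del: in_pr_linear(2))
  moreover have "in0 u' + in1 v \<in> free_module X (basis (cone f d F) 1)"
    using u' v by (auto simp: cone_free_module_Suc)
  ultimately show "w \<in> lin_ext (diff (cone f d F) 0) ` free_module X (basis (cone f d F) 1)" by blast
next
  fix w assume "w \<in> lin_ext (diff (cone f d F) 0) ` free_module X (basis (cone f d F) 1)"
  then obtain u v where uv: "u \<in> free_module X (basis F 1)" "v \<in> free_module X (basis F 0)"
    and "w = lin_ext (diff (cone f d F) 0) (in0 u + in1 v)"
    by (auto simp: cone_free_module_Suc)
  then have w: "w = in0 (lin_ext (diff F 0) u + scal f v)"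
    by (simp add: lin_ext_add cone_diff_in0 cone_diff_in1 lower_diff_def in_pr_linear)
  have fm: "lin_ext (diff F 0) u \<in> free_module X (basis F 0)" using uv diff_free_module[of u 0] by simp
  have "aug_map F (lin_ext (diff F 0) u) \<in> I" using aug_map_exact_iff[OF fm] uv by auto
  moreover have "aug_map F v \<in> poly_ring X" using uv by (intro aug_map_poly_ring)
  ultimately have "aug_map (cone f d F) w \<in> ideal_plus X I f"
    unfolding w cone_aug_in0 aug_map_linear ideal_plus_def
    by (intro CollectI exI conjI) (auto simp: mult.commute)
  moreover have "w \<in> free_module X (basis (cone f d F) 0)"
    unfolding w using fm uv f by (auto simp: cone_free_module_0 intro!: free_module_add free_module_scal)
  ultimately show "w \<in> {w \<in> free_module X (basis (cone f d F) 0). aug_map (cone f d F) w \<in> ideal_plus X I f}"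
    by simp
qed

text \<open>A pair (u, v) in the kernel satisfies d u + f v = 0 and d v = 0. Once v = d v', the
  vector u + f v' is a cycle, hence a boundary d u', and (u', - v') is a preimage; its sign
  compensates the sign in the cone.\<close>

lemma cone_diff_kernel:
  "{w \<in> free_module X (basis (cone f d F) (Suc i)). lin_ext (diff (cone f d F) i) w = 0} =
    lin_ext (diff (cone f d F) (Suc i)) ` free_module X (basis (cone f d F) (Suc (Suc i)))"
proof (intro set_eqI iffI)
  fix w assume w: "w \<in> {w \<in> free_module X (basis (cone f d F) (Suc i)). lin_ext (diff (cone f d F) i) w = 0}"
  then obtain u v where uv: "u \<in> free_module X (basis F (Suc i))" "v \<in> free_module X (basis F i)"
      "w = in0 u + in1 v" by (auto simp: cone_free_module_Suc)
  have "in0 (lin_ext (diff F i) u + scal f v) + in1 (- lower_diff F i v) = 0"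
    using w by (simp add: uv(3) lin_ext_add cone_diff_in0 cone_diff_in1 in_pr_linear add_diff_eq)
  then have 0: "lin_ext (diff F i) u + scal f v = 0" "lower_diff F i v = 0"
    by (simp_all add: in_add_eq_0_iff)
  have "v \<in> lin_ext (diff F i) ` free_module X (basis F (Suc i))"
  proof (cases i)
    case 0
    \<comment> \<open>In degree 0 the second equation says nothing about \<open>v\<close>. Instead,
      \<open>f\<close> times the augmentation of \<open>v\<close> lies in \<open>I\<close>, and the
      nonzerodivisor property moves the augmentation itself into \<open>I\<close>.\<close>
    have "f * aug_map F v = - aug_map F (lin_ext (diff F 0) u)"
      using \<open>lin_ext (diff F i) u + scal f v = 0\<close> 0
      by (simp add: aug_map_linear[symmetric] add_eq_0_iff2 del: scal_simps)
    moreover have "aug_map F (lin_ext (diff F 0) u) \<in> I"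
      using aug_map_exact_iff[OF diff_free_module[of u 0]] uv(1) 0 by simp
    ultimately have "f * aug_map F v \<in> I" using ring_idealD(6)[OF I] by simp
    moreover have "aug_map F v \<in> poly_ring X" using uv(2) 0 by (intro aug_map_poly_ring) simp
    ultimately have "aug_map F v \<in> I" by (intro nzd[of "aug_map F v"])
    then show ?thesis using aug_map_exact_iff[of v] uv(2) 0 by simp
  next
    case (Suc k)
    then show ?thesis using diff_exact_iff[of v k] uv(2) 0(2) by (simp add: lower_diff_def)
  qed
  then obtain v' where v': "v' \<in> free_module X (basis F (Suc i))" "v = lin_ext (diff F i) v'" by blast
  have "lin_ext (diff F i) (u + scal f v') = 0"
    using 0(1) by (simp add: lin_ext_add lin_ext_scal v'(2))
  then obtain u' where u': "u' \<in> free_module X (basis F (Suc (Suc i)))" "u + scal f v' = lin_ext (diff F (Suc i)) u'"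
    using diff_exact_iff[of "u + scal f v'" i] uv(1) v'(1) f by (auto intro: free_module_add free_module_scal)
  have u: "u = lin_ext (diff F (Suc i)) u' - scal f v'" using u'(2) by (simp add: algebra_simps)
  have "w = lin_ext (diff (cone f d F) (Suc i)) (in0 u' + in1 (- v'))"
    by (simp add: uv(3) u v'(2) lin_ext_add lin_ext_diff cone_diff_in0 cone_diff_in1 lower_diff_def in_pr_linear)
  moreover have "in0 u' + in1 (- v') \<in> free_module X (basis (cone f d F) (Suc (Suc i)))"
    unfolding cone_free_module_Suc using u'(1) free_module_uminus[OF v'(1)] by blast
  ultimately show "w \<in> lin_ext (diff (cone f d F) (Suc i)) ` free_module X (basis (cone f d F) (Suc (Suc i)))"
    by blast
next
  fix w assume "w \<in> lin_ext (diff (cone f d F) (Suc i)) ` free_module X (basis (cone f d F) (Suc (Suc i)))"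
  then obtain u v where uv: "u \<in> free_module X (basis F (Suc (Suc i)))" "v \<in> free_module X (basis F (Suc i))"
    and "w = lin_ext (diff (cone f d F) (Suc i)) (in0 u + in1 v)"
    by (auto simp: cone_free_module_Suc)
  then have w: "w = in0 (lin_ext (diff F (Suc i)) u + scal f v) + in1 (- lin_ext (diff F i) v)"
    by (simp add: lin_ext_add cone_diff_in0 cone_diff_in1 lower_diff_def in_pr_linear)
  have fm: "lin_ext (diff F (Suc i)) u \<in> free_module X (basis F (Suc i))" using uv diff_free_module by simp
  have "lin_ext (diff F i) (lin_ext (diff F (Suc i)) u) = 0" using diff_exact_iff[OF fm] uv by blast
  then have "lin_ext (diff (cone f d F) i) w = 0"
    using lower_diff_diff[OF uv(2)]
    by (simp add: w lin_ext_add lin_ext_diff lin_ext_scal cone_diff_in0 cone_diff_in1 in_pr_linear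
        lower_diff_def split: nat.splits)
  moreover have "w \<in> free_module X (basis (cone f d F) (Suc i))"
    unfolding w cone_free_module_Suc
    using free_module_add[OF fm free_module_scal[OF f(1) uv(2)]] free_module_uminus[OF diff_free_module[OF uv(2)]]
    by blast
  ultimately show "w \<in> {w \<in> free_module X (basis (cone f d F) (Suc i)). lin_ext (diff (cone f d F) i) w = 0}"
    by simp
qed

lemma cone_diff_gmap:
  assumes n: "n \<in> basis (cone f d F) (Suc i)"
  shows "diff (cone f d F) i n \<in> free_module X (basis (cone f d F) i)"
    "hvec (bdeg (cone f d F) i) (bdeg (cone f d F) (Suc i) n) (diff (cone f d F) i n)"
proof -
  have "diff (cone f d F) i n \<in> free_module X (basis (cone f d F) i) \<and>
    hvec (bdeg (cone f d F) i) (bdeg (cone f d F) (Suc i) n) (diff (cone f d F) i n)"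
  proof (cases "even n")
    case True
    then obtain b where b: "n = 2 * b" "b \<in> basis F (Suc i)"
      using n unfolding cone_basis by auto
    have D: "diff (cone f d F) i n = in0 (diff F i b)" by (simp add: cone_def b)
    have *: "diff F i b \<in> free_module X (basis F i)" "hvec (bdeg F i) (bdeg F (Suc i) b) (diff F i b)"
      using diff_gmap b(2) by (auto simp: gmap_def)
    then show ?thesis unfolding D b(1) cone_bdeg
      using hvec_in0[OF *(2)] free_module_in0[OF *(1)] by (simp add: cone_def)
  next
    case False
    then obtain b where b: "n = 2 * b + 1" "b \<in> basis F i"
      using n unfolding cone_basis by auto
    have D: "diff (cone f d F) i n =
        in0 (Poly_Mapping.single b f) - (case i of 0 \<Rightarrow> 0 | Suc k \<Rightarrow> in1 (diff F k b))"
      by (simp add: cone_def b split: nat.split)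
    have s: "Poly_Mapping.single b f \<in> free_module X (basis F i)" using f b by (intro free_module_single)
    have sh: "hvec (bdeg F i) (bdeg F i b + d) (Poly_Mapping.single b f)"
      using f(2) by (simp add: hvec_def lookup_single when_def)
    have 1: "in0 (Poly_Mapping.single b f) \<in> free_module X (basis (cone f d F) i)"
      using free_module_in0[OF s] unfolding cone_def by simp
    have 2: "hvec (bdeg (cone f d F) i) (bdeg (cone f d F) (Suc i) n) (in0 (Poly_Mapping.single b f))"
      using hvec_in0[OF sh] b by simp
    show ?thesis
    proof (cases i)
      case 0
      then show ?thesis unfolding D using 1 2 by simp
    next
      case (Suc k)
      have *: "diff F k b \<in> free_module X (basis F k)" "hvec (bdeg F k) (bdeg F (Suc k) b) (diff F k b)"
        using diff_gmap[of k] b(2) Suc by (auto simp: gmap_def)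
      have "in1 (diff F k b) \<in> free_module X (basis (cone f d F) i)"
        using free_module_in1[OF *(1)] unfolding Suc cone_basis .
      moreover have "hvec (bdeg (cone f d F) i) (bdeg (cone f d F) (Suc i) n) (in1 (diff F k b))"
        using hvec_in1[OF *(2)] b Suc by simp
      ultimately show ?thesis unfolding D using 1 2 Suc by (simp add: free_module_diff hvec_diff)
    qed
  qed
  then show "diff (cone f d F) i n \<in> free_module X (basis (cone f d F) i)"
    "hvec (bdeg (cone f d F) i) (bdeg (cone f d F) (Suc i) n) (diff (cone f d F) i n)" by auto
qed

lemma cone_resolution: "graded_free_resolution X (ideal_plus X I f) (cone f d F)"
proof -
  have "\<exists>w\<in>free_module X (basis (cone f d F) 0). aug_map (cone f d F) w - r \<in> ideal_plus X I f"
    if r: "r \<in> poly_ring X" for r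
  proof -
    have "\<forall>r\<in>poly_ring X. \<exists>w\<in>free_module X (basis F 0). aug_map F w - r \<in> I"
      using res unfolding graded_free_resolution_def by (elim conjE)
    then obtain v where v: "v \<in> free_module X (basis F 0)" "aug_map F v - r \<in> I" using r by blast
    then have "aug_map (cone f d F) (in0 v) - r \<in> ideal_plus X I f"
      unfolding cone_aug_in0 ideal_plus_def by (intro CollectI exI[of _ "aug_map F v - r"] exI[of _ 0]) auto
    then show ?thesis using v(1) cone_free_module_0 by (intro bexI[of _ "in0 v"]) blast+
  qed
  moreover have "aug (cone f d F) n \<in> poly_ring X \<and> homogeneous (bdeg (cone f d F) 0 n) (aug (cone f d F) n)"
    if "n \<in> basis (cone f d F) 0" for n
  proof -
    have "\<forall>b\<in>basis F 0. aug F b \<in> poly_ring X \<and> homogeneous (bdeg F 0 b) (aug F b)"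
      using res unfolding graded_free_resolution_def by (elim conjE)
    then show ?thesis using that by (auto simp: cone_basis) (auto simp: cone_def)
  qed
  ultimately show ?thesis
    unfolding graded_free_resolution_def
    using cone_aug_kernel cone_diff_kernel cone_diff_gmap unfolding hvec_def
    by (intro conjI allI ballI) simp_all
qed

end

section \<open>Tor of the mapping cone\<close>

lemma family_basis_empty: "family_basis {0} {0} {} \<sigma>"
  by (auto simp: family_basis_def)

text \<open>The projections \<open>pr0\<close> and \<open>pr1\<close> split a relation among the
  joint representatives into one relation for each summand.\<close>

lemma family_basis_direct_sum:
  fixes \<sigma>0 :: "'a \<Rightarrow> nat \<Rightarrow>\<^sub>0 'k::field" and \<sigma>1 :: "'b \<Rightarrow> nat \<Rightarrow>\<^sub>0 'k"
  assumes fb: "family_basis Z0 B0 A0 \<sigma>0" "family_basis Z1 B1 A1 \<sigma>1"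
    and 0: "0 \<in> Z0" "0 \<in> Z1"
  shows "family_basis {in0 u + in1 v | u v. u \<in> Z0 \<and> v \<in> Z1} {in0 u + in1 v | u v. u \<in> B0 \<and> v \<in> B1}
    (A0 <+> A1) (case_sum (\<lambda>a. in0 (\<sigma>0 a)) (\<lambda>a. in1 (\<sigma>1 a)))"
    (is "family_basis ?Z ?B ?A ?\<sigma>")
  unfolding family_basis_def
proof (intro conjI ballI allI impI)
  fix a assume "a \<in> ?A"
  then show "?\<sigma> a \<in> ?Z"
  proof
    fix b assume "b \<in> A0" "a = Inl b"
    then show ?thesis using family_basisD(1)[OF fb(1)] 0
      by (intro CollectI exI[of _ "\<sigma>0 b"] exI[of _ 0]) (simp add: in_pr_linear)
  next
    fix b assume "b \<in> A1" "a = Inr b"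
    then show ?thesis using family_basisD(1)[OF fb(2)] 0
      by (intro CollectI exI[of _ 0] exI[of _ "\<sigma>1 b"]) (simp add: in_pr_linear)
  qed
next
  fix z assume "z \<in> ?Z"
  then obtain u v where uv: "z = in0 u + in1 v" "u \<in> Z0" "v \<in> Z1" by blast
  obtain c0 where c0: "keys c0 \<subseteq> A0" "u - lin_ext \<sigma>0 c0 \<in> B0" using family_basisD(2)[OF fb(1) uv(2)] by (elim exE conjE)
  obtain c1 where c1: "keys c1 \<subseteq> A1" "v - lin_ext \<sigma>1 c1 \<in> B1" using family_basisD(2)[OF fb(2) uv(3)] by (elim exE conjE)
  define c where "c = lin_ext (\<lambda>a. Poly_Mapping.single (Inl a :: 'a + 'b) (1::'k)) c0 +
    lin_ext (\<lambda>a. Poly_Mapping.single (Inr a) 1) c1"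
  have "keys c \<subseteq> keys (lin_ext (\<lambda>a. Poly_Mapping.single (Inl a :: 'a + 'b) (1::'k)) c0) \<union>
      keys (lin_ext (\<lambda>a. Poly_Mapping.single (Inr a :: 'a + 'b) (1::'k)) c1)"
    unfolding c_def by (rule Poly_Mapping.keys_add)
  also have "\<dots> \<subseteq> ?A"
    by (intro Un_least order_trans[OF keys_lin_ext]) (use c0(1) c1(1) in auto)
  finally have "keys c \<subseteq> ?A" .
  moreover have "z - lin_ext ?\<sigma> c = in0 (u - lin_ext \<sigma>0 c0) + in1 (v - lin_ext \<sigma>1 c1)"
    by (simp add: c_def uv(1) lin_ext_add lin_ext_lin_ext in_pr_linear) (simp add: in0_def in1_def lin_ext_lin_ext)
  then have "z - lin_ext ?\<sigma> c \<in> ?B" using c0(2) c1(2) by blast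
  ultimately show "\<exists>c. keys c \<subseteq> ?A \<and> z - lin_ext ?\<sigma> c \<in> ?B" by (intro exI conjI)
next
  fix c assume c: "keys c \<subseteq> ?A \<and> lin_ext ?\<sigma> c \<in> ?B"
  then obtain u v where uv: "lin_ext ?\<sigma> c = in0 u + in1 v" "u \<in> B0" "v \<in> B1" by blast
  define c0 where "c0 = lin_ext (case_sum (\<lambda>a. Poly_Mapping.single a 1) (\<lambda>b. 0)) c"
  define c1 where "c1 = lin_ext (case_sum (\<lambda>a. 0) (\<lambda>b. Poly_Mapping.single b 1)) c"
  have "keys c0 \<subseteq> A0" unfolding c0_def
    by (rule order_trans[OF keys_lin_ext]) (use c in \<open>auto split: sum.splits if_splits\<close>)
  moreover have "keys c1 \<subseteq> A1" unfolding c1_def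
    by (rule order_trans[OF keys_lin_ext]) (use c in \<open>auto split: sum.splits if_splits\<close>)
  moreover have "pr0 (lin_ext ?\<sigma> c) = lin_ext \<sigma>0 c0"
    unfolding pr0_def c0_def lin_ext_lin_ext
    by (rule lin_ext_cong) (auto simp: pr0_def[symmetric] split: sum.split)
  then have "lin_ext \<sigma>0 c0 \<in> B0" using uv by (simp add: in_pr_linear)
  moreover have "pr1 (lin_ext ?\<sigma> c) = lin_ext \<sigma>1 c1"
    unfolding pr1_def c1_def lin_ext_lin_ext
    by (rule lin_ext_cong) (auto simp: pr1_def[symmetric] split: sum.split)
  then have "lin_ext \<sigma>1 c1 \<in> B1" using uv by (simp add: in_pr_linear)
  ultimately have "c0 = 0" "c1 = 0" using family_basisD(3)[OF fb(1)] family_basisD(3)[OF fb(2)] by simp_all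
  have "c = lin_ext (\<lambda>a. Poly_Mapping.single (Inl a) 1) c0 + lin_ext (\<lambda>a. Poly_Mapping.single (Inr a) 1) c1"
  proof -
    have "c = lin_ext (\<lambda>a. Poly_Mapping.single a 1) c" by simp
    also have "\<dots> = lin_ext (\<lambda>x. lin_ext (\<lambda>a. Poly_Mapping.single (Inl a) 1)
          (case x of Inl a \<Rightarrow> Poly_Mapping.single a 1 | Inr b \<Rightarrow> 0) +
        lin_ext (\<lambda>a. Poly_Mapping.single (Inr a) 1) (case x of Inl a \<Rightarrow> 0 | Inr b \<Rightarrow> Poly_Mapping.single b 1)) c"
      by (rule lin_ext_cong) (simp split: sum.split)
    finally show ?thesis by (simp add: lin_ext_fun_add c0_def c1_def lin_ext_lin_ext)
  qed
  then show "c = 0" using \<open>c0 = 0\<close> \<open>c1 = 0\<close> by simp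
qed

text \<open>Vectors supported in a finite set span a space of bounded dimension; this turns finitely
  many basis elements per degree into finite-dimensional Tor.\<close>

lemma family_basis_finite:
  assumes "family_basis Z B A \<sigma>" "finite S" "\<And>z. z \<in> Z \<Longrightarrow> keys z \<subseteq> S" "0 \<in> B"
  shows "finite A"
proof -
  have "finite A \<and> card A \<le> card S"
  proof (rule card_le_if_lin_ext_inj[where \<kappa> = \<sigma>, OF assms(2)])
    show "keys (\<sigma> a) \<subseteq> S" if "a \<in> A" for a
      using assms(3) family_basisD(1)[OF assms(1) that] .
    show "c = 0" if "keys c \<subseteq> A" "lin_ext \<sigma> c = 0" for c
      by (rule family_basisD(3)[OF assms(1) that(1)]) (simp add: that(2) assms(4))
  qed
  then show ?thesis ..
qed

text \<open>Finiteness keeps dimensions away from the default value 0 of \<open>card\<close> on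
  infinite sets. Nonnegativity makes the pieces in negative degree vanish, in agreement with
  \<open>betti\<close>.\<close>

definition degreewise_finite :: "('x, 'k::comm_ring_1) free_complex \<Rightarrow> bool" where
  "degreewise_finite F \<longleftrightarrow> (\<forall>i n. finite {b \<in> basis F i. bdeg F i b = n}) \<and> (\<forall>i. \<forall>b\<in>basis F i. bdeg F i b \<ge> 0)"

lemma tensor_part_cone_Suc:
  "w \<in> tensor_part (cone f d F) (Suc k) j \<longleftrightarrow>
    (\<exists>u v. u \<in> tensor_part F (Suc k) j \<and> v \<in> tensor_part F k (j - d) \<and> w = in0 u + in1 v)"
proof
  assume w: "w \<in> tensor_part (cone f d F) (Suc k) j"
  have "pr0 w \<in> tensor_part F (Suc k) j"
    unfolding tensor_part_def
  proof (rule CollectI, rule subsetI)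
    fix b assume "b \<in> keys (pr0 w)"
    then have "2 * b \<in> keys w" using keys_pr0 by blast
    then have "2 * b \<in> basis (cone f d F) (Suc k)" "bdeg (cone f d F) (Suc k) (2 * b) = j"
      using w by (auto simp: tensor_part_def)
    then show "b \<in> {b \<in> basis F (Suc k). bdeg F (Suc k) b = j}"
      unfolding cone_basis cone_bdeg by (auto; presburger)
  qed
  moreover have "pr1 w \<in> tensor_part F k (j - d)"
    unfolding tensor_part_def
  proof (rule CollectI, rule subsetI)
    fix b assume "b \<in> keys (pr1 w)"
    then have "2 * b + 1 \<in> keys w" using keys_pr1 by blast
    then have "2 * b + 1 \<in> basis (cone f d F) (Suc k)" "bdeg (cone f d F) (Suc k) (2 * b + 1) = j"
      using w by (auto simp: tensor_part_def)
    then show "b \<in> {b \<in> basis F k. bdeg F k b = j - d}"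
      unfolding cone_basis by (auto; presburger)
  qed
  ultimately show "\<exists>u v. u \<in> tensor_part F (Suc k) j \<and> v \<in> tensor_part F k (j - d) \<and> w = in0 u + in1 v"
    using in_pr_decomp[of w, symmetric] by blast
next
  assume "\<exists>u v. u \<in> tensor_part F (Suc k) j \<and> v \<in> tensor_part F k (j - d) \<and> w = in0 u + in1 v"
  then obtain u v where uv: "u \<in> tensor_part F (Suc k) j" "v \<in> tensor_part F k (j - d)" "w = in0 u + in1 v" by blast
  have "keys w \<subseteq> keys (in0 u) \<union> keys (in1 v)" unfolding uv(3) by (rule Poly_Mapping.keys_add)
  also have "\<dots> \<subseteq> (\<lambda>b. 2 * b) ` keys u \<union> (\<lambda>b. 2 * b + 1) ` keys v"
    using keys_in0[of u] keys_in1[of v] by blast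
  also have "\<dots> \<subseteq> {b \<in> basis (cone f d F) (Suc k). bdeg (cone f d F) (Suc k) b = j}"
    using uv(1,2) by (auto simp: tensor_part_def cone_basis)
  finally show "w \<in> tensor_part (cone f d F) (Suc k) j" by (simp add: tensor_part_def)
qed

lemma tensor_part_cone_0:
  "w \<in> tensor_part (cone f d F) 0 j \<longleftrightarrow> (\<exists>u. u \<in> tensor_part F 0 j \<and> w = in0 u)"
proof
  assume w: "w \<in> tensor_part (cone f d F) 0 j"
  then have kw: "keys w \<subseteq> (\<lambda>b. 2 * b) ` {b \<in> basis F 0. bdeg F 0 b = j}"
    by (auto simp: tensor_part_def cone_basis)
  have "pr0 w \<in> tensor_part F 0 j"
    using keys_pr0[of w] kw by (auto simp: tensor_part_def)
  moreover have "b \<notin> keys (pr1 w)" for b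
  proof
    assume "b \<in> keys (pr1 w)"
    then have "2 * b + 1 \<in> keys w" using keys_pr1[of w] by blast
    then obtain c where "2 * b + 1 = 2 * c" using kw by blast
    then show False by presburger
  qed
  then have "pr1 w = 0" by (metis Poly_Mapping.keys_eq_empty ex_in_conv)
  then have "w = in0 (pr0 w)" using in_pr_decomp[of w] by (simp add: in_pr_linear)
  ultimately show "\<exists>u. u \<in> tensor_part F 0 j \<and> w = in0 u" by blast
next
  assume "\<exists>u. u \<in> tensor_part F 0 j \<and> w = in0 u"
  then show "w \<in> tensor_part (cone f d F) 0 j"
    using keys_in0 by (force simp: tensor_part_def cone_basis)
qed

lemma tensor_diff_cone:
  assumes "lookup f 0 = 0"
  shows "tensor_diff (cone f d F) i (in0 u + in1 v) =
    in0 (tensor_diff F i u) + in1 (case i of 0 \<Rightarrow> 0 | Suc k \<Rightarrow> - tensor_diff F k v)"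
proof -
  \<comment> \<open>Lifting the vectors to R makes the formulas for the cone available; the entry
    \<open>f\<close> then reduces to its constant coefficient 0.\<close>
  have "tensor_diff (cone f d F) i (in0 u + in1 v) =
      eps (lin_ext (diff (cone f d F) i) (in0 (const_lift u) + in1 (const_lift v)))"
    by (simp add: tensor_diff_eps eps_lin_ext eps_in)
  also have "\<dots> = in0 (tensor_diff F i u) + in1 (case i of 0 \<Rightarrow> 0 | Suc k \<Rightarrow> - tensor_diff F k v)"
    using assms by (simp add: lin_ext_add cone_diff_in0 cone_diff_in1 eps_in lower_diff_def tensor_diff_eps
        eps_lin_ext in_pr_linear split: nat.split)
  finally show ?thesis .
qed

lemma tor_cycles_cone:
  assumes "lookup f 0 = 0"
  shows "tor_cycles (cone f d F) i j =
    {in0 u + in1 v | u v. u \<in> tor_cycles F i j \<and> v \<in> (case i of 0 \<Rightarrow> {0} | Suc k \<Rightarrow> tor_cycles F k (j - d))}"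
proof (cases i)
  case 0
  then show ?thesis by (auto simp: tor_cycles_def tensor_part_cone_0 in_pr_linear)
next
  case (Suc k)
  show ?thesis
    unfolding Suc
    by (cases k; auto simp: tor_cycles_def tensor_part_cone_Suc tensor_diff_cone[OF assms] in_add_eq_0_iff; blast)
qed

lemma tor_boundaries_cone:
  fixes F :: "('x, 'k::field) free_complex"
  assumes "lookup f 0 = 0"
  shows "tor_boundaries (cone f d F) i j =
    {in0 u + in1 v | u v. u \<in> tor_boundaries F i j \<and> v \<in> (case i of 0 \<Rightarrow> {0} | Suc k \<Rightarrow> tor_boundaries F k (j - d))}"
    (is "_ = ?R")
proof (intro set_eqI iffI)
  fix w assume "w \<in> tor_boundaries (cone f d F) i j"
  then obtain u v where uv: "u \<in> tensor_part F (Suc i) j" "v \<in> tensor_part F i (j - d)"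
    and w: "w = tensor_diff (cone f d F) i (in0 u + in1 v)"
    unfolding tor_boundaries_def image_iff Bex_def tensor_part_cone_Suc by blast
  have "tensor_diff F i u \<in> tor_boundaries F i j" using uv(1) by (auto simp: tor_boundaries_def)
  \<comment> \<open>The sign of the cone is harmless, because boundaries form a subspace.\<close>
  moreover have "- tensor_diff F k v \<in> tor_boundaries F k (j - d)" if "i = Suc k" for k
    by (rule lin_subspaceD(4)[OF lin_subspace_tor_boundaries]) (use uv(2) that in \<open>auto simp: tor_boundaries_def\<close>)
  ultimately show "w \<in> ?R" unfolding w tensor_diff_cone[OF assms] by (cases i) auto
next
  fix w assume "w \<in> ?R"
  then obtain x y where xy: "w = in0 x + in1 y" "x \<in> tor_boundaries F i j"
    "y \<in> (case i of 0 \<Rightarrow> {0} | Suc k \<Rightarrow> tor_boundaries F k (j - d))" by blast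
  obtain u where u: "u \<in> tensor_part F (Suc i) j" "x = tensor_diff F i u" using xy(2) by (auto simp: tor_boundaries_def)
  obtain v where v: "v \<in> tensor_part F i (j - d)" "y = (case i of 0 \<Rightarrow> 0 | Suc k \<Rightarrow> - tensor_diff F k v)"
  proof (cases i)
    case 0
    then show thesis using that[of 0] xy(3) lin_subspaceD(1)[OF lin_subspace_tensor_part[of F 0 "j - d"]] by simp
  next
    case (Suc k)
    then obtain v where "v \<in> tensor_part F i (j - d)" "y = tensor_diff F k v"
      using xy(3) by (auto simp: tor_boundaries_def)
    then show thesis using that[of "- v"] Suc lin_subspaceD(4)[OF lin_subspace_tensor_part[of F i "j - d"]]
      by (simp add: tensor_diff_eps lin_ext_uminus)
  qed
  have "w = tensor_diff (cone f d F) i (in0 u + in1 v)"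
    unfolding tensor_diff_cone[OF assms] by (simp add: xy(1) u v)
  then show "w \<in> tor_boundaries (cone f d F) i j"
    unfolding tor_boundaries_def image_iff Bex_def tensor_part_cone_Suc using u(1) v(1) by blast
qed

theorem betti_ideal_plus:
  fixes I :: "('x, 'k::field) mpoly set"
  assumes I: "ring_ideal X I" "\<And>n p. p \<in> I \<Longrightarrow> pcomp n p \<in> I"
    and I': "ring_ideal X (ideal_plus X I f)" "\<And>n p. p \<in> ideal_plus X I f \<Longrightarrow> pcomp n p \<in> ideal_plus X I f"
    and F: "graded_free_resolution X I F" "degreewise_finite F"
    and f: "f \<in> poly_ring X" "homogeneous d f" "lookup f 0 = 0"
    and nzd: "\<And>p. p \<in> poly_ring X \<Longrightarrow> f * p \<in> I \<Longrightarrow> p \<in> I"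
    and ij: "i \<ge> 0" "j \<ge> 0"
  shows "betti X (ideal_plus X I f) i j = betti X I i j + betti X I (i - 1) (j - d)"
proof -
  note res' = cone_resolution[OF I F(1) f(1,2) nzd]
  note sub = lin_subspace_tor_cycles lin_subspace_tor_boundaries
  define fam where "fam = (\<lambda>n k. SOME S. basis_modulo (tor_cycles F n k) (tor_boundaries F n k) S)"
  have fam: "family_basis (tor_cycles F n k) (tor_boundaries F n k) (fam n k) (\<lambda>s. s)" for n k
    unfolding fam_def by (intro family_basis_quotient_dim sub tor_boundaries_subset[OF I F(1)])
  have fin: "finite (fam n k)" for n k
  proof (rule family_basis_finite[OF fam])
    show "finite {b \<in> basis F n. bdeg F n b = k}" using F(2) by (simp add: degreewise_finite_def)
    show "0 \<in> tor_boundaries F n k" by (rule lin_subspaceD(1)[OF sub(2)])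
  qed (rule tor_cycles_keys)
  have card: "betti X I i j = card (fam (nat i) j)" if "i \<ge> 0" "j \<ge> 0" for i j
    using betti_eq[OF I F(1) that] by (simp add: fam_def quotient_dim_def)
  define n where "n = nat i"
  \<comment> \<open>In homological degree 0 there is no shifted copy, which matches the convention
    that \<open>betti\<close> vanishes at index -1.\<close>
  define Z1 B1 where "Z1 = (case n of 0 \<Rightarrow> {0} | Suc k \<Rightarrow> tor_cycles F k (j - d))"
    and "B1 = (case n of 0 \<Rightarrow> {0} | Suc k \<Rightarrow> tor_boundaries F k (j - d))"
  define A1 where "A1 = (case n of 0 \<Rightarrow> {} | Suc k \<Rightarrow> fam k (j - d))"
  have fb1: "family_basis Z1 B1 A1 (\<lambda>s. s)"
    using fam family_basis_empty by (cases n) (auto simp: Z1_def B1_def A1_def)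
  have Z1: "0 \<in> Z1" using lin_subspaceD(1)[OF sub(1)[of F]] by (auto simp: Z1_def split: nat.split)
  have finA1: "finite A1" using fin by (auto simp: A1_def split: nat.split)
  note ds = family_basis_direct_sum[OF fam[of n j] fb1 lin_subspaceD(1)[OF sub(1)] Z1]
  have "betti X (ideal_plus X I f) i j =
      quotient_dim (tor_cycles (cone f d F) n j) (tor_boundaries (cone f d F) n j)"
    using betti_eq[OF I' res' ij] by (simp add: n_def)
  also have "\<dots> = card (fam n j <+> A1)"
  proof (rule quotient_dim_eq_card[OF sub tor_boundaries_subset[OF I' res']])
    show "family_basis (tor_cycles (cone f d F) n j) (tor_boundaries (cone f d F) n j) (fam n j <+> A1)
        (case_sum (\<lambda>a. in0 a) (\<lambda>a. in1 a))"
      unfolding tor_cycles_cone[OF f(3)] tor_boundaries_cone[OF f(3)]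
      using ds unfolding Z1_def B1_def .
  qed (assumption | rule finite_Plus[OF fin finA1])+
  also have "\<dots> = card (fam n j) + card A1" using fin finA1 by (rule card_Plus)
  also have "card (fam n j) = betti X I i j" using card ij by (simp add: n_def)
  also have "card A1 = betti X I (i - 1) (j - d)"
  proof (cases "i = 0")
    case True
    then show ?thesis by (simp add: A1_def n_def betti_def)
  next
    case False
    then have n: "n = Suc (nat (i - 1))" using ij by (simp add: n_def)
    show ?thesis
    proof (cases "j - d < 0")
      case True
      \<comment> \<open>Here \<open>betti\<close> is 0 by definition, so \<open>A1\<close> must be
        empty. The graded piece is zero, and a basis cannot contain the zero vector.\<close>
      have empty: "{b \<in> basis F (nat (i - 1)). bdeg F (nat (i - 1)) b = j - d} = {}"
        using F(2) True by (force simp: degreewise_finite_def)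
      have "A1 = {}"
      proof (rule ccontr)
        assume "A1 \<noteq> {}"
        then obtain z where z: "z \<in> A1" by blast
        have "keys z \<subseteq> {b \<in> basis F (nat (i - 1)). bdeg F (nat (i - 1)) b = j - d}"
          using tor_cycles_keys[OF family_basisD(1)[OF fam]] z by (simp add: A1_def n)
        then have "z = 0" unfolding empty by simp
        have "lin_ext (\<lambda>s. s) (Poly_Mapping.single z (1::'k)) = z" by simp
        also have "z \<in> B1" using \<open>z = 0\<close> lin_subspaceD(1)[OF sub(2)[of F]] by (simp add: B1_def n)
        finally have "Poly_Mapping.single z (1::'k) = 0"
          by (intro family_basisD(3)[OF fb1]) (use z in auto)
        then show False using lookup_single_eq[of z "1::'k"] by simp
      qed
      then show ?thesis using True by (simp add: betti_def)
    next
      case False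
      then show ?thesis using card[of "i - 1" "j - d"] \<open>i \<noteq> 0\<close> ij by (simp add: A1_def n)
    qed
  qed
  finally show ?thesis .
qed

section \<open>Existence of resolutions that are finite in each degree\<close>

lemma finite_monomials:
  assumes "finite X"
  shows "finite {m :: 'x \<Rightarrow>\<^sub>0 nat. keys m \<subseteq> X \<and> mon_degree m = n}" (is "finite ?M")
proof -
  have "lookup ` ?M \<subseteq> {f. \<forall>x. (x \<in> X \<longrightarrow> f x \<in> {..n}) \<and> (x \<notin> X \<longrightarrow> f x = 0)}"
  proof safe
    fix m :: "'x \<Rightarrow>\<^sub>0 nat" and x
    show "lookup m x \<le> mon_degree m"
      unfolding mon_degree_def by (cases "x \<in> keys m") (auto intro: member_le_sum simp: in_keys_iff)
  qed (auto simp: in_keys_iff)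
  then have "finite (lookup ` ?M)"
    using finite_set_of_finite_funs[OF assms, of "{..n}" 0] finite_subset by blast
  then show ?thesis by (rule finite_imageD) (simp add: inj_on_def poly_mapping.lookup_inject)
qed

definition graded_submodule :: "'x set \<Rightarrow> nat set \<Rightarrow> (nat \<Rightarrow> int) \<Rightarrow> (nat \<Rightarrow>\<^sub>0 ('x, 'k::comm_ring_1) mpoly) set \<Rightarrow> bool" where
  "graded_submodule X B dg M \<longleftrightarrow> M \<subseteq> free_module X B \<and> 0 \<in> M \<and> (\<forall>v\<in>M. \<forall>w\<in>M. v + w \<in> M) \<and>
     (\<forall>r\<in>poly_ring X. \<forall>v\<in>M. scal r v \<in> M) \<and> (\<forall>n. \<forall>v\<in>M. vcomp dg n v \<in> M)"

lemma vcomp_decomp: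
  assumes "v \<in> free_module X B" "\<And>b. b \<in> B \<Longrightarrow> dg b \<ge> 0"
  shows "\<exists>S. finite S \<and> v = (\<Sum>n\<in>S. vcomp dg (int n) v)"
proof -
  \<comment> \<open>\<open>S\<close> collects the degrees of all occurring monomials, each shifted
    by the degree of its basis element. Since no shift is negative, truncation by \<open>nat\<close>
    loses nothing.\<close>
  define S where "S = (\<Union>c\<in>keys v. (\<lambda>m. nat (int (mon_degree m) + dg c)) ` keys (lookup v c))"
  have fin: "finite S" by (simp add: S_def)
  have "lookup (lookup v c) m = lookup (lookup (\<Sum>n\<in>S. vcomp dg (int n) v) c) m" for c m
  proof (cases "m \<in> keys (lookup v c)")
    case True
    then have c: "c \<in> keys v" by (auto simp: in_keys_iff)
    have "dg c \<ge> 0" by (rule assms(2)[OF free_module_keys[OF assms(1) c]])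
    define n0 where "n0 = nat (int (mon_degree m) + dg c)"
    have "n0 \<in> S" unfolding S_def n0_def using c True by blast
    have "lookup (lookup (\<Sum>n\<in>S. vcomp dg (int n) v) c) m = (\<Sum>n\<in>S. if n = n0 then lookup (lookup v c) m else 0)"
      unfolding lookup_sum lookup_vcomp lookup_pcomp
      using \<open>dg c \<ge> 0\<close> by (intro sum.cong refl) (auto simp: n0_def)
    also have "\<dots> = lookup (lookup v c) m" using fin \<open>n0 \<in> S\<close> by simp
    finally show ?thesis by simp
  next
    case False
    then show ?thesis by (simp add: lookup_sum lookup_pcomp in_keys_iff cong: if_cong)
  qed
  then have "v = (\<Sum>n\<in>S. vcomp dg (int n) v)" by (intro poly_mapping_eqI)
  with fin show ?thesis by blast
qed

lemma Const_simps: "Const (a + b) = Const a + Const b" "Const (a * b) = Const a * Const b" "Const 1 = 1"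
  by (simp_all add: Const_def single_add mult_single)

lemma vector_space_scal_Const: "vector_space (\<lambda>c v. scal (Const c) (v :: 'b \<Rightarrow>\<^sub>0 ('x, 'k::field) mpoly))"
  by unfold_locales (auto simp: Const_simps scal_distribs)

text \<open>A homogeneous component of a free module with finitely many basis elements in each degree is
  finite-dimensional over \<open>\<bbbK>\<close>, so finitely many generators per degree suffice.\<close>
lemma finite_generators:
  fixes M :: "(nat \<Rightarrow>\<^sub>0 ('x, 'k::field) mpoly) set"
  assumes "finite X" and fin: "\<And>n. finite {b \<in> B. dg b = n}" and nonneg: "\<And>b. b \<in> B \<Longrightarrow> dg b \<ge> 0"
    and M: "M \<subseteq> free_module X B"
  shows "\<exists>T. finite T \<and> T \<subseteq> {v \<in> M. hvec dg n v} \<and>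
    (\<forall>U. 0 \<in> U \<longrightarrow> (\<forall>x\<in>U. \<forall>y\<in>U. x + y \<in> U) \<longrightarrow> (\<forall>c. \<forall>x\<in>U. scal (Const c) x \<in> U) \<longrightarrow> T \<subseteq> U \<longrightarrow>
      {v \<in> M. hvec dg n v} \<subseteq> U)"
proof -
  interpret vs: vector_space "\<lambda>c v. scal (Const c) (v :: nat \<Rightarrow>\<^sub>0 ('x, 'k) mpoly)"
    by (rule vector_space_scal_Const)
  let ?M = "{v \<in> M. hvec dg n v}"
  define Bn where "Bn = {b \<in> B. dg b \<le> n}"
  have "Bn = (\<Union>k\<in>{0..n}. {b \<in> B. dg b = k})" using nonneg by (auto simp: Bn_def)
  then have Bn: "finite Bn" using fin by simp
  \<comment> \<open>These monomial multiples of basis elements are the finitely many monomials of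
    degree \<open>n\<close> in the free module; they span its part of degree \<open>n\<close> over
    the field.\<close>
  define W :: "(nat \<Rightarrow>\<^sub>0 ('x, 'k) mpoly) set" where
    "W = (\<Union>b\<in>Bn. (\<lambda>m. Poly_Mapping.single b (Poly_Mapping.single m 1)) ` {m. keys m \<subseteq> X \<and> mon_degree m = nat (n - dg b)})"
  have W: "finite W" unfolding W_def using Bn finite_monomials[OF assms(1)] by (intro finite_UN_I finite_imageI)
  obtain T where T: "T \<subseteq> ?M" "vs.independent T" "?M \<subseteq> vs.span T"
    using vs.maximal_independent_subset by blast
  have "?M \<subseteq> vs.span W"
  proof
    fix v assume v: "v \<in> ?M"
    have "Poly_Mapping.single b (Poly_Mapping.single m c) \<in> vs.span W"
      if b: "b \<in> keys v" "m \<in> keys (lookup v b)" for b m c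
    proof -
      have "b \<in> B" "keys m \<subseteq> X" "int (mon_degree m) = n - dg b"
        using v b subsetD[OF M, of v] by (auto simp: hvec_def homogeneous_def free_module_def' poly_ring_def)
      then have "Poly_Mapping.single b (Poly_Mapping.single m 1) \<in> W"
        unfolding W_def Bn_def by (intro UN_I[of b] imageI) auto
      then have "scal (Const c) (Poly_Mapping.single b (Poly_Mapping.single m 1)) \<in> vs.span W"
        by (intro vs.span_scale vs.span_base)
      then show ?thesis by (simp add: scal_single Const_def mult_single)
    qed
    then have "(\<Sum>b\<in>keys v. \<Sum>m\<in>keys (lookup v b). Poly_Mapping.single b (Poly_Mapping.single m (lookup (lookup v b) m))) \<in> vs.span W"
      by (intro vs.span_sum)
    moreover have "(\<Sum>m\<in>keys p. Poly_Mapping.single b (Poly_Mapping.single m (lookup p m))) = Poly_Mapping.single b p"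
      for b :: nat and p :: "('x, 'k) mpoly"
    proof -
      have "Poly_Mapping.single b (\<Sum>m\<in>A. g m) = (\<Sum>m\<in>A. Poly_Mapping.single b (g m))"
        for A and g :: "('x \<Rightarrow>\<^sub>0 nat) \<Rightarrow> ('x, 'k) mpoly"
        by (induction A rule: infinite_finite_induct) (simp_all add: single_add)
      then show ?thesis by (metis poly_mapping_sum_single)
    qed
    ultimately show "v \<in> vs.span W" by (simp add: poly_mapping_sum_single[symmetric])
  qed
  then have "T \<subseteq> vs.span W" using T(1) by (rule subset_trans[rotated])
  then have "finite T" using vs.independent_span_bound[OF W T(2)] by blast
  \<comment> \<open>The span is expressed by all closed sets \<open>U\<close> containing
    \<open>T\<close>, since the vector space structure is interpreted only inside this
    proof.\<close>
  moreover have "?M \<subseteq> U" if "0 \<in> U" "\<forall>x\<in>U. \<forall>y\<in>U. x + y \<in> U" "\<forall>c. \<forall>x\<in>U. scal (Const c) x \<in> U" "T \<subseteq> U" for U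
  proof -
    have "vs.subspace U" using that by (simp add: vs.subspace_def)
    then have "vs.span T \<subseteq> U" using that(4) by (rule vs.span_minimal[rotated])
    then show ?thesis using T(3) by (rule subset_trans[rotated])
  qed
  ultimately show ?thesis using T(1) by (intro exI[of _ T]) simp
qed

text \<open>Generators are taken separately in each degree, finitely many at a time. This replaces
  Hilbert's basis theorem at the price of a possibly infinite basis, and every element is reached as
  the sum of its homogeneous components.\<close>

lemma graded_submodule_cover:
  fixes M :: "(nat \<Rightarrow>\<^sub>0 ('x, 'k::field) mpoly) set"
  assumes X: "finite X" and fin: "\<And>n. finite {b \<in> B. dg b = n}" and nonneg: "\<And>b. b \<in> B \<Longrightarrow> dg b \<ge> 0"
    and M: "graded_submodule X B dg M"
  shows "\<exists>B' dg' D. (\<forall>n. finite {b \<in> B'. dg' b = n}) \<and> (\<forall>b\<in>B'. dg' b \<ge> 0) \<and>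
    gmap X B' dg' B dg D \<and> lin_ext D ` free_module X B' = M"
proof -
  have Mfree: "M \<subseteq> free_module X B" and M0: "0 \<in> M"
    and Madd: "\<And>v w. v \<in> M \<Longrightarrow> w \<in> M \<Longrightarrow> v + w \<in> M"
    and Mscal: "\<And>r v. r \<in> poly_ring X \<Longrightarrow> v \<in> M \<Longrightarrow> scal r v \<in> M"
    and Mcomp: "\<And>n v. v \<in> M \<Longrightarrow> vcomp dg n v \<in> M"
    using M unfolding graded_submodule_def by simp_all
  have Msum: "(\<Sum>a\<in>A. g a) \<in> M" if "\<And>a. a \<in> A \<Longrightarrow> g a \<in> M" for A :: "nat set" and g
    using that by (induction A rule: infinite_finite_induct) (auto simp: M0 Madd)
  have "\<forall>n. \<exists>L. set L \<subseteq> {v \<in> M. hvec dg (int n) v} \<and>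
    (\<forall>U. 0 \<in> U \<longrightarrow> (\<forall>x\<in>U. \<forall>y\<in>U. x + y \<in> U) \<longrightarrow> (\<forall>c. \<forall>x\<in>U. scal (Const c) x \<in> U) \<longrightarrow> set L \<subseteq> U \<longrightarrow>
      {v \<in> M. hvec dg (int n) v} \<subseteq> U)"
  proof
    fix n
    from finite_generators[where n = "int n" and dg = dg, OF X fin nonneg Mfree, simplified] obtain T where
      "finite T" and T: "T \<subseteq> {v \<in> M. hvec dg (int n) v} \<and>
    (\<forall>U. 0 \<in> U \<longrightarrow> (\<forall>x\<in>U. \<forall>y\<in>U. x + y \<in> U) \<longrightarrow> (\<forall>c. \<forall>x\<in>U. scal (Const c) x \<in> U) \<longrightarrow> T \<subseteq> U \<longrightarrow>
      {v \<in> M. hvec dg (int n) v} \<subseteq> U)" by auto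
    from \<open>finite T\<close> obtain L where "set L = T" using finite_list by blast
    then show "\<exists>L. set L \<subseteq> {v \<in> M. hvec dg (int n) v} \<and>
    (\<forall>U. 0 \<in> U \<longrightarrow> (\<forall>x\<in>U. \<forall>y\<in>U. x + y \<in> U) \<longrightarrow> (\<forall>c. \<forall>x\<in>U. scal (Const c) x \<in> U) \<longrightarrow> set L \<subseteq> U \<longrightarrow>
      {v \<in> M. hvec dg (int n) v} \<subseteq> U)" using T by (intro exI[of _ L]) simp
  qed
  from choice[OF this] obtain L where "\<forall>n. set (L n) \<subseteq> {v \<in> M. hvec dg (int n) v} \<and>
    (\<forall>U. 0 \<in> U \<longrightarrow> (\<forall>x\<in>U. \<forall>y\<in>U. x + y \<in> U) \<longrightarrow> (\<forall>c. \<forall>x\<in>U. scal (Const c) x \<in> U) \<longrightarrow> set (L n) \<subseteq> U \<longrightarrow>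
      {v \<in> M. hvec dg (int n) v} \<subseteq> U)" ..
  then have L: "set (L n) \<subseteq> {v \<in> M. hvec dg (int n) v}"
    "0 \<in> U \<Longrightarrow> (\<forall>x\<in>U. \<forall>y\<in>U. x + y \<in> U) \<Longrightarrow> (\<forall>c. \<forall>x\<in>U. scal (Const c) x \<in> U) \<Longrightarrow> set (L n) \<subseteq> U \<Longrightarrow>
      {v \<in> M. hvec dg (int n) v} \<subseteq> U" for n U
    by simp_all
  \<comment> \<open>A number codes a degree together with a position in the list of generators of
    that degree, so one set of natural numbers indexes the generators of all degrees.\<close>
  define B' where "B' = {b. snd (prod_decode b) < length (L (fst (prod_decode b)))}"
  define dg' where "dg' = (\<lambda>b. int (fst (prod_decode b)))"
  define D where "D = (\<lambda>b. L (fst (prod_decode b)) ! snd (prod_decode b))"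
  have D: "D b \<in> M" "hvec dg (dg' b) (D b)" if "b \<in> B'" for b
    using subsetD[OF L(1) nth_mem, of "snd (prod_decode b)" "fst (prod_decode b)"] that
    by (simp_all add: D_def B'_def dg'_def)
  have "finite {b \<in> B'. dg' b = n}" for n
  proof (rule finite_subset)
    show "{b \<in> B'. dg' b = n} \<subseteq> prod_encode ` ({nat n} \<times> {..<length (L (nat n))})"
    proof
      fix b assume b: "b \<in> {b \<in> B'. dg' b = n}"
      then have "prod_decode b \<in> {nat n} \<times> {..<length (L (nat n))}"
        by (cases "prod_decode b") (auto simp: B'_def dg'_def)
      then have "prod_encode (prod_decode b) \<in> prod_encode ` ({nat n} \<times> {..<length (L (nat n))})" by (rule imageI)
      then show "b \<in> prod_encode ` ({nat n} \<times> {..<length (L (nat n))})"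
        by simp
    qed
  qed simp
  moreover have "\<forall>b\<in>B'. dg' b \<ge> 0" by (simp add: dg'_def)
  moreover have "gmap X B' dg' B dg D" using D Mfree by (auto simp: gmap_def)
  moreover have "lin_ext D ` free_module X B' = M"
  proof
    show "lin_ext D ` free_module X B' \<subseteq> M"
      by (auto simp: lin_ext_def free_module_def' intro!: Msum Mscal D)
    let ?U = "lin_ext D ` free_module X B'"
    have U: "0 \<in> ?U" "\<forall>x\<in>?U. \<forall>y\<in>?U. x + y \<in> ?U" "\<forall>c. \<forall>x\<in>?U. scal (Const c) x \<in> ?U"
    proof -
      show "0 \<in> ?U" by (rule image_eqI[of _ _ 0]) simp_all
      show "\<forall>x\<in>?U. \<forall>y\<in>?U. x + y \<in> ?U" by (auto simp: lin_ext_add[symmetric] intro!: imageI free_module_add)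
      show "\<forall>c. \<forall>x\<in>?U. scal (Const c) x \<in> ?U" by (auto simp: lin_ext_scal[symmetric] intro!: imageI free_module_scal)
    qed
    have Ln: "set (L n) \<subseteq> ?U" for n
    proof
      fix v assume "v \<in> set (L n)"
      then obtain k where k: "k < length (L n)" "v = L n ! k" by (auto simp: in_set_conv_nth)
      let ?b = "prod_encode (n, k)"
      have "?b \<in> B'" "D ?b = v" using k by (simp_all add: B'_def D_def)
      then show "v \<in> ?U" by (intro image_eqI[of _ _ "Poly_Mapping.single ?b 1"]) (simp_all add: free_module_single)
    qed
    note Un = L(2)[OF U Ln]
    show "M \<subseteq> ?U"
    proof
      fix v assume v: "v \<in> M"
      then obtain S where S: "finite S" "v = (\<Sum>n\<in>S. vcomp dg (int n) v)"
        using vcomp_decomp[of v X B dg] Mfree nonneg by blast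
      have "vcomp dg (int n) v \<in> ?U" for n using Un[of n] Mcomp[OF v] hvec_vcomp by blast
      with S(1) have "(\<Sum>n\<in>S. vcomp dg (int n) v) \<in> ?U"
        by (induction S rule: finite_induct) (simp_all add: U(1) U(2)[rule_format])
      then show "v \<in> ?U" using S(2) by simp
    qed
  qed
  ultimately show ?thesis by (intro exI[of _ B'] exI[of _ dg'] exI[of _ D]) simp
qed

text \<open>Covering a graded submodule by a free module and passing to the kernel can be repeated
  forever, since the kernel of a degree-preserving map is again graded.\<close>

theorem degreewise_finite_resolution_exists:
  fixes I :: "('x, 'k::field) mpoly set"
  assumes X: "finite X" and I: "ring_ideal X I" and hom: "\<And>n p. p \<in> I \<Longrightarrow> pcomp n p \<in> I"
  shows "\<exists>F. graded_free_resolution X I F \<and> degreewise_finite F"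
proof -
  \<comment> \<open>A state holds a free module, its degrees and the submodule \<open>M\<close> to
    be covered next. The initial module is R itself with \<open>M\<close> equal to the ideal, so
    that the augmentation is the identity.\<close>
  define P :: "nat \<Rightarrow> nat set \<times> (nat \<Rightarrow> int) \<times> (nat \<Rightarrow>\<^sub>0 ('x, 'k) mpoly) set \<Rightarrow> bool" where
    "P = (\<lambda>n (B, dg, M). (\<forall>n. finite {b \<in> B. dg b = n}) \<and> (\<forall>b\<in>B. dg b \<ge> 0) \<and> graded_submodule X B dg M \<and>
      (n = 0 \<longrightarrow> B = {0} \<and> dg = (\<lambda>_. 0) \<and> M = {v \<in> free_module X {0}. lookup v 0 \<in> I}))"
  define Q :: "nat set \<times> (nat \<Rightarrow> int) \<times> (nat \<Rightarrow>\<^sub>0 ('x, 'k) mpoly) set \<Rightarrow>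
      nat set \<times> (nat \<Rightarrow> int) \<times> (nat \<Rightarrow>\<^sub>0 ('x, 'k) mpoly) set \<Rightarrow> (nat \<Rightarrow> nat \<Rightarrow>\<^sub>0 ('x, 'k) mpoly) \<Rightarrow> bool" where
    "Q = (\<lambda>(B, dg, M) (B', dg', M') D. gmap X B' dg' B dg D \<and> lin_ext D ` free_module X B' = M \<and>
      M' = {v \<in> free_module X B'. lin_ext D v = 0})"
  have "\<exists>st. \<forall>n. P n (st n) \<and> (\<exists>D. Q (st n) (st (Suc n)) D)"
  proof (rule dependent_nat_choice)
    have "graded_submodule X {0} (\<lambda>_. 0) {v \<in> free_module X {0}. lookup v 0 \<in> I}"
      unfolding graded_submodule_def
      by (auto simp: lookup_add ring_idealD[OF I] hom intro: free_module_add free_module_scal free_module_vcomp)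
    then show "\<exists>s. P 0 s" unfolding P_def
      by (intro exI[of _ "({0}, (\<lambda>_. 0), {v \<in> free_module X {0}. lookup v 0 \<in> I})"]) simp
  next
    fix s n assume "P n s"
    obtain B dg M where s: "s = (B, dg, M)" by (cases s)
    obtain B' dg' D where D: "\<forall>n. finite {b \<in> B'. dg' b = n}" "\<forall>b\<in>B'. dg' b \<ge> 0"
      "gmap X B' dg' B dg D" "lin_ext D ` free_module X B' = M"
      using graded_submodule_cover[OF X, of B dg M] \<open>P n s\<close> unfolding s P_def by auto
    let ?M = "{v \<in> free_module X B'. lin_ext D v = 0}"
    have "graded_submodule X B' dg' ?M"
      unfolding graded_submodule_def using gmap_vcomp[OF D(3)]
      by (auto simp: lin_ext_add lin_ext_scal intro: free_module_add free_module_scal free_module_vcomp)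
    then have "P (Suc n) (B', dg', ?M)" using D by (simp add: P_def)
    moreover have "Q s (B', dg', ?M) D" using D by (simp add: Q_def s)
    ultimately show "\<exists>s'. P (Suc n) s' \<and> (\<exists>D. Q s s' D)" by blast
  qed
  then obtain st where st: "\<And>n. P n (st n)" "\<And>n. \<exists>D. Q (st n) (st (Suc n)) D" by blast
  from st(2) obtain D where Q: "\<And>n. Q (st n) (st (Suc n)) (D n)" by metis
  define B where "B = (\<lambda>n. fst (st n))"
  define dg where "dg = (\<lambda>n. fst (snd (st n)))"
  define M where "M = (\<lambda>n. snd (snd (st n)))"
  have s: "st n = (B n, dg n, M n)" for n by (simp add: B_def dg_def M_def)
  have P: "\<forall>k. finite {b \<in> B n. dg n b = k}" "\<forall>b\<in>B n. dg n b \<ge> 0" for n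
    using st(1)[of n] unfolding P_def s by simp_all
  have P0: "B 0 = {0}" "dg 0 = (\<lambda>_. 0)" "M 0 = {v \<in> free_module X {0}. lookup v 0 \<in> I}"
    using st(1)[of 0] unfolding P_def s by simp_all
  have Q: "gmap X (B (Suc n)) (dg (Suc n)) (B n) (dg n) (D n)" "lin_ext (D n) ` free_module X (B (Suc n)) = M n"
    "M (Suc n) = {v \<in> free_module X (B (Suc n)). lin_ext (D n) v = 0}" for n
    using Q[of n] unfolding Q_def s by simp_all
  define F :: "('x, 'k) free_complex" where "F = \<lparr>basis = B, bdeg = dg, diff = D, aug = (\<lambda>_. 1)\<rparr>"
  have aug: "aug_map F v = lookup v 0" if "v \<in> free_module X {0}" for v
    by (subst free_module_0_basis[OF that]) (simp add: aug_map_def F_def in_keys_iff)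
  have "graded_free_resolution X I F"
    unfolding graded_free_resolution_def
  proof (intro conjI allI ballI)
    fix i b assume "b \<in> basis F (Suc i)"
    then show "diff F i b \<in> free_module X (basis F i)" using Q(1)[of i] by (simp add: F_def gmap_def)
  next
    fix i b c assume "b \<in> basis F (Suc i)"
    then show "homogeneous (bdeg F (Suc i) b - bdeg F i c) (lookup (diff F i b) c)"
      using Q(1)[of i] by (simp add: F_def gmap_def hvec_def)
  next
    fix r :: "('x, 'k) mpoly" assume r: "r \<in> poly_ring X"
    then have fm: "Poly_Mapping.single 0 r \<in> free_module X (basis F 0)" by (simp add: F_def P0 free_module_single)
    then have "aug_map F (Poly_Mapping.single 0 r) - r = 0" using aug by (simp add: F_def P0)
    then show "\<exists>v\<in>free_module X (basis F 0). aug_map F v - r \<in> I"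
      using fm ring_idealD(2)[OF I] by (intro bexI[of _ "Poly_Mapping.single 0 r"]) simp_all
  next
    show "{v \<in> free_module X (basis F 0). aug_map F v \<in> I} = lin_ext (diff F 0) ` free_module X (basis F 1)"
      using Q(2)[of 0] aug by (auto simp: F_def P0)
  next
    fix i
    show "{v \<in> free_module X (basis F (Suc i)). lin_ext (diff F i) v = 0} =
       lin_ext (diff F (Suc i)) ` free_module X (basis F (Suc (Suc i)))"
      using Q(2)[of "Suc i"] Q(3)[of i] by (simp add: F_def)
  qed (simp_all add: F_def P0)
  moreover have "degreewise_finite F" using P by (simp add: degreewise_finite_def F_def)
  ultimately show ?thesis by blast
qed

section \<open>Kernels of monomial maps\<close>

text \<open>The linear map of monoid algebras induced by a map of exponents. Leaving the target
  arbitrary admits the pairs used by \<open>ext_vmon\<close>.\<close>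

definition push :: "('m \<Rightarrow> 't) \<Rightarrow> ('m \<Rightarrow>\<^sub>0 'k::comm_ring_1) \<Rightarrow> ('t \<Rightarrow>\<^sub>0 'k)" where
  "push \<mu> = lin_ext (\<lambda>m. Poly_Mapping.single (\<mu> m) 1)"

lemma push_simps [simp]:
  "push \<mu> 0 = 0" "push \<mu> (p + q) = push \<mu> p + push \<mu> q" "push \<mu> (p - q) = push \<mu> p - push \<mu> q"
  "push \<mu> (scal c p) = scal c (push \<mu> p)"
  "push \<mu> (Poly_Mapping.single m c) = Poly_Mapping.single (\<mu> m) c"
  "push \<mu> (sum g A) = (\<Sum>a\<in>A. push \<mu> (g a))"
  by (simp_all add: push_def lin_ext_add lin_ext_diff lin_ext_scal lin_ext_sum scal_single)

lemma push_push: "push \<nu> (push \<mu> p) = push (\<lambda>m. \<nu> (\<mu> m)) p"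
  by (simp add: push_def lin_ext_lin_ext)

lemma push_cong: "(\<And>m. m \<in> keys p \<Longrightarrow> \<mu> m = \<nu> m) \<Longrightarrow> push \<mu> p = push \<nu> p"
  unfolding push_def by (rule lin_ext_cong) simp

lemma push_mult:
  fixes \<mu> :: "'m::comm_monoid_add \<Rightarrow> 't::comm_monoid_add"
  assumes "\<And>m m'. \<mu> (m + m') = \<mu> m + \<mu> m'"
  shows "push \<mu> (p * q) = push \<mu> p * push \<mu> q"
proof -
  have "push \<mu> (p * q) = (\<Sum>m\<in>keys p. \<Sum>m'\<in>keys q. Poly_Mapping.single (\<mu> m + \<mu> m') (lookup p m * lookup q m'))"
    by (subst poly_mapping_sum_single[of p], subst (1) poly_mapping_sum_single[of q])
      (simp add: sum_product mult_single assms)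
  also have "\<dots> = push \<mu> p * push \<mu> q"
    by (simp add: push_def lin_ext_def scal_single sum_product mult_single)
  finally show ?thesis .
qed

text \<open>The proof replaces every monomial by a chosen representative of its fibre.\<close>
lemma push_kernel_binomials:
  fixes J :: "('x, 'k::field) mpoly set"
  assumes J: "lin_subspace J"
    and bin: "\<And>m m'. keys m \<subseteq> X \<Longrightarrow> keys m' \<subseteq> X \<Longrightarrow> \<mu> m = \<mu> m' \<Longrightarrow>
      Poly_Mapping.single m 1 - Poly_Mapping.single m' 1 \<in> J"
    and p: "p \<in> poly_ring X" "push \<mu> p = 0"
  shows "p \<in> J"
proof -
  define r where "r = (\<lambda>t. SOME m. keys m \<subseteq> X \<and> \<mu> m = t)"
  have r: "keys (r (\<mu> m)) \<subseteq> X" "\<mu> (r (\<mu> m)) = \<mu> m" if "keys m \<subseteq> X" for m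
    using someI[of "\<lambda>m'. keys m' \<subseteq> X \<and> \<mu> m' = \<mu> m" m] that unfolding r_def by auto
  have "lin_ext (\<lambda>m. Poly_Mapping.single m 1 - Poly_Mapping.single (r (\<mu> m)) 1) p \<in> J"
    by (intro lin_subspace_lin_ext[OF J] bin) (use p(1) r in \<open>auto simp: poly_ring_def\<close>)
  also have "lin_ext (\<lambda>m. Poly_Mapping.single m 1 - Poly_Mapping.single (r (\<mu> m)) 1) p = p - push r (push \<mu> p)"
    by (simp add: lin_ext_fun_diff push_push) (simp add: push_def)
  finally show ?thesis using p(2) by simp
qed

lemma scal_eq_Const_mult: "scal c p = Const c * (p :: ('x, 'k::comm_ring_1) mpoly)"
  unfolding scal_def Const_def by (rule mult_map_scale_conv_mult)

lemma ring_ideal_lin_subspace: "ring_ideal X I \<Longrightarrow> lin_subspace I"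
  by (auto simp: lin_subspace_def scal_eq_Const_mult ring_idealD)

definition push_kernel :: "'x set \<Rightarrow> (('x \<Rightarrow>\<^sub>0 nat) \<Rightarrow> 't) \<Rightarrow> ('x, 'k::comm_ring_1) mpoly set" where
  "push_kernel X \<mu> = {p \<in> poly_ring X. push \<mu> p = 0}"

lemma ring_ideal_push_kernel:
  fixes \<mu> :: "('x \<Rightarrow>\<^sub>0 nat) \<Rightarrow> 't::comm_monoid_add"
  assumes "\<And>m m'. \<mu> (m + m') = \<mu> m + \<mu> m'"
  shows "ring_ideal X (push_kernel X \<mu>)"
  by (auto simp: ring_ideal_def push_kernel_def push_mult[OF assms] poly_ring_add poly_ring_mult)

text \<open>The kernel is spanned by binomials whose two monomials have equal degree, and a
  component of such a binomial is the binomial itself or 0.\<close>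

lemma push_kernel_pcomp:
  fixes p :: "('x, 'k::field) mpoly"
  assumes deg: "\<And>m m'. keys m \<subseteq> X \<Longrightarrow> keys m' \<subseteq> X \<Longrightarrow> \<mu> m = \<mu> m' \<Longrightarrow> mon_degree m = mon_degree m'"
    and p: "p \<in> push_kernel X \<mu>"
  shows "pcomp n p \<in> push_kernel X \<mu>"
proof -
  have pcomp_scal: "pcomp n (scal c q) = scal c (pcomp n q)" for c and q :: "('x, 'k) mpoly"
    by (rule poly_mapping_eqI) (simp add: lookup_pcomp)
  have "p \<in> {q. push \<mu> (pcomp n q) = 0}"
  proof (rule push_kernel_binomials)
    show "lin_subspace {q. push \<mu> (pcomp n q) = (0 :: _ \<Rightarrow>\<^sub>0 'k)}"
      by (auto simp: lin_subspace_def pcomp_add pcomp_scal)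
    fix m m' :: "'x \<Rightarrow>\<^sub>0 nat"
    assume m: "keys m \<subseteq> X" "keys m' \<subseteq> X" "\<mu> m = \<mu> m'"
    have "pcomp n (Poly_Mapping.single m 1 - Poly_Mapping.single m' (1::'k)) =
        pcomp n (Poly_Mapping.single m 1) - pcomp n (Poly_Mapping.single m' 1)"
      by (rule poly_mapping_eqI) (simp add: lookup_pcomp lookup_minus)
    then show "Poly_Mapping.single m 1 - Poly_Mapping.single m' 1 \<in> {q. push \<mu> (pcomp n q) = (0 :: _ \<Rightarrow>\<^sub>0 'k)}"
      using deg[OF m] m(3) by (simp add: pcomp_single)
  qed (use p in \<open>auto simp: push_kernel_def\<close>)
  then show ?thesis using p by (simp add: push_kernel_def poly_ring_pcomp)
qed

text \<open>The variables carry no linear order, so the library does not provide that the polynomials form a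
  domain; comparing the terms of maximal height replaces this.\<close>
lemma binomial_mult_eq_0:
  fixes q :: "'t::cancel_comm_monoid_add \<Rightarrow>\<^sub>0 'k::comm_ring_1" and h :: "'t \<Rightarrow> nat"
  assumes h: "\<And>s t. h (s + t) = h s + h t" "h a < h b"
    and eq: "(Poly_Mapping.single a 1 - Poly_Mapping.single b 1) * q = 0"
  shows "q = 0"
proof (rule ccontr)
  assume "q \<noteq> 0"
  then have ne: "keys q \<noteq> {}" by simp
  have "Max (h ` keys q) \<in> h ` keys q" using ne by (intro Max_in) auto
  then obtain t where t: "t \<in> keys q" "h t = Max (h ` keys q)" by auto
  have shift: "Poly_Mapping.single s 1 * q = (\<Sum>t\<in>keys q. Poly_Mapping.single (s + t) (lookup q t))" for s
    by (subst poly_mapping_sum_single[of q]) (simp add: sum_distrib_left mult_single)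
  have "lookup (Poly_Mapping.single b 1 * q) (b + t) = lookup q t"
    using t(1) unfolding shift by (simp add: lookup_sum lookup_single when_def)
  moreover have "Poly_Mapping.single a 1 * q = Poly_Mapping.single b 1 * q" using eq by (simp add: left_diff_distrib)
  ultimately have "(\<Sum>t'\<in>keys q. lookup (Poly_Mapping.single (a + t') (lookup q t')) (b + t)) \<noteq> 0"
    using t(1) by (simp add: shift[of a] lookup_sum[symmetric] in_keys_iff)
  then obtain t' where "t' \<in> keys q" "lookup (Poly_Mapping.single (a + t') (lookup q t')) (b + t) \<noteq> 0"
    by (rule sum.not_neutral_contains_not_neutral)
  then have t': "t' \<in> keys q" "a + t' = b + t" by (simp_all add: lookup_single when_def split: if_splits)
  have "h t' \<le> h t" unfolding t(2) using t'(1) by (intro Max_ge) auto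
  moreover have "h a + h t' = h b + h t" using t'(2) h(1) by metis
  ultimately show False using h(2) by simp
qed

text \<open>The quotient by the kernel embeds through \<open>push\<close> into the target algebra,
  where a binomial with terms of different height annihilates only 0.\<close>

lemma push_kernel_nonzerodivisor:
  fixes \<mu> :: "('x \<Rightarrow>\<^sub>0 nat) \<Rightarrow> 't::cancel_comm_monoid_add" and h :: "'t \<Rightarrow> nat"
    and p :: "('x, 'k::comm_ring_1) mpoly"
  assumes "\<And>m m'. \<mu> (m + m') = \<mu> m + \<mu> m'" "\<And>s t. h (s + t) = h s + h t" "h (\<mu> a) < h (\<mu> b)"
    and "p \<in> poly_ring X" "(Poly_Mapping.single a 1 - Poly_Mapping.single b 1) * p \<in> push_kernel X \<mu>"
  shows "p \<in> push_kernel X \<mu>"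
  using binomial_mult_eq_0[of h "\<mu> a" "\<mu> b" "push \<mu> p"] assms by (simp add: push_kernel_def push_mult)

section \<open>The monomial map of a graph\<close>

definition vmon :: "('v set \<Rightarrow>\<^sub>0 nat) \<Rightarrow> ('v \<Rightarrow>\<^sub>0 nat)" where
  "vmon m = (\<Sum>e\<in>keys m. \<Sum>v\<in>e. Poly_Mapping.single v (lookup m e))"

lemma vmon_superset:
  "finite A \<Longrightarrow> keys m \<subseteq> A \<Longrightarrow> vmon m = (\<Sum>e\<in>A. \<Sum>v\<in>e. Poly_Mapping.single v (lookup m e))"
  unfolding vmon_def by (intro sum.mono_neutral_left) (auto simp: in_keys_iff)

lemma vmon_add: "vmon (m + m') = vmon m + vmon m'"
  by (simp add: vmon_superset[of "keys m \<union> keys m'"] keys_add_nat lookup_add single_add sum.distrib)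

lemma vmon_0 [simp]: "vmon 0 = 0"
  by (simp add: vmon_def)

lemma vmon_single: "vmon (Poly_Mapping.single e n) = (\<Sum>v\<in>e. Poly_Mapping.single v n)"
  by (simp add: vmon_superset[of "{e}"])

lemma vmon_sum: "vmon (\<Sum>a\<in>A. g a) = (\<Sum>a\<in>A. vmon (g a))"
  by (induction A rule: infinite_finite_induct) (simp_all add: vmon_add)

text \<open>Reading \<open>m\<close> as edge multiplicities, the exponent at \<open>v\<close> is the
  degree of the vertex \<open>v\<close> in the resulting multigraph.\<close>

lemma lookup_vmon:
  assumes "\<And>e. e \<in> keys m \<Longrightarrow> finite e"
  shows "lookup (vmon m) v = (\<Sum>e\<in>keys m. if v \<in> e then lookup m e else 0)"
  unfolding vmon_def lookup_sum using assms
  by (intro sum.cong refl) (auto simp: lookup_sum lookup_single when_def)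

lemma mon_degree_sum: "mon_degree (\<Sum>a\<in>A. g a) = (\<Sum>a\<in>A. mon_degree (g a))"
  by (induction A rule: infinite_finite_induct) (simp_all add: mon_degree_add)

lemma mon_degree_vmon: "(\<And>e. e \<in> keys m \<Longrightarrow> card e = 2) \<Longrightarrow> mon_degree (vmon m) = 2 * mon_degree m"
  by (simp add: vmon_def mon_degree_sum sum_distrib_left) (simp add: mon_degree_def sum_distrib_left)

lemma prod_single_1: "(\<Prod>a\<in>A. Poly_Mapping.single (g a) 1) = Poly_Mapping.single (\<Sum>a\<in>A. g a) (1 :: 'k::comm_ring_1)"
  by (induction A rule: infinite_finite_induct) (simp_all add: mult_single)

lemma Var_power: "Var x ^ n = Poly_Mapping.single (Poly_Mapping.single x n) 1"
  by (induction n) (simp_all add: Var_def mult_single single_add[symmetric])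

lemma prod_Var_power:
  "(\<Prod>a\<in>A. Var (c a)) ^ n = Poly_Mapping.single (\<Sum>a\<in>A. Poly_Mapping.single (c a) n) 1"
  by (simp add: prod_power_distrib Var_power prod_single_1)

lemma mpoly_subst_eq_push: "mpoly_subst (\<lambda>e. \<Prod>v\<in>e. Var v) p = push vmon p"
  by (simp add: mpoly_subst_def prod_Var_power prod_single_1 push_def lin_ext_def vmon_def scal_single Const_def mult_single)

lemma toric_ideal_eq_push_kernel: "toric_ideal K G = push_kernel (edges G) vmon"
  by (simp add: toric_ideal_def push_kernel_def mpoly_subst_eq_push)

section \<open>Toric ideals extended to further variables\<close>

definition restr :: "'x set \<Rightarrow> ('x \<Rightarrow>\<^sub>0 nat) \<Rightarrow> ('x \<Rightarrow>\<^sub>0 nat)" where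
  "restr A m = Poly_Mapping.mapp (\<lambda>x c. if x \<in> A then c else 0) m"

lemma lookup_restr [simp]: "lookup (restr A m) x = (if x \<in> A then lookup m x else 0)"
  by (auto simp: restr_def lookup_mapp when_def in_keys_iff)

lemma keys_restr [simp]: "keys (restr A m) = keys m \<inter> A"
  by (auto simp: in_keys_iff split: if_splits)

lemma restr_add: "restr A (m + m') = restr A m + restr A m'"
  by (rule poly_mapping_eqI) (simp add: lookup_add)

lemma restr_decomp: "restr A m + restr (- A) m = m"
  by (rule poly_mapping_eqI) (simp add: lookup_add)

lemma restr_id: "keys m \<subseteq> A \<Longrightarrow> restr A m = m" "keys m \<subseteq> A \<Longrightarrow> restr (- A) m = 0"
  by (rule poly_mapping_eqI, auto simp: in_keys_iff)+

text \<open>For \<open>E = E(G)\<close>, the kernel of this monomial map is the extension of the toric ideal of \<open>G\<close>.\<close>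
definition ext_vmon :: "'v set set \<Rightarrow> ('v set \<Rightarrow>\<^sub>0 nat) \<Rightarrow> ('v \<Rightarrow>\<^sub>0 nat) \<times> ('v set \<Rightarrow>\<^sub>0 nat)" where
  "ext_vmon E m = (vmon (restr E m), restr (- E) m)"

lemma ext_vmon_add: "ext_vmon E (m + m') = ext_vmon E m + ext_vmon E m'"
  by (simp add: ext_vmon_def restr_add vmon_add)

lemma poly_ring_mono: "X \<subseteq> Y \<Longrightarrow> poly_ring X \<subseteq> poly_ring Y"
  unfolding poly_ring_def by blast

text \<open>Monomials with equal image under \<open>ext_vmon\<close> share their part outside E(G),
  so their difference is that common monomial times a binomial of the toric ideal. Such binomials
  span the kernel.\<close>

lemma ideal_extension_eq_push_kernel:
  assumes "edges G \<subseteq> X"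
  shows "ideal_extension X (toric_ideal (K :: 'k::field itself) G) = push_kernel X (ext_vmon (edges G))"
    (is "?L = ?R")
proof
  let ?E = "edges G"
  note ker = ring_ideal_push_kernel[where \<mu> = "ext_vmon ?E" and X = X, OF ext_vmon_add]
  show "?L \<subseteq> ?R"
  proof
    fix p assume "p \<in> ?L"
    then obtain r S where p: "p = (\<Sum>g\<in>S. r g * g)" "S \<subseteq> toric_ideal K G" "\<forall>g\<in>S. r g \<in> poly_ring X"
      by (auto simp: ideal_extension_def)
    have "g \<in> ?R" if "g \<in> S" for g
    proof -
      have g: "g \<in> poly_ring ?E" "push vmon g = 0"
        using p(2) that by (auto simp: toric_ideal_eq_push_kernel push_kernel_def)
      \<comment> \<open>A generator involves edges of G only, so the second component of
        \<open>ext_vmon\<close> is 0 on its monomials.\<close>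
      have "push (ext_vmon ?E) g = push (\<lambda>m. (vmon m, 0)) g"
        by (rule push_cong) (use g(1) in \<open>auto simp: ext_vmon_def restr_id poly_ring_def\<close>)
      also have "\<dots> = push (\<lambda>t. (t, 0)) (push vmon g)" by (simp add: push_push)
      also have "\<dots> = 0" by (simp add: g(2))
      finally show ?thesis using g(1) poly_ring_mono[OF assms] by (auto simp: push_kernel_def)
    qed
    then show "p \<in> ?R" unfolding p(1) using p(3) by (intro ring_ideal_sum[OF ker] ring_idealD(4)[OF ker]) auto
  qed
  show "?R \<subseteq> ?L"
  proof
    fix p :: "('a set, 'k) mpoly" assume "p \<in> ?R"
    then have p: "p \<in> poly_ring X" "push (ext_vmon ?E) p = 0" by (auto simp: push_kernel_def)
    show "p \<in> ?L"
    proof (rule push_kernel_binomials[OF _ _ p])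
      show "lin_subspace ?L"
        unfolding lin_subspace_def
      proof (intro conjI ballI allI)
        show "0 \<in> ?L" unfolding ideal_extension_def by (intro CollectI exI[of _ "\<lambda>_. 0"] exI[of _ "{}"]) simp
      next
        fix x y :: "('a set, 'k) mpoly" assume "x \<in> ?L" "y \<in> ?L"
        then obtain r S r' S' where x: "x = (\<Sum>g\<in>S. r g * g)" "finite S" "S \<subseteq> toric_ideal K G" "\<forall>g\<in>S. r g \<in> poly_ring X"
          and y: "y = (\<Sum>g\<in>S'. r' g * g)" "finite S'" "S' \<subseteq> toric_ideal K G" "\<forall>g\<in>S'. r' g \<in> poly_ring X"
          by (auto simp: ideal_extension_def)
        let ?r = "\<lambda>g. (if g \<in> S then r g else 0) + (if g \<in> S' then r' g else 0)"
        have "x = (\<Sum>g\<in>S \<union> S'. (if g \<in> S then r g else 0) * g)"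
          unfolding x(1) using x(2) y(2) by (intro sum.mono_neutral_cong_left) auto
        moreover have "y = (\<Sum>g\<in>S \<union> S'. (if g \<in> S' then r' g else 0) * g)"
          unfolding y(1) using x(2) y(2) by (intro sum.mono_neutral_cong_left) auto
        ultimately have "x + y = (\<Sum>g\<in>S \<union> S'. ?r g * g)"
          by (simp only: sum.distrib distrib_right)
        then show "x + y \<in> ?L"
          unfolding ideal_extension_def using x y
          by (intro CollectI exI[of _ ?r] exI[of _ "S \<union> S'"]) (auto intro!: poly_ring_add)
      next
        fix c and x :: "('a set, 'k) mpoly" assume "x \<in> ?L"
        then obtain r S where x: "x = (\<Sum>g\<in>S. r g * g)" "finite S" "S \<subseteq> toric_ideal K G" "\<forall>g\<in>S. r g \<in> poly_ring X"
          by (auto simp: ideal_extension_def)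
        have "scal c x = (\<Sum>g\<in>S. (Const c * r g) * g)"
          by (simp add: x(1) scal_eq_Const_mult sum_distrib_left mult.assoc)
        then show "scal c x \<in> ?L"
          unfolding ideal_extension_def using x
          by (intro CollectI exI[of _ "\<lambda>g. Const c * r g"] exI[of _ S]) (auto intro!: poly_ring_mult)
      qed
    next
      fix m m' :: "'a set \<Rightarrow>\<^sub>0 nat"
      assume m: "keys m \<subseteq> X" "keys m' \<subseteq> X" "ext_vmon ?E m = ext_vmon ?E m'"
      let ?g = "Poly_Mapping.single (restr ?E m) 1 - Poly_Mapping.single (restr ?E m') (1::'k)"
      let ?u = "Poly_Mapping.single (restr (- ?E) m) (1::'k)"
      have "?u * ?g = Poly_Mapping.single (restr (- ?E) m + restr ?E m) 1 -
          Poly_Mapping.single (restr (- ?E) m + restr ?E m') 1"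
        by (simp add: right_diff_distrib mult_single)
      also have "restr (- ?E) m + restr ?E m = m" by (metis restr_decomp add.commute)
      also have "restr (- ?E) m + restr ?E m' = m'" using m(3) by (metis restr_decomp add.commute ext_vmon_def prod.inject)
      finally have "Poly_Mapping.single m 1 - Poly_Mapping.single m' 1 = (\<Sum>g\<in>{?g}. ?u * g)" by simp
      moreover have "?g \<in> toric_ideal K G"
        using m(3) by (auto simp: toric_ideal_eq_push_kernel push_kernel_def ext_vmon_def
            intro!: poly_ring_diff poly_ring_single)
      moreover have "?u \<in> poly_ring X" using m(1) by (intro poly_ring_single) auto
      ultimately show "Poly_Mapping.single m 1 - Poly_Mapping.single m' 1 \<in> ?L"
        unfolding ideal_extension_def by (intro CollectI exI[of _ "\<lambda>_. ?u"] exI[of _ "{?g}"]) simp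
    qed
  qed
qed

section \<open>Adjoining one generator to an ideal\<close>

lemma ideal_plusI: "g \<in> I \<Longrightarrow> r \<in> poly_ring X \<Longrightarrow> p = g + r * f \<Longrightarrow> p \<in> ideal_plus X I f"
  by (auto simp: ideal_plus_def)

lemma ring_ideal_ideal_plus:
  fixes I :: "('x, 'k::comm_ring_1) mpoly set"
  assumes I: "ring_ideal X I" and f: "f \<in> poly_ring X"
  shows "ring_ideal X (ideal_plus X I f)" "g \<in> I \<Longrightarrow> g \<in> ideal_plus X I f" "f \<in> ideal_plus X I f"
proof -
  show "ring_ideal X (ideal_plus X I f)"
    unfolding ring_ideal_def
  proof (intro conjI ballI)
    show "ideal_plus X I f \<subseteq> poly_ring X"
      using ring_idealD(1)[OF I] f by (auto simp: ideal_plus_def intro!: poly_ring_add poly_ring_mult)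
    show "0 \<in> ideal_plus X I f" by (rule ideal_plusI[of 0 _ 0]) (simp_all add: ring_idealD(2)[OF I])
  next
    fix p q :: "('x, 'k) mpoly" assume "p \<in> ideal_plus X I f" "q \<in> ideal_plus X I f"
    then obtain g r g' r' where "p = g + r * f" "g \<in> I" "r \<in> poly_ring X" "q = g' + r' * f" "g' \<in> I" "r' \<in> poly_ring X"
      by (auto simp: ideal_plus_def)
    then show "p + q \<in> ideal_plus X I f"
      by (intro ideal_plusI[of "g + g'" I "r + r'"])
        (simp_all add: algebra_simps ring_idealD(3)[OF I] poly_ring_add)
  next
    fix s p :: "('x, 'k) mpoly" assume s: "s \<in> poly_ring X" and "p \<in> ideal_plus X I f"
    then obtain g r where "p = g + r * f" "g \<in> I" "r \<in> poly_ring X" by (auto simp: ideal_plus_def)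
    then show "s * p \<in> ideal_plus X I f"
      using s by (intro ideal_plusI[of "s * g" I "s * r"])
        (simp_all add: algebra_simps ring_idealD(5)[OF I] poly_ring_mult)
  qed
  show "g \<in> I \<Longrightarrow> g \<in> ideal_plus X I f" by (rule ideal_plusI[of g _ 0]) simp_all
  show "f \<in> ideal_plus X I f" by (rule ideal_plusI[of 0 _ 1]) (simp_all add: ring_idealD(2)[OF I])
qed

section \<open>Gluing an even cycle\<close>

text \<open>Rotating the enumeration of the cycle moves the prescribed edge to the front, so the
  remaining edges carry the numbers 1 to n - 1.\<close>

lemma cycle_graph_enum:
  assumes "cycle_graph n C" "e \<in> edges C"
  shows "\<exists>q. inj_on q {..<n} \<and> verts C = q ` {..<n} \<and>
    edges C = (\<lambda>k. {q k, q (Suc k mod n)}) ` {..<n} \<and> e = {q 0, q 1}"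
proof -
  obtain p where n: "n \<ge> 3" and p: "length p = n" "distinct p" "verts C = set p"
      "edges C = {{p ! k, p ! (Suc k mod n)} | k. k < n}"
    using assms(1) by (auto simp: cycle_graph_def)
  obtain k0 where k0: "k0 < n" "e = {p ! k0, p ! (Suc k0 mod n)}" using assms(2) p(4) by auto
  let ?s = "\<lambda>k. (k0 + k) mod n"
  define q where "q = (\<lambda>k. p ! ?s k)"
  have q_rotate: "q k = rotate k0 p ! k" if "k < n" for k
    using that p(1) by (simp add: q_def nth_rotate)
  have inj_q: "inj_on q {..<n}"
    using p(1,2) by (auto simp: inj_on_def q_rotate nth_eq_iff_index_eq)
  have inj: "inj_on ?s {..<n}"
    using inj_q unfolding q_def inj_on_def by metis
  have surj: "?s ` {..<n} = {..<n}"
    using n inj by (intro endo_inj_surj) auto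
  moreover have "verts C = q ` {..<n}"
  proof -
    have "verts C = (\<lambda>k. p ! k) ` ?s ` {..<n}"
      unfolding surj p(3) using p(1) by (auto simp: set_conv_nth)
    then show ?thesis by (simp add: q_def image_image)
  qed
  moreover have "edges C = (\<lambda>k. {q k, q (Suc k mod n)}) ` {..<n}"
  proof -
    have "edges C = (\<lambda>k. {p ! k, p ! (Suc k mod n)}) ` ?s ` {..<n}"
      unfolding surj p(4) by auto
    also have "\<dots> = (\<lambda>k. {q k, q (Suc k mod n)}) ` {..<n}"
      by (simp add: q_def image_image mod_simps)
    finally show ?thesis .
  qed
  moreover have "e = {q 0, q 1}" using k0 n by (simp add: q_def)
  ultimately show ?thesis using inj_q by blast
qed

text \<open>\<open>G = (V, E)\<close> with the cycle on \<open>q 0, \<dots>, q (2d - 1)\<close> glued along the edge \<open>{q 0, q 1}\<close>.\<close>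
locale glued_cycle =
  fixes V :: "'v set" and E :: "'v set set" and q :: "nat \<Rightarrow> 'v" and d :: nat
  assumes d: "2 \<le> d"
    and inj: "inj_on q {..<2 * d}"
    and E: "\<And>x. x \<in> E \<Longrightarrow> x \<subseteq> V \<and> card x = 2"
    and new: "\<And>k. 2 \<le> k \<Longrightarrow> k < 2 * d \<Longrightarrow> q k \<notin> V"
    and e: "{q 0, q 1} \<in> E"
begin

text \<open>\<open>c 0\<close> is the glued edge, and the edges numbered 1 to 2d - 1 are the new
  ones.\<close>

definition c :: "nat \<Rightarrow> 'v set" where
  "c k = {q k, q (Suc k mod (2 * d))}"

definition X :: "'v set set" where
  "X = E \<union> c ` {..<2 * d}"

lemma q_eq_iff: "k < 2 * d \<Longrightarrow> l < 2 * d \<Longrightarrow> q k = q l \<longleftrightarrow> k = l"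
  using inj by (auto simp: inj_on_def)

lemma Suc_mod: "k < 2 * d \<Longrightarrow> Suc k mod (2 * d) = (if Suc k = 2 * d then 0 else Suc k)"
  by auto

lemma Suc_mod_less: "Suc k mod (2 * d) < 2 * d"
  using d by simp

lemma card_c: "k < 2 * d \<Longrightarrow> card (c k) = 2"
  using d q_eq_iff[of k "Suc k mod (2 * d)"] Suc_mod_less[of k]
  by (auto simp: c_def Suc_mod card_insert_if split: if_splits)

lemma mem_c_iff: "k < 2 * d \<Longrightarrow> l < 2 * d \<Longrightarrow> q l \<in> c k \<longleftrightarrow> l = k \<or> l = Suc k mod (2 * d)"
  using q_eq_iff Suc_mod_less[of k] by (auto simp: c_def)

lemma c_eq_iff:
  assumes "k < 2 * d" "l < 2 * d"
  shows "c k = c l \<longleftrightarrow> k = l"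
proof
  assume eq: "c k = c l"
  have "q k \<in> c k" "q l \<in> c l" by (simp_all add: c_def)
  then have "q k \<in> c l" "q l \<in> c k" using eq by simp_all
  then have "k = l \<or> k = Suc l mod (2 * d)" "l = k \<or> l = Suc k mod (2 * d)"
    using mem_c_iff assms by blast+
  then show "k = l" using assms d by (auto simp: Suc_mod split: if_splits)
qed simp

lemma c_0: "c 0 \<in> E"
  using e d by (simp add: c_def)

text \<open>Each of these edges has an endpoint outside \<open>V\<close>: its first one if k is at
  least 2, and \<open>q 2\<close> if k = 1.\<close>

lemma c_notin_E:
  assumes "1 \<le> k" "k < 2 * d"
  shows "c k \<notin> E"
proof
  assume "c k \<in> E"
  then have "c k \<subseteq> V" using E by blast
  moreover have "q k \<notin> V \<or> q (Suc k mod (2 * d)) \<notin> V"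
    using new[of k] new[of 2] assms d by (cases "k = 1") (auto simp: numeral_2_eq_2)
  ultimately show False by (auto simp: c_def)
qed

lemma X_cases:
  assumes "x \<in> X" "x \<notin> E"
  obtains k where "1 \<le> k" "k < 2 * d" "x = c k"
proof -
  obtain k where k: "k < 2 * d" "x = c k" using assms by (auto simp: X_def)
  then have "k \<noteq> 0" using assms(2) c_0 by metis
  then show thesis using that[of k] k by simp
qed

lemma card_X: "x \<in> X \<Longrightarrow> card x = 2"
  using E card_c by (auto simp: X_def)

lemma c_in_X: "k < 2 * d \<Longrightarrow> c k \<in> X"
  by (auto simp: X_def)

text \<open>A new vertex lies on exactly two edges of the glued graph. Equating its exponents in two
  monomials therefore links consecutive edges of the path.\<close>

lemma lookup_vmon_new:
  assumes m: "keys m \<subseteq> X" and k: "1 \<le> k" "Suc k < 2 * d"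
  shows "lookup (vmon m) (q (Suc k)) = lookup m (c k) + lookup m (c (Suc k))"
proof -
  have iff: "q (Suc k) \<in> x \<longleftrightarrow> x = c k \<or> x = c (Suc k)" if x: "x \<in> X" for x
  proof (cases "x \<in> E")
    case True
    then have "q (Suc k) \<notin> x" using E new[of "Suc k"] k by auto
    moreover have "x \<noteq> c k" "x \<noteq> c (Suc k)" using True c_notin_E k by auto
    ultimately show ?thesis by simp
  next
    case False
    with x obtain l where l: "1 \<le> l" "l < 2 * d" "x = c l" by (rule X_cases)
    then show ?thesis using k by (auto simp: mem_c_iff c_eq_iff Suc_mod split: if_splits)
  qed
  have ne: "c k \<noteq> c (Suc k)" using k c_eq_iff[of k "Suc k"] by simp
  have fin: "finite x" if "x \<in> keys m" for x using card_X[of x] m that card.infinite by fastforce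
  have "lookup (vmon m) (q (Suc k)) = (\<Sum>x\<in>keys m. if q (Suc k) \<in> x then lookup m x else 0)"
    using fin by (rule lookup_vmon)
  also have "\<dots> = (\<Sum>x\<in>keys m. (if x = c k then lookup m x else 0) + (if x = c (Suc k) then lookup m x else 0))"
    using m iff ne by (intro sum.cong refl) auto
  also have "\<dots> = lookup m (c k) + lookup m (c (Suc k))"
    by (simp add: sum.distrib in_keys_iff)
  finally show ?thesis .
qed

text \<open>\<open>A n\<close> and \<open>B n\<close> are the exponents of the n-th powers of the
  two terms of \<open>f\<close>. The glued edge \<open>c 0\<close> belongs to \<open>A\<close>,
  while all edges in \<open>B\<close> are new.\<close>

definition A :: "nat \<Rightarrow> 'v set \<Rightarrow>\<^sub>0 nat" where
  "A n = (\<Sum>k<d. Poly_Mapping.single (c (2 * k)) n)"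

definition B :: "nat \<Rightarrow> 'v set \<Rightarrow>\<^sub>0 nat" where
  "B n = (\<Sum>k<d. Poly_Mapping.single (c (2 * k + 1)) n)"

lemma vmon_c: "k < 2 * d \<Longrightarrow>
    vmon (Poly_Mapping.single (c k) n) = Poly_Mapping.single (q k) n + Poly_Mapping.single (q (Suc k mod (2 * d))) n"
  using d q_eq_iff[of k "Suc k mod (2 * d)"] Suc_mod_less[of k]
  by (auto simp: vmon_single c_def Suc_mod split: if_splits)

text \<open>The even and the odd edges of an even cycle are both perfect matchings of its
  vertices.\<close>

lemma vmon_A_eq_B: "vmon (A n) = vmon (B n)"
proof -
  let ?g = "\<lambda>k. Poly_Mapping.single (q k) n"
  obtain d' where d': "d = Suc d'" using d by (cases d) auto
  have "vmon (A n) = (\<Sum>k<d. ?g (2 * k) + ?g (2 * k + 1))"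
    unfolding A_def vmon_sum by (intro sum.cong refl) (auto simp: vmon_c)
  also have "\<dots> = (\<Sum>k<d. ?g (2 * k + 1)) + (\<Sum>k<d. ?g (2 * k))" by (simp add: sum.distrib add.commute)
  also have "(\<Sum>k<d. ?g (2 * k)) = (\<Sum>k<d'. ?g (2 * k + 2)) + ?g 0"
    unfolding d' by (subst sum.lessThan_Suc_shift) (simp add: add.commute)
  \<comment> \<open>The vertex \<open>q 0\<close> split off at the front returns at the end, as the
    successor of the last index modulo 2d.\<close>
  also have "\<dots> = (\<Sum>k<d. ?g (Suc (2 * k + 1) mod (2 * d)))"
    unfolding d' sum.lessThan_Suc by simp
  also have "(\<Sum>k<d. ?g (2 * k + 1)) + \<dots> = vmon (B n)"
    unfolding B_def vmon_sum sum.distrib[symmetric] by (intro sum.cong refl) (simp add: vmon_c)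
  finally show ?thesis .
qed

lemma lookup_A: "k < 2 * d \<Longrightarrow> lookup (A n) (c k) = (if even k then n else 0)"
proof -
  assume k: "k < 2 * d"
  have "lookup (A n) (c k) = (\<Sum>l<d. if 2 * l = k then n else 0)"
    unfolding A_def lookup_sum using k by (intro sum.cong refl) (auto simp: lookup_single when_def c_eq_iff)
  also have "\<dots> = (\<Sum>l<d. if l = k div 2 then (if even k then n else 0) else 0)"
    by (intro sum.cong refl) auto
  also have "\<dots> = (if even k then n else 0)" using k by auto
  finally show ?thesis .
qed

lemma lookup_B: "k < 2 * d \<Longrightarrow> lookup (B n) (c k) = (if odd k then n else 0)"
proof -
  assume k: "k < 2 * d"
  have "lookup (B n) (c k) = (\<Sum>l<d. if 2 * l + 1 = k then n else 0)"
    unfolding B_def lookup_sum using k by (intro sum.cong refl) (auto simp: lookup_single when_def c_eq_iff)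
  also have "\<dots> = (\<Sum>l<d. if l = k div 2 then (if odd k then n else 0) else 0)"
    by (intro sum.cong refl) auto
  also have "\<dots> = (if odd k then n else 0)" using k by auto
  finally show ?thesis .
qed

lemma keys_A: "keys (A n) \<subseteq> X" and keys_B: "keys (B n) \<subseteq> c ` {k. k < 2 * d \<and> odd k}"
proof -
  have "keys (A n) \<subseteq> (\<Union>k<d. keys (Poly_Mapping.single (c (2 * k)) n))"
    unfolding A_def by (rule Poly_Mapping.keys_sum)
  also have "\<dots> \<subseteq> X" by (auto intro!: c_in_X)
  finally show "keys (A n) \<subseteq> X" .
  have "keys (B n) \<subseteq> (\<Union>k<d. keys (Poly_Mapping.single (c (2 * k + 1)) n))"
    unfolding B_def by (rule Poly_Mapping.keys_sum)
  also have "\<dots> \<subseteq> c ` {k. k < 2 * d \<and> odd k}" by (auto intro!: imageI)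
  finally show "keys (B n) \<subseteq> c ` {k. k < 2 * d \<and> odd k}" .
qed

lemma keys_B_X: "keys (B n) \<subseteq> X"
  using keys_B c_in_X by blast

definition f :: "('v set, 'k::field) mpoly" where
  "f = Poly_Mapping.single (A 1) 1 - Poly_Mapping.single (B 1) 1"

lemma f_poly_ring: "f \<in> poly_ring X"
  unfolding f_def using keys_A keys_B_X by (intro poly_ring_diff poly_ring_single) auto

lemma mon_degree_A: "mon_degree (A n) = d * n" and mon_degree_B: "mon_degree (B n) = d * n"
  by (simp_all add: A_def B_def mon_degree_sum)

lemma homogeneous_f: "homogeneous (int d) f"
  unfolding f_def by (intro homogeneous_diff) (simp_all add: homogeneous_def mon_degree_A mon_degree_B)

lemma lookup_f_0: "lookup f 0 = 0"
proof -
  have "A 1 \<noteq> 0" "B 1 \<noteq> 0" using mon_degree_A[of 1] mon_degree_B[of 1] d by auto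
  then show ?thesis by (simp add: f_def lookup_minus lookup_single when_def)
qed

lemma f_vmon: "f \<in> push_kernel X vmon"
  using f_poly_ring vmon_A_eq_B[of 1] by (simp add: push_kernel_def f_def)

lemma f_nonzerodivisor:
  fixes p :: "('v set, 'k::field) mpoly"
  assumes "p \<in> poly_ring X" "f * p \<in> push_kernel X (ext_vmon E)"
  shows "p \<in> push_kernel X (ext_vmon E)"
proof (rule push_kernel_nonzerodivisor[where \<mu> = "ext_vmon E" and h = "\<lambda>t. lookup (snd t) (c 1)"])
  \<comment> \<open>The height is the exponent of the new odd edge \<open>c 1\<close>, which
    \<open>ext_vmon\<close> leaves untouched: it is 0 in \<open>A 1\<close> and 1 in
    \<open>B 1\<close>.\<close>
  show "lookup (snd (ext_vmon E (A 1))) (c 1) < lookup (snd (ext_vmon E (B 1))) (c 1)"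
    using d lookup_A[of 1 1] lookup_B[of 1 1] c_notin_E[of 1] by (simp add: ext_vmon_def)
qed (use assms in \<open>simp_all add: ext_vmon_add lookup_add f_def\<close>)

lemma push_kernel_ext_subset: "push_kernel X (ext_vmon E) \<subseteq> (push_kernel X vmon :: ('v set, 'k::field) mpoly set)"
proof
  fix p :: "('v set, 'k) mpoly" assume p: "p \<in> push_kernel X (ext_vmon E)"
  have "push vmon p = push (\<lambda>t. fst t + vmon (snd t)) (push (ext_vmon E) p)"
    by (simp add: push_push ext_vmon_def vmon_add[symmetric] restr_decomp)
  then show "p \<in> push_kernel X vmon" using p by (simp add: push_kernel_def)
qed

text \<open>At each inner vertex of the path the exponents of its two edges have the same sum in
  \<open>m\<close> and \<open>m'\<close>. An excess of \<open>n\<close> at one edge is thus a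
  deficit of \<open>n\<close> at the next.\<close>

lemma exponent_difference:
  assumes m: "keys m \<subseteq> X" "keys m' \<subseteq> X" "vmon m = vmon m'"
    and n: "lookup m (c 1) = lookup m' (c 1) + n"
    and k: "1 \<le> k" "k < 2 * d"
  shows "if odd k then lookup m (c k) = lookup m' (c k) + n else lookup m' (c k) = lookup m (c k) + n"
  using k
proof (induction k rule: nat_induct_at_least)
  case base
  then show ?case using n by simp
next
  case (Suc k)
  then have "lookup m (c k) + lookup m (c (Suc k)) = lookup m' (c k) + lookup m' (c (Suc k))"
    using lookup_vmon_new[OF m(1)] lookup_vmon_new[OF m(2)] m(3) by metis
  then show ?case using Suc by (auto split: if_splits)
qed

section \<open>The toric ideal of the glued graph\<close>

abbreviation J :: "('v set, 'k::field) mpoly set" where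
  "J \<equiv> ideal_plus X (push_kernel X (ext_vmon E)) f"

lemmas J_ideal = ring_ideal_ideal_plus[OF ring_ideal_push_kernel[where \<mu> = "ext_vmon E" and X = X, OF ext_vmon_add] f_poly_ring]

text \<open>Modulo \<open>f\<close> the excess of \<open>m\<close> at the odd edges of the cycle can be moved to the even edges, after
  which \<open>m\<close> and \<open>m'\<close> agree outside \<open>E\<close>.\<close>
lemma binomial_in_J_aux:
  assumes m: "keys m \<subseteq> X" "keys m' \<subseteq> X" "vmon m = vmon m'"
    and le: "lookup m' (c 1) \<le> lookup m (c 1)"
  shows "Poly_Mapping.single m 1 - Poly_Mapping.single m' (1::'k::field) \<in> J"
proof -
  obtain n where n: "lookup m (c 1) = lookup m' (c 1) + n" using le le_Suc_ex by blast
  note diff = exponent_difference[OF m n]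
  define m0 where "m0 = m - B n"
  \<comment> \<open>Subtraction of exponents is truncated, so \<open>B n\<close> must divide
    \<open>m\<close>; it does, because \<open>m\<close> exceeds \<open>m'\<close> by
    \<open>n\<close> at every odd edge of the cycle.\<close>
  have m0: "m = m0 + B n"
  proof (rule poly_mapping_eqI)
    fix x
    have "lookup (B n) x \<le> lookup m x"
    proof (cases "x \<in> keys (B n)")
      case True
      then obtain k where k: "k < 2 * d" "odd k" "x = c k" using keys_B by blast
      moreover have "1 \<le> k" using k(2) by (cases k) auto
      ultimately show ?thesis using diff[of k] by (simp add: lookup_B)
    qed (simp add: in_keys_iff)
    then show "lookup m x = lookup (m0 + B n) x" by (simp add: m0_def lookup_add lookup_minus)
  qed
  define m1 where "m1 = m0 + A n"
  have keys_m0: "keys m0 \<subseteq> X" using m(1) unfolding m0 by (simp add: keys_add_nat)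
  then have keys_m1: "keys m1 \<subseteq> X" using keys_A by (simp add: m1_def keys_add_nat)
  have vmon_m1: "vmon m1 = vmon m'"
    using m(3) by (simp add: m1_def m0 vmon_add vmon_A_eq_B)
  have restr_m1: "restr (- E) m1 = restr (- E) m'"
  proof (rule poly_mapping_eqI)
    fix x
    \<comment> \<open>Replacing \<open>B n\<close> by \<open>A n\<close> removes the excess
      \<open>n\<close> at odd edges and fills the deficit \<open>n\<close> at the new even
      ones.\<close>
    have "lookup m1 x = lookup m' x" if "x \<notin> E"
    proof (cases "x \<in> X")
      case True
      then obtain k where k: "1 \<le> k" "k < 2 * d" "x = c k" using \<open>x \<notin> E\<close> by (rule X_cases)
      have "lookup m (c k) = lookup m0 (c k) + lookup (B n) (c k)" by (simp add: m0 lookup_add)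
      then show ?thesis using diff[OF k(1,2)] k
        by (auto simp: m1_def lookup_add lookup_A lookup_B split: if_splits)
    next
      case False
      then have "lookup m1 x = 0" "lookup m' x = 0" using keys_m1 m(2) by (auto simp: in_keys_iff)
      then show ?thesis by simp
    qed
    then show "lookup (restr (- E) m1) x = lookup (restr (- E) m') x" by simp
  qed
  \<comment> \<open>The contributions of the new edges are equal and cancel from the total vertex
    exponents.\<close>
  have "ext_vmon E m1 = ext_vmon E m'"
  proof -
    have "vmon (restr E m1) + vmon (restr (- E) m1) = vmon (restr E m') + vmon (restr (- E) m')"
      unfolding vmon_add[symmetric] restr_decomp by (rule vmon_m1)
    then show ?thesis using restr_m1 by (simp add: ext_vmon_def)
  qed
  then have "Poly_Mapping.single m1 1 - Poly_Mapping.single m' (1::'k) \<in> push_kernel X (ext_vmon E)"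
    using keys_m1 m(2) by (auto simp: push_kernel_def intro!: poly_ring_diff poly_ring_single)
  then have 1: "Poly_Mapping.single m1 1 - Poly_Mapping.single m' (1::'k) \<in> J" by (rule J_ideal(2))
  define a b :: "('v set, 'k) mpoly" where ab: "a = Poly_Mapping.single (A 1) 1" "b = Poly_Mapping.single (B 1) 1"
  have f_eq: "f = a - b" unfolding f_def ab ..
  have pow: "Poly_Mapping.single (A n) (1::'k) = a ^ n" "Poly_Mapping.single (B n) (1::'k) = b ^ n" for n
    unfolding ab A_def B_def prod_Var_power[symmetric] by simp_all
  have poly_ring_ab: "a \<in> poly_ring X" "b ^ n \<in> poly_ring X" for n
    using keys_A keys_B_X unfolding pow[symmetric] by (auto simp: ab intro!: poly_ring_single)
  have "a ^ n - b ^ n \<in> J"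
  proof (induction n)
    case 0
    then show ?case using ring_idealD(2)[OF J_ideal(1)] by simp
  next
    case (Suc n)
    \<comment> \<open>This is the inductive form of the divisibility of a^n - b^n by a - b.\<close>
    have "a ^ Suc n - b ^ Suc n = a * (a ^ n - b ^ n) + b ^ n * f"
      by (simp add: f_eq algebra_simps)
    also have "\<dots> \<in> J"
      by (intro ring_idealD(3)[OF J_ideal(1)] ring_idealD(4)[OF J_ideal(1)] poly_ring_ab Suc.IH J_ideal(3))
    finally show ?case .
  qed
  then have "Poly_Mapping.single (A n) 1 - Poly_Mapping.single (B n) (1::'k) \<in> J" by (simp only: pow)
  moreover have "Poly_Mapping.single m0 (1::'k) \<in> poly_ring X" using keys_m0 by (rule poly_ring_single)
  ultimately have "Poly_Mapping.single m0 1 * (Poly_Mapping.single (A n) 1 - Poly_Mapping.single (B n) (1::'k)) \<in> J"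
    by (intro ring_idealD(4)[OF J_ideal(1)])
  then have 2: "Poly_Mapping.single m1 1 - Poly_Mapping.single m (1::'k) \<in> J"
    by (simp add: right_diff_distrib mult_single m1_def m0)
  show ?thesis using ring_idealD(7)[OF J_ideal(1) 1 2] by simp
qed

lemma push_kernel_vmon: "push_kernel X vmon = (J :: ('v set, 'k::field) mpoly set)"
proof
  show "push_kernel X vmon \<subseteq> (J :: ('v set, 'k) mpoly set)"
  proof
    fix p :: "('v set, 'k) mpoly" assume "p \<in> push_kernel X vmon"
    then have p: "p \<in> poly_ring X" "push vmon p = 0" by (auto simp: push_kernel_def)
    show "p \<in> J"
    proof (rule push_kernel_binomials[OF ring_ideal_lin_subspace[OF J_ideal(1)] _ p])
      fix m m' assume m: "keys m \<subseteq> X" "keys m' \<subseteq> X" "vmon m = vmon m'"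
      show "Poly_Mapping.single m 1 - Poly_Mapping.single m' (1::'k) \<in> J"
      \<comment> \<open>The case distinction decides which monomial has the excess at
        \<open>c 1\<close>; exchanging the two only changes the sign of the binomial.\<close>
      proof (cases "lookup m' (c 1) \<le> lookup m (c 1)")
        case True
        then show ?thesis using m by (intro binomial_in_J_aux)
      next
        case False
        then have "Poly_Mapping.single m' 1 - Poly_Mapping.single m (1::'k) \<in> J"
          using m by (intro binomial_in_J_aux) auto
        from ring_idealD(6)[OF J_ideal(1) this] show ?thesis by simp
      qed
    qed
  qed
  show "(J :: ('v set, 'k) mpoly set) \<subseteq> push_kernel X vmon"
  proof
    fix p :: "('v set, 'k) mpoly" assume "p \<in> J"
    then obtain g r where gr: "p = g + r * f" "g \<in> push_kernel X (ext_vmon E)" "r \<in> poly_ring X"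
      by (auto simp: ideal_plus_def)
    note ker = ring_ideal_push_kernel[where \<mu> = vmon and X = X, OF vmon_add]
    show "p \<in> push_kernel X vmon"
      unfolding gr(1) using gr(2,3) push_kernel_ext_subset
      by (intro ring_idealD(3)[OF ker] ring_idealD(4)[OF ker] f_vmon) auto
  qed
qed

text \<open>Handshake identity: the vertex exponents sum to twice the number of edges, so
  \<open>vmon\<close> determines the degree. This makes both kernels homogeneous.\<close>

lemma vmon_mon_degree:
  assumes "keys m \<subseteq> X" "keys m' \<subseteq> X" "vmon m = vmon m'"
  shows "mon_degree m = mon_degree m'"
proof -
  have "mon_degree (vmon m) = 2 * mon_degree m" if "keys m \<subseteq> X" for m
    using that card_X by (intro mon_degree_vmon) auto
  from this[OF assms(1)] this[OF assms(2)] assms(3) show ?thesis by simp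
qed

lemma betti_glued_cycle:
  fixes i j :: int
  assumes "finite X" "i \<ge> 0" "j \<ge> 0"
  shows "betti X (push_kernel X vmon :: ('v set, 'k::field) mpoly set) i j =
    betti X (push_kernel X (ext_vmon E) :: ('v set, 'k) mpoly set) i j +
    betti X (push_kernel X (ext_vmon E) :: ('v set, 'k) mpoly set) (i - 1) (j - int d)"
proof -
  let ?I = "push_kernel X (ext_vmon E) :: ('v set, 'k) mpoly set"
  have I: "ring_ideal X ?I" by (rule ring_ideal_push_kernel[OF ext_vmon_add])
  have "vmon m = (case ext_vmon E m of (s, t) \<Rightarrow> s + vmon t)" for m
    by (simp add: ext_vmon_def vmon_add[symmetric] restr_decomp)
  then have ext: "vmon m = vmon m'" if "ext_vmon E m = ext_vmon E m'" for m m'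
    using that by metis
  have hom: "pcomp n p \<in> ?I" if "p \<in> ?I" for n p
    by (rule push_kernel_pcomp[OF _ that]) (rule vmon_mon_degree, assumption, assumption, erule ext)
  have hom': "pcomp n p \<in> J" if "p \<in> (J :: ('v set, 'k) mpoly set)" for n p
    using that unfolding push_kernel_vmon[symmetric]
    by (rule push_kernel_pcomp[rotated]) (rule vmon_mon_degree)
  obtain F where "graded_free_resolution X ?I F" "degreewise_finite F"
    using degreewise_finite_resolution_exists[OF assms(1) I hom] by blast
  then show ?thesis
    unfolding push_kernel_vmon
    using betti_ideal_plus[of X ?I f _ "int d" i j, OF I hom J_ideal(1) hom' _ _
        f_poly_ring homogeneous_f lookup_f_0 f_nonzerodivisor assms(2,3)]
    by fast
qed

end

theorem corollary3p12:
  fixes G H :: "'v graph" and e :: "'v set" and d :: nat and i j :: int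
    and K :: "'k::{alg_closed_field, field_char_0} itself"
  assumes "finite_simple_graph G"
    and "e \<in> edges G"
    and "2 * d \<ge> 4"
    and "cycle_connected_along G e (2 * d) H"
    and "i \<ge> 0" and "j \<ge> 0"
  shows "betti (edges H) (toric_ideal K H) i j =
           betti (edges H) (ideal_extension (edges H) (toric_ideal K G)) i j
         + betti (edges H) (ideal_extension (edges H) (toric_ideal K G)) (i - 1) (j - int d)"
proof -
  obtain C where C: "cycle_graph (2 * d) C" "e \<in> edges C" "verts G \<inter> verts C = e"
      "edges H = edges G \<union> edges C"
    using assms(4) by (auto simp: cycle_connected_along_def)
  obtain q where q: "inj_on q {..<2 * d}" "verts C = q ` {..<2 * d}"
      "edges C = (\<lambda>k. {q k, q (Suc k mod (2 * d))}) ` {..<2 * d}" "e = {q 0, q 1}"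
    using cycle_graph_enum[OF C(1,2)] by blast
  interpret glued_cycle "verts G" "edges G" q d
  proof
    show "2 \<le> d" using assms(3) by simp
    show "x \<subseteq> verts G \<and> card x = 2" if "x \<in> edges G" for x
      using assms(1) that by (simp add: finite_simple_graph_def)
    show "{q 0, q 1} \<in> edges G" using assms(2) q(4) by simp
    fix k assume k: "2 \<le> k" "k < 2 * d"
    show "q k \<notin> verts G"
    \<comment> \<open>G and the cycle share only the endpoints of \<open>e\<close>, which carry the
      numbers 0 and 1.\<close>
    proof
      assume "q k \<in> verts G"
      then have "q k \<in> {q 0, q 1}" using C(3) q(2,4) k by auto
      then show False using inj_onD[OF q(1), of k 0] inj_onD[OF q(1), of k 1] k by auto
    qed
  qed (rule q(1))
  have X: "edges H = X" unfolding C(4) q(3) X_def c_def ..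
  have "finite (verts G)" "edges G \<subseteq> Pow (verts G)" using assms(1) by (auto simp: finite_simple_graph_def)
  then have "finite X" unfolding X_def by (auto intro: finite_subset)
  from betti_glued_cycle[OF this assms(5,6)] show ?thesis
    using ideal_extension_eq_push_kernel[of G "edges H" K] unfolding X toric_ideal_eq_push_kernel
    by (simp add: X toric_ideal_eq_push_kernel X_def)
qed

end
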